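(* For every integer $k \geq 4$ the following chain of inclusions in $\mathbb{G}_k$ holds: $$P_k \subsetneq \Sigma_k \subsetneq C_k \subseteq \mathrm{Cut}_0(\mathbb{G}_k).$$ In particular, if $\mathrm{Cut}_0(\mathbb{G}_k)$ is semi-algebraic, then $\mathrm{codim}(\mathrm{Cut}_0(\mathbb{G}_k)) \leq 2$, for all $k$.
   Context: Let $k\geq 2$. Identify $\wedge^2\mathbb{R}^k$ with the space of $k\times k$ real skew-symmetric matrices, via $v\wedge w = vw^* - wv^*$ ($^*$ = transpose). Let $\mathbb{G}_k = \mathbb{R}^k\oplus\wedge^2\mathbb{R}^k$, with points denoted $(x,Y)$, origin $0=(0,0)$, and dimension $k(k+1)/2$. It is the free, step $2$ Carnot group of rank $k$, i.e. the sub-Riemannian structure for which the vector fields $X_i = \partial_{x_i} - \frac12\sum_{1\leq \ell<m\leq k}(e_i\wedge x)_{\ell m}\partial_{Y_{\ell m}}$, $i=1,\dots,k$, are a global orthonormal frame of the horizontal distribution ($e_1,\dots,e_k$ is the standard basis of $\mathbb{R}^k$). A Lipschitz curve $\gamma=(x(\cdot),Y(\cdot)):[0,T]\to\mathbb{G}_k$ is horizontal if $\dot\gamma=\sum_i u_iX_i(\gamma)$ a.e. for some control $u\in L^\infty([0,T],\mathbb{R}^k)$, equivalently $\dot x=u$, $\dot Y=\frac12 x\wedge u$; its length is $L(\gamma)=\int_0^T|u(t)|\,dt$. The distance $d$ is the infimum of lengths of horizontal curves joining two points; it is complete. A geodesic is a non-trivial constant-speed horizontal curve that locally minimizes the length between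 its endpoints; it is minimizing if its length equals the distance between its endpoints; it is maximal if it is not the restriction of a geodesic defined on a larger interval $[0,T']$. The cut time of a maximal geodesic $\gamma$ is $t_{\mathrm{cut}}(\gamma)=\sup\{t>0 : \gamma|_{[0,t]}\text{ is a minimizing geodesic}\}$. The cut locus (from the origin) is $\mathrm{Cut}_0(\mathbb{G}_k)=\{\gamma(t_{\mathrm{cut}}(\gamma)) : \gamma \text{ maximal geodesic starting at } 0 \text{ (with } t_{\mathrm{cut}}(\gamma)<\infty)\}$. Define - $P_k=\{(x,Y)\in\mathbb{G}_k : Y=v\wedge w\neq 0 \text{ for some } v,w\in\mathbb{R}^k,\ Yx=0\}$; - $\Sigma_k=\{(x,Y)\in\mathbb{G}_k : Y\neq 0,\ Yx=0\}$; - $C_k$ = the set of $(x,Y)\in\mathbb{G}_k$ with $Y\neq 0$ such that there exists $M\in\mathrm{O}(k)$, $M\neq\mathbb{1}$, with $Mx=x$, $MYM^*=Y$ and $Mv=v$ for all $v\in\ker Y$. A subset of $\mathbb{R}^n$ is semi-algebraic if it is obtained by finitely many unions and intersections of sets of the form $\{f=0\}$, $\{g>0\}$ with $f,g$ polynomials; dimension and codimension are in the sense of semi-algebraic sets. *)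

theory Defs
  imports "HOL-Analysis.Analysis"
begin

section \<open>The free step 2 Carnot group of rank \<open>k = CARD('k)\<close>\<close>

text \<open>
  Points are pairs \<open>(x, Y)\<close> in the ambient space of vectors and square matrices; the group
  itself is the linear subspace on which \<open>Y\<close> is skew-symmetric.
\<close>

type_synonym 'k point = "(real ^ 'k) \<times> (real ^ 'k ^ 'k)"

definition carnot_group :: "('k::finite) point set" where
  "carnot_group = {(x, Y). transpose Y = - Y}"

definition wedge :: "real ^ 'k \<Rightarrow> real ^ 'k \<Rightarrow> real ^ 'k ^ 'k" where
  "wedge v w = (\<chi> i j. v $ i * w $ j - w $ i * v $ j)"

text \<open>
  A sum over \<open>l < m\<close> of \<open>A\<^sub>l\<^sub>m\<close> times the coordinate field of \<open>Y\<^sub>l\<^sub>m\<close>, with \<open>A\<close> skew-symmetric,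
  is the vector field with matrix component \<open>A\<close>; hence no ordering of the index type is needed.
\<close>

definition frame_field :: "'k \<Rightarrow> ('k::finite) point \<Rightarrow> 'k point" where
  "frame_field i p = (axis i 1, - (1/2) *\<^sub>R wedge (axis i 1) (fst p))"

definition is_control ::
  "real \<Rightarrow> real \<Rightarrow> (real \<Rightarrow> ('k::finite) point) \<Rightarrow> (real \<Rightarrow> real ^ 'k) \<Rightarrow> bool" where
  "is_control a b \<gamma> u \<longleftrightarrow>
     \<gamma> ` {a..b} \<subseteq> carnot_group \<and>
     (\<exists>L. L-lipschitz_on {a..b} \<gamma>) \<and>
     u \<in> borel_measurable (lebesgue_on {a..b}) \<and>
     (\<exists>C. AE t in lebesgue_on {a..b}. norm (u t) \<le> C) \<and>
     (AE t in lebesgue_on {a..b}.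
        (\<gamma> has_vector_derivative (\<Sum>i\<in>UNIV. (u t $ i) *\<^sub>R frame_field i (\<gamma> t)))
          (at t within {a..b}))"

definition horizontal :: "real \<Rightarrow> real \<Rightarrow> (real \<Rightarrow> ('k::finite) point) \<Rightarrow> bool" where
  "horizontal a b \<gamma> \<longleftrightarrow> (\<exists>u. is_control a b \<gamma> u)"

text \<open>
  A control is determined by its curve up to a null set, so the length does not depend on it;
  see \<open>curve_length_eq\<close> below.
\<close>

definition curve_length :: "real \<Rightarrow> real \<Rightarrow> (real \<Rightarrow> ('k::finite) point) \<Rightarrow> real" where
  "curve_length a b \<gamma> =
     (THE l. \<exists>u. is_control a b \<gamma> u \<and> l = integral\<^sup>L (lebesgue_on {a..b}) (\<lambda>t. norm (u t)))"

definition cc_dist :: "('k::finite) point \<Rightarrow> 'k point \<Rightarrow> real" where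
  "cc_dist p q =
     Inf {curve_length 0 T \<gamma> | T \<gamma>. 0 < T \<and> horizontal 0 T \<gamma> \<and> \<gamma> 0 = p \<and> \<gamma> T = q}"

definition minimizing :: "real \<Rightarrow> real \<Rightarrow> (real \<Rightarrow> ('k::finite) point) \<Rightarrow> bool" where
  "minimizing a b \<gamma> \<longleftrightarrow>
     horizontal a b \<gamma> \<and> curve_length a b \<gamma> = cc_dist (\<gamma> a) (\<gamma> b)"

text \<open>
  The domain of a geodesic is an interval with left endpoint \<open>0\<close> that contains \<open>0\<close>. It may be
  half-open or unbounded: maximal geodesics are defined on all of \<open>{0..}\<close>. Only the values on
  the domain \<open>J\<close> matter.
\<close>

definition geodesic :: "real set \<Rightarrow> (real \<Rightarrow> ('k::finite) point) \<Rightarrow> bool" where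
  "geodesic J \<gamma> \<longleftrightarrow>
     is_interval J \<and> 0 \<in> J \<and> J \<subseteq> {0..} \<and>
     \<not> \<gamma> constant_on J \<and>
     (\<exists>c. \<forall>T\<in>J. 0 < T \<longrightarrow>
        (\<exists>u. is_control 0 T \<gamma> u \<and> (AE t in lebesgue_on {0..T}. norm (u t) = c))) \<and>
     (\<forall>t\<in>J. \<exists>\<epsilon>>0. \<forall>a b. a < b \<and> {a..b} \<subseteq> J \<inter> {t - \<epsilon>..t + \<epsilon>} \<longrightarrow> minimizing a b \<gamma>)"

definition maximal_geodesic :: "real set \<Rightarrow> (real \<Rightarrow> ('k::finite) point) \<Rightarrow> bool" where
  "maximal_geodesic J \<gamma> \<longleftrightarrow>
     geodesic J \<gamma> \<and> \<not> (\<exists>J' \<gamma>'. J \<subset> J' \<and> geodesic J' \<gamma>' \<and> (\<forall>t\<in>J. \<gamma>' t = \<gamma> t))"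

definition cut_time :: "real set \<Rightarrow> (real \<Rightarrow> ('k::finite) point) \<Rightarrow> ereal" where
  "cut_time J \<gamma> =
     Sup (ereal ` {t. 0 < t \<and> t \<in> J \<and> geodesic {0..t} \<gamma> \<and> minimizing 0 t \<gamma>})"

definition cut_locus :: "('k::finite) point set" where
  "cut_locus =
     {\<gamma> t | J \<gamma> t. maximal_geodesic J \<gamma> \<and> \<gamma> 0 = 0 \<and> t \<in> J \<and> cut_time J \<gamma> = ereal t}"

section \<open>The sets in the chain of inclusions\<close>

definition P_set :: "('k::finite) point set" where
  "P_set = {(x, Y). (\<exists>v w. Y = wedge v w) \<and> Y \<noteq> 0 \<and> Y *v x = 0}"

definition Sigma_set :: "('k::finite) point set" where
  "Sigma_set = {(x, Y). (x, Y) \<in> carnot_group \<and> Y \<noteq> 0 \<and> Y *v x = 0}"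

definition C_set :: "('k::finite) point set" where
  "C_set = {(x, Y). (x, Y) \<in> carnot_group \<and> Y \<noteq> 0 \<and>
     (\<exists>M. orthogonal_matrix M \<and> M \<noteq> mat 1 \<and> M *v x = x \<and>
          M ** Y ** transpose M = Y \<and> (\<forall>v. Y *v v = 0 \<longrightarrow> M *v v = v))}"

section \<open>Semi-algebraic sets and their dimension\<close>

inductive semialgebraic :: "'a::euclidean_space set \<Rightarrow> bool" where
  eq_zero: "real_polynomial_function f \<Longrightarrow> semialgebraic {x. f x = 0}"
| pos: "real_polynomial_function g \<Longrightarrow> semialgebraic {x. g x > 0}"
| union: "semialgebraic A \<Longrightarrow> semialgebraic B \<Longrightarrow> semialgebraic (A \<union> B)"
| inter: "semialgebraic A \<Longrightarrow> semialgebraic B \<Longrightarrow> semialgebraic (A \<inter> B)"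

text \<open>
  The open cube of dimension \<open>card B\<close>, placed in the coordinate subspace spanned by \<open>B\<close>.
\<close>

definition open_cube :: "'a::euclidean_space set \<Rightarrow> 'a set" where
  "open_cube B = {x. (\<forall>b\<in>B. 0 < x \<bullet> b \<and> x \<bullet> b < 1) \<and> (\<forall>b\<in>Basis - B. x \<bullet> b = 0)}"

text \<open>
  Cells of dimension \<open>d\<close>: semi-algebraic sets that are semi-algebraically homeomorphic to an open
  cube of dimension \<open>d\<close>. A cell in \<open>'a\<close> has dimension at most \<open>DIM('a)\<close>, so its model cube
  can be taken inside \<open>'a\<close> as well.
\<close>

definition semialgebraic_cell :: "nat \<Rightarrow> 'a::euclidean_space set \<Rightarrow> bool" where
  "semialgebraic_cell d S \<longleftrightarrow> semialgebraic S \<and>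
     (\<exists>(B :: 'a set) f g. B \<subseteq> Basis \<and> card B = d \<and> homeomorphism (open_cube B) S f g \<and>
        semialgebraic ((\<lambda>t. (t, f t)) ` open_cube B))"

text \<open>
  The dimension of a semi-algebraic set is the largest dimension of a cell contained in it, and
  \<open>-\<infinity>\<close> for the empty set.
\<close>

definition semialgebraic_dim :: "'a::euclidean_space set \<Rightarrow> ereal" where
  "semialgebraic_dim A = Sup {ereal (real d) | d. \<exists>S\<subseteq>A. semialgebraic_cell d S}"

text \<open>Codimension in the group; its linear dimension is computed in \<open>dim_carnot_group\<close> below.\<close>

definition codim :: "('k::finite) point set \<Rightarrow> ereal" where
  "codim A = ereal (real (dim (carnot_group :: 'k point set))) - semialgebraic_dim A"

section \<open>Consistency of the definitions\<close>

lemma sum_frame_field: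
  "(\<Sum>i\<in>UNIV. (v $ i) *\<^sub>R frame_field i p) = (v, (1/2) *\<^sub>R wedge (fst p) v)"
proof (rule prod_eqI)
  show "fst (\<Sum>i\<in>UNIV. (v $ i) *\<^sub>R frame_field i p) = fst (v, (1/2) *\<^sub>R wedge (fst p) v)"
    by (simp add: fst_sum frame_field_def vec_eq_iff axis_def if_distrib cong: if_cong)
  have "(\<Sum>i\<in>UNIV. v $ i * (- (1/2) * ((axis i 1 :: real^'a) $ l * fst p $ m - fst p $ l * (axis i 1 :: real^'a) $ m)))
      = (1/2) * (fst p $ l * v $ m - v $ l * fst p $ m)" for l m
  proof -
    have "(\<Sum>i\<in>UNIV. v $ i * (- (1/2) * ((axis i 1 :: real^'a) $ l * fst p $ m - fst p $ l * (axis i 1 :: real^'a) $ m)))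
      = (\<Sum>i\<in>UNIV. (if i = l then - (1/2) * v $ i * fst p $ m else 0) + (if i = m then (1/2) * v $ i * fst p $ l else 0))"
      by (rule sum.cong) (auto simp: axis_def field_simps)
    also have "\<dots> = (1/2) * (fst p $ l * v $ m - v $ l * fst p $ m)"
      by (simp add: sum.distrib algebra_simps)
    finally show ?thesis .
  qed
  then show "snd (\<Sum>i\<in>UNIV. (v $ i) *\<^sub>R frame_field i p) = snd (v, (1/2) *\<^sub>R wedge (fst p) v)"
    by (simp add: snd_sum frame_field_def wedge_def vec_eq_iff)
qed

lemma curve_length_eq:
  assumes u: "is_control a b \<gamma> u"
  shows "curve_length a b \<gamma> = integral\<^sup>L (lebesgue_on {a..b}) (\<lambda>t. norm (u t))"
proof -
  have eq: "integral\<^sup>L (lebesgue_on {a..b}) (\<lambda>t. norm (w t))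
          = integral\<^sup>L (lebesgue_on {a..b}) (\<lambda>t. norm (u t))" if w: "is_control a b \<gamma> w" for w
  proof (cases "a < b")
    case True
    let ?D = "\<lambda>u t. (\<gamma> has_vector_derivative (\<Sum>i\<in>UNIV. (u t $ i) *\<^sub>R frame_field i (\<gamma> t)))
          (at t within {a..b})"
    have "AE t in lebesgue_on {a..b}. ?D u t" "AE t in lebesgue_on {a..b}. ?D w t"
      using u w by (auto simp: is_control_def)
    moreover have "AE t in lebesgue_on {a..b}. t \<in> {a..b}"
      by (rule AE_I2) simp
    ultimately have "AE t in lebesgue_on {a..b}. w t = u t"
    proof eventually_elim
      case (elim t)
      have "(\<Sum>i\<in>UNIV. (w t $ i) *\<^sub>R frame_field i (\<gamma> t)) = (\<Sum>i\<in>UNIV. (u t $ i) *\<^sub>R frame_field i (\<gamma> t))"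
        using vector_derivative_unique_within_closed_interval[of a b t \<gamma>] True elim by auto
      then show ?case by (simp add: sum_frame_field)
    qed
    then have "AE t in lebesgue_on {a..b}. norm (w t) = norm (u t)" by eventually_elim simp
    then show ?thesis
      by (intro integral_cong_AE) (use u w in \<open>auto simp: is_control_def\<close>)
  next
    case False
    then have "negligible {a..b}"
      by (cases "a = b") auto
    then have "{a..b} \<in> null_sets lebesgue"
      by (simp add: negligible_iff_null_sets)
    then have "AE t in lebesgue. t \<notin> {a..b}" by (rule AE_not_in)
    then have "AE t in lebesgue_on {a..b}. False"
      by (simp add: AE_restrict_space_iff)
    then have "AE t in lebesgue_on {a..b}. norm (w t) = norm (u t)" by eventually_elim simp
    then show ?thesis
      by (intro integral_cong_AE) (use u w in \<open>auto simp: is_control_def\<close>)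
  qed
  show ?thesis
    unfolding curve_length_def by (rule the_equality) (use u eq in blast)+
qed

lemma dim_skew: "2 * dim {Y :: real^'k^'k::finite. transpose Y = - Y} = CARD('k) * (CARD('k) - 1)"
proof -
  let ?S = "{Y :: real^'k^'k. transpose Y = - Y}"
  have "\<exists>r. bij_betw r (UNIV :: 'k set) {0..<CARD('k)}"
    by (rule ex_bij_betw_finite_nat) simp
  then obtain r :: "'k \<Rightarrow> nat" where "bij_betw r UNIV {0..<CARD('k)}" ..
  then have r: "inj r" by (rule bij_betw_imp_inj_on)
  define I where "I = {(i, j). r i < r j}"
  define W :: "'k \<times> 'k \<Rightarrow> real^'k^'k" where
    "W = (\<lambda>(i, j). \<chi> l m. (if l = i \<and> m = j then 1 else 0) - (if l = j \<and> m = i then 1 else 0))"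
  have W: "W (i, j) $ l $ m = (if l = i \<and> m = j then 1 else 0) - (if l = j \<and> m = i then 1 else 0)"
    for i j l m
    by (simp add: W_def)
  have inj: "inj_on W I"
  proof (rule inj_onI)
    fix p q assume pq: "p \<in> I" "q \<in> I" "W p = W q"
    obtain i j where p: "p = (i, j)" by (cases p)
    obtain i' j' where q: "q = (i', j')" by (cases q)
    have "i \<noteq> j" "W (i, j) $ i $ j = W (i', j') $ i $ j" using pq p q by (auto simp: I_def)
    then have "i = i' \<and> j = j'" unfolding W by (simp split: if_splits)
    then show "p = q" using p q by simp
  qed
  have ne: "W p \<noteq> 0" if "p \<in> I" for p
  proof -
    obtain i j where p: "p = (i, j)" by (cases p)
    have "i \<noteq> j" using that p by (auto simp: I_def)
    then have "W (i, j) $ i $ j \<noteq> 0" by (simp add: W)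
    then show ?thesis unfolding p by (rule contrapos_nn) simp
  qed
  have "independent (W ` I)"
  proof (rule pairwise_orthogonal_independent)
    show "0 \<notin> W ` I" using ne by auto
    have "W p \<bullet> W q = 0" if "p \<in> I" "q \<in> I" "p \<noteq> q" for p q
    proof -
      obtain i j where p: "p = (i, j)" by (cases p)
      obtain i' j' where q: "q = (i', j')" by (cases q)
      have nz: "l = a \<and> m = b \<or> l = b \<and> m = a" if "W (a, b) $ l $ m \<noteq> 0" for a b l m
        using that unfolding W by (metis diff_self)
      have "W p $ l $ m * W q $ l $ m = 0" for l m
      proof (rule ccontr)
        assume "W p $ l $ m * W q $ l $ m \<noteq> 0"
        then have "W (i, j) $ l $ m \<noteq> 0" "W (i', j') $ l $ m \<noteq> 0" unfolding p q by simp_all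
        then have "l = i \<and> m = j \<or> l = j \<and> m = i" "l = i' \<and> m = j' \<or> l = j' \<and> m = i'"
          by (blast dest: nz)+
        moreover have "r i < r j" "r i' < r j'" "(i, j) \<noteq> (i', j')"
          using that p q by (simp_all add: I_def)
        ultimately show False by (elim disjE conjE) simp_all
      qed
      then show ?thesis by (simp only: inner_vec_def inner_real_def sum.neutral_const)
    qed
    then show "pairwise orthogonal (W ` I)"
      by (auto simp: pairwise_def orthogonal_def)
  qed
  moreover have "W ` I \<subseteq> ?S"
  proof (rule image_subsetI)
    fix p :: "'k \<times> 'k"
    obtain i j where p: "p = (i, j)" by (cases p)
    have "transpose (W (i, j)) = - W (i, j)"
      unfolding vec_eq_iff transpose_def by (simp add: W conj_commute)
    then show "W p \<in> ?S" using p by simp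
  qed
  moreover have "?S \<subseteq> span (W ` I)"
  proof
    fix Y assume "Y \<in> ?S"
    then have Y: "transpose Y = - Y" by simp
    have sk: "Y $ m $ l = - Y $ l $ m" for l m
    proof -
      have "Y $ m $ l = transpose Y $ l $ m" by (simp add: transpose_def)
      also have "\<dots> = - Y $ l $ m" unfolding Y by simp
      finally show ?thesis .
    qed
    have "Y = (\<Sum>p\<in>I. (Y $ fst p $ snd p) *\<^sub>R W p)"
    proof -
      have "Y $ l $ m = (\<Sum>p\<in>I. Y $ fst p $ snd p * W p $ l $ m)" for l m
      proof -
        have "(\<Sum>p\<in>I. Y $ fst p $ snd p * W p $ l $ m)
            = (\<Sum>p\<in>I. (if p = (l, m) then Y $ l $ m else 0) + (if p = (m, l) then - Y $ m $ l else 0))"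
        proof (rule sum.cong[OF refl])
          fix p assume "p \<in> I"
          obtain i j where p: "p = (i, j)" by (cases p)
          then have "i \<noteq> j" using \<open>p \<in> I\<close> by (auto simp: I_def)
          show "Y $ fst p $ snd p * W p $ l $ m
            = (if p = (l, m) then Y $ l $ m else 0) + (if p = (m, l) then - Y $ m $ l else 0)"
          proof (cases "p = (l, m)")
            case True
            then have "p \<noteq> (m, l)" "W p $ l $ m = 1"
              using \<open>i \<noteq> j\<close> p by (simp_all add: W)
            then show ?thesis using True by simp
          next
            case False
            then have "\<not> (l = i \<and> m = j)" using p by blast
            then have "W p $ l $ m = (if l = j \<and> m = i then - 1 else 0)"
              unfolding p W by (simp only: if_False) simp
            also have "(l = j \<and> m = i) = (p = (m, l))" using p by blast
            finally have "W p $ l $ m = (if p = (m, l) then - 1 else 0)" .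
            then show ?thesis using False by simp
          qed
        qed
        also have "\<dots> = (if (l, m) \<in> I then Y $ l $ m else 0) + (if (m, l) \<in> I then - Y $ m $ l else 0)"
          by (simp add: sum.distrib)
        also have "\<dots> = Y $ l $ m"
        proof -
          consider "r l < r m" | "r m < r l" | "l = m"
            using r by (metis injD linorder_neqE_nat)
          then show ?thesis
          proof cases
            case 3
            then have "Y $ l $ m = 0" using sk[of m m] by simp
            then show ?thesis using 3 by (simp add: I_def)
          qed (simp_all add: I_def sk[of l m])
        qed
        finally show ?thesis by simp
      qed
      then show ?thesis
        unfolding vec_eq_iff sum_component vector_scaleR_component real_scaleR_def by blast
    qed
    moreover have "(\<Sum>p\<in>I. (Y $ fst p $ snd p) *\<^sub>R W p) \<in> span (W ` I)"
      by (intro span_sum span_scale span_base imageI)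
    ultimately show "Y \<in> span (W ` I)" by (rule ssubst)
  qed
  ultimately have "dim ?S = card (W ` I)" by (metis basis_card_eq_dim)
  also have "\<dots> = card I" using inj by (rule card_image)
  finally have d: "dim ?S = card I" .
  let ?J = "{(i, j). r j < r i}"
  have "card ?J = card I"
    by (rule bij_betw_same_card[of prod.swap])
       (auto simp: I_def bij_betw_def inj_on_def image_iff)
  moreover have "UNIV = I \<union> ?J \<union> (\<lambda>i. (i, i)) ` UNIV"
    using r by (auto simp: I_def image_iff) (metis injD linorder_neqE_nat)
  then have "CARD('k \<times> 'k) = card (I \<union> ?J \<union> (\<lambda>i. (i, i)) ` (UNIV :: 'k set))"
    by simp
  then have "CARD('k) * CARD('k) = card I + card ?J + card ((\<lambda>i. (i, i)) ` (UNIV :: 'k set))"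
    by (subst (asm) card_Un_disjoint; (subst (asm) card_Un_disjoint)?) (auto simp: I_def)
  moreover have "card ((\<lambda>i. (i, i)) ` (UNIV :: 'k set)) = CARD('k)"
    by (rule card_image) (auto simp: inj_on_def)
  ultimately have "CARD('k) * CARD('k) = 2 * card I + CARD('k)" by simp
  then show ?thesis using d by (simp add: diff_mult_distrib2)
qed

lemma dim_carnot_group:
  "dim (carnot_group :: ('k::finite) point set) = CARD('k) * (CARD('k) + 1) div 2"
proof -
  let ?S = "{Y :: real^'k^'k. transpose Y = - Y}"
  have "carnot_group = (UNIV :: (real^'k) set) \<times> ?S"
    by (auto simp: carnot_group_def)
  moreover have "subspace ?S"
  proof -
    have "transpose (X + Y) = transpose X + transpose Y" "transpose (c *\<^sub>R X) = c *\<^sub>R transpose X"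
      "transpose 0 = (0 :: real^'k^'k)" for X Y :: "real^'k^'k" and c
      by (simp_all add: transpose_def vec_eq_iff)
    then show ?thesis by (simp add: subspace_def)
  qed
  ultimately have "dim (carnot_group :: 'k point set) = dim (UNIV :: (real^'k) set) + dim ?S"
    using dim_Times[OF subspace_UNIV] by metis
  then have "dim (carnot_group :: 'k point set) = CARD('k) + dim ?S"
    by simp
  moreover have "CARD('k) \<ge> 1" by (simp add: Suc_leI)
  ultimately have "2 * dim (carnot_group :: 'k point set) = CARD('k) * (CARD('k) + 1)"
    using dim_skew[where 'k = 'k] by (cases "CARD('k)") auto
  then show ?thesis by simp
qed

end

theory Submission
  imports Defs "HOL-Complex_Analysis.Great_Picard"
begin

text \<open>
  Horizontal curves parametrized by arc length are the curves that are Lipschitz with respect to a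
  left-invariant gauge comparable to the Carnot--Caratheodory distance; this class is closed under
  pointwise limits, so minimizers exist by Arzela--Ascoli. A variation of size
  \<open>e\<close> that is corrected at order \<open>e\<^sup>2\<close> has an endpoint error of order \<open>e\<^sup>3\<close>, which commutator loops of
  length of order \<open>e powr (3/2)\<close> close up; since this is \<open>o(e)\<close>, the first variation gives that the
  horizontal projection \<open>x\<close> of a minimizer solves a linear equation \<open>x' = p + L x\<close>, and hence that
  minimizers do not branch.
  For \<open>(x, Y)\<close> in \<open>C_set\<close> the orthogonal map \<open>M\<close> sends a minimizer from \<open>0\<close> to \<open>(x, Y)\<close> to another
  one. If the curve minimized beyond \<open>(x, Y)\<close>, non-branching would make it invariant under \<open>M\<close>;
  then \<open>x\<close> stays in the fixed space of \<open>M\<close>, whose orthogonal complement lies in \<open>ker Y\<close>,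
  and \<open>M = 1\<close> because \<open>M\<close> fixes \<open>ker Y\<close>.

  The set \<open>C_set\<close> contains the points \<open>(x, Y)\<close> for which \<open>Y\<close> preserves a plane orthogonal to \<open>x\<close>.
  Generically they are parametrized polynomially by conjugating block matrices with \<open>1 + X\<close>, \<open>X\<close>
  skew, and \<open>X\<close> is recovered rationally from the Krylov vectors \<open>x, Y x, Y\<^sup>2 x, \<dots>\<close> by Cramer's rule,
  which gives a semi-algebraic cell of codimension two.
\<close>

section \<open>Lipschitz curves and linear flows\<close>

text \<open>Closing an endpoint error E costs length of order sqrt |E|. A variation of size e that
  keeps the endpoint to first order leaves an error of order e^2, and closing that would cost order
  e, as much as the variation gains; hence the correction at order e^2. It exists because variations
  are confined to the span V of the curve \<open>x\<close>: a functional that obstructs the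
  correction kills V, and with it the quadratic error of a V-valued variation. So no such variation
  gains length without a first-order change of the endpoint, the vector (1, 0, 0) lies outside the
  range of the first-order data, and the separating vector has a nonzero length entry: a normal
  multiplier always exists. Multipliers are not unique, so two minimizers sharing an arc may solve
  different linear equations; their coincidence propagates by analyticity, not by uniqueness for one
  equation. For the cell, \<open>1 + X\<close> replaces a rotation because it is polynomial in X.
  Its columns need not be orthonormal, but its two column blocks are orthogonal, as (1 - X)(1 + X) =
  1 - X^2 is block diagonal for off-diagonal X.\<close>

lemma lebesgue_on_AE_iff_negligible:
  fixes S :: "'a::euclidean_space set"
  assumes "S \<in> sets lebesgue"
  shows "(AE x in lebesgue_on S. P x) \<longleftrightarrow> (\<exists>N. negligible N \<and> (\<forall>x\<in>S - N. P x))"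
proof
  assume "AE x in lebesgue_on S. P x"
  then have "AE x in lebesgue. x \<in> S \<longrightarrow> P x"
    using assms by (simp add: AE_restrict_space_iff)
  then obtain N where "N \<in> null_sets lebesgue" "{x \<in> space lebesgue. \<not> (x \<in> S \<longrightarrow> P x)} \<subseteq> N"
    by (auto simp: eventually_ae_filter)
  then show "\<exists>N. negligible N \<and> (\<forall>x\<in>S - N. P x)"
    by (intro exI[of _ N]) (auto simp: negligible_iff_null_sets)
next
  assume "\<exists>N. negligible N \<and> (\<forall>x\<in>S - N. P x)"
  then obtain N where N: "N \<in> null_sets lebesgue" "\<forall>x\<in>S - N. P x"
    by (auto simp: negligible_iff_null_sets)
  have "AE x in lebesgue. x \<in> S \<longrightarrow> P x"
    by (rule AE_I'[OF N(1)]) (use N(2) in auto)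
  then show "AE x in lebesgue_on S. P x"
    using assms by (simp add: AE_restrict_space_iff)
qed

text \<open>\<open>integrable_ccontinuous_explicit\<close> yields the right difference quotients;
  applied to the reflection of \<open>f\<close> it yields the left ones, with the exceptional set
  reflected back. The null set does not depend on \<open>a\<close> and \<open>b\<close>, so it
  serves all intervals at once.\<close>

lemma vector_derivative_indefinite_integral_AE:
  fixes f :: "real \<Rightarrow> 'b::euclidean_space"
  assumes f: "\<And>a b. f integrable_on {a..b}"
  shows "\<exists>N. negligible N \<and> (\<forall>a b. \<forall>t\<in>{a..b} - N.
       ((\<lambda>s. integral {a..s} f) has_vector_derivative f t) (at t within {a..b}))"
proof -
  have f': "(\<lambda>x. f (- x)) integrable_on {a..b}" for a b
    using Henstock_Kurzweil_Integration.integrable_reflect_real[where f=f and a="-b" and b="-a"] f by simp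
  obtain N1 where N1: "negligible N1" "\<And>x e. \<lbrakk>x \<notin> N1; 0 < e\<rbrakk> \<Longrightarrow>
      \<exists>d>0. \<forall>h. 0 < h \<and> h < d \<longrightarrow> norm (integral {x..x + h} f /\<^sub>R h - f x) < e"
    using integrable_ccontinuous_explicit[of f] f by (auto simp: cbox_interval)
  obtain N2 where N2: "negligible N2" "\<And>x e. \<lbrakk>x \<notin> N2; 0 < e\<rbrakk> \<Longrightarrow>
      \<exists>d>0. \<forall>h. 0 < h \<and> h < d \<longrightarrow> norm (integral {x..x + h} (\<lambda>x. f (- x)) /\<^sub>R h - f (- x)) < e"
    using integrable_ccontinuous_explicit[of "\<lambda>x. f (- x)"] f' by (auto simp: cbox_interval)
  have neg: "negligible (uminus ` N2)"
  proof (rule negligible_locally_Lipschitz_image[OF _ N2(1)])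
    fix x :: real
    show "\<exists>T B. open T \<and> x \<in> T \<and> (\<forall>y\<in>N2 \<inter> T. norm (- y - - x) \<le> B * norm (y - x))"
      by (rule exI[of _ UNIV], rule exI[of _ 1]) auto
  qed simp
  have der: "((\<lambda>s. integral {a..s} f) has_vector_derivative f t) (at t within {a..b})"
    if t: "t \<notin> N1 \<union> uminus ` N2" "t \<in> {a..b}" for t a b
  proof -
    have tN: "t \<notin> N1" "- t \<notin> N2" using t by (auto simp: image_iff)
    show ?thesis
      unfolding has_vector_derivative_def has_derivative_within_alt
    proof (intro conjI allI impI)
      show "bounded_linear (\<lambda>x. x *\<^sub>R f t)" by (rule bounded_linear_scaleR_left)
      fix e :: real assume e: "0 < e"
      obtain d1 where d1: "d1 > 0" "\<And>h. 0 < h \<Longrightarrow> h < d1 \<Longrightarrow> norm (integral {t..t + h} f /\<^sub>R h - f t) < e"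
        using N1(2)[OF tN(1) e] by blast
      obtain d2 where d2: "d2 > 0"
        "\<And>h. 0 < h \<Longrightarrow> h < d2 \<Longrightarrow> norm (integral {-t..-t + h} (\<lambda>x. f (- x)) /\<^sub>R h - f t) < e"
        using N2(2)[OF tN(2) e] by auto
      have "norm (integral {a..y} f - integral {a..t} f - (y - t) *\<^sub>R f t) \<le> e * norm (y - t)"
        if y: "y \<in> {a..b}" "norm (y - t) < min d1 d2" for y
      proof (cases y t rule: linorder_cases)
        case equal then show ?thesis by simp
      next
        case greater
        have "integral {a..y} f = integral {a..t} f + integral {t..y} f"
          using Henstock_Kurzweil_Integration.integral_combine[of a t y f] f t greater by auto
        moreover have "norm (integral {t..y} f /\<^sub>R (y - t) - f t) < e"
          using d1(2)[of "y - t"] greater y by auto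
        moreover have "integral {t..y} f - (y - t) *\<^sub>R f t = (y - t) *\<^sub>R (integral {t..y} f /\<^sub>R (y - t) - f t)"
          using greater by (simp add: scaleR_diff_right)
        ultimately show ?thesis using greater by (simp add: mult.commute)
      next
        case less
        have "integral {a..t} f = integral {a..y} f + integral {y..t} f"
          using Henstock_Kurzweil_Integration.integral_combine[of a y t f] f t y less by auto
        moreover have "integral {-t..-t + (t - y)} (\<lambda>x. f (- x)) = integral {y..t} f"
          using Henstock_Kurzweil_Integration.integral_reflect_real[where f=f and a=y and b=t] by simp
        then have "norm (integral {y..t} f /\<^sub>R (t - y) - f t) < e"
          using d2(2)[of "t - y"] less y by auto
        moreover have "integral {y..t} f - (t - y) *\<^sub>R f t = (t - y) *\<^sub>R (integral {y..t} f /\<^sub>R (t - y) - f t)"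
          using less by (simp add: scaleR_diff_right)
        then have "norm (integral {y..t} f - (t - y) *\<^sub>R f t) = (t - y) * norm (integral {y..t} f /\<^sub>R (t - y) - f t)"
          using less by simp
        moreover have "integral {a..y} f - integral {a..t} f - (y - t) *\<^sub>R f t = - (integral {y..t} f - (t - y) *\<^sub>R f t)"
          using calculation(1) by (simp add: algebra_simps)
        then have "norm (integral {a..y} f - integral {a..t} f - (y - t) *\<^sub>R f t) = norm (integral {y..t} f - (t - y) *\<^sub>R f t)"
          by (metis norm_minus_cancel)
        ultimately show ?thesis using less by (simp add: mult.commute)
      qed
      then show "\<exists>d>0. \<forall>y\<in>{a..b}. norm (y - t) < d \<longrightarrow>
          norm (integral {a..y} f - integral {a..t} f - (y - t) *\<^sub>R f t) \<le> e * norm (y - t)"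
        using d1(1) d2(1) by (intro exI[of _ "min d1 d2"]) auto
    qed
  qed
  show ?thesis
    using negligible_Un[OF N1(1) neg] der by (intro exI[of _ "N1 \<union> uminus ` N2"]) auto
qed

text \<open>Adding \<open>(L + 1) * t\<close> turns the function into a bi-Lipschitz bijection
  \<open>F\<close> of the line. Its Stieltjes measure is the image of Lebesgue measure under the
  inverse \<open>H\<close>; it is absolutely continuous because Lipschitz maps preserve null sets,
  and its Radon-Nikodym density minus \<open>L + 1\<close> is the integrand.\<close>

lemma lipschitz_imp_indefinite_integral_real:
  fixes f :: "real \<Rightarrow> real"
  assumes f: "L-lipschitz_on {a..b} f" and ab: "a \<le> b"
  obtains u where "u \<in> borel_measurable borel"
    "\<And>s t. \<lbrakk>a \<le> s; s \<le> t; t \<le> b\<rbrakk> \<Longrightarrow> (u has_integral (f t - f s)) {s..t}"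
proof -
  have L: "0 \<le> L" using f by (rule lipschitz_on_nonneg)
  \<comment> \<open>Clamping extends \<open>f\<close> to the whole line, so that \<open>F\<close>
    becomes onto.\<close>
  define g where "g t = f (max a (min b t))" for t
  have gl: "\<bar>g t - g s\<bar> \<le> L * \<bar>t - s\<bar>" for s t
  proof -
    have "\<bar>g t - g s\<bar> \<le> L * \<bar>max a (min b t) - max a (min b s)\<bar>"
      unfolding g_def using lipschitz_onD[OF f, of "max a (min b t)" "max a (min b s)"] ab
      by (auto simp: dist_real_def)
    also have "\<dots> \<le> L * \<bar>t - s\<bar>" using L by (intro mult_left_mono) auto
    finally show ?thesis .
  qed
  \<comment> \<open>Slope \<open>L + 1\<close> instead of \<open>L\<close> leaves increments of at
    least \<open>t - s\<close>, so \<open>F\<close> is injective with a 1-Lipschitz inverse.\<close>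
  define F where "F t = g t + (L + 1) * t" for t
  have Fge: "t - s \<le> F t - F s" if "s \<le> t" for s t
  proof -
    have "- (L * (t - s)) \<le> g t - g s" using gl[of t s] that by auto
    then show ?thesis by (simp add: F_def algebra_simps)
  qed
  have Fle: "\<bar>F t - F s\<bar> \<le> (2 * L + 1) * \<bar>t - s\<bar>" for s t
  proof -
    have "\<bar>F t - F s\<bar> = \<bar>(g t - g s) + (L + 1) * (t - s)\<bar>" by (simp add: F_def algebra_simps)
    also have "\<dots> \<le> L * \<bar>t - s\<bar> + (L + 1) * \<bar>t - s\<bar>"
      using gl[of t s] L abs_triangle_ineq[of "g t - g s" "(L + 1) * (t - s)"] by (simp add: abs_mult)
    finally show ?thesis by (simp add: algebra_simps)
  qed
  have Fmono: "F s < F t" if "s < t" for s t using Fge[of s t] that by simp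
  have Finj: "inj F"
    by (rule injI) (metis Fmono less_irrefl linorder_neqE_linordered_idom)
  have Fcont: "continuous_on A F" for A
  proof (rule continuous_on_subset[OF _ subset_UNIV])
    have "(2 * L + 1)-lipschitz_on UNIV F"
      by (rule lipschitz_onI) (use Fle L in \<open>auto simp: dist_real_def\<close>)
    then show "continuous_on UNIV F" by (rule lipschitz_on_continuous_on)
  qed
  have Fsurj: "\<exists>t. F t = y" for y
  proof -
    define c where "c = \<bar>y - F 0\<bar>"
    have "F (- c) \<le> y" using Fge[of "-c" 0] by (simp add: c_def)
    moreover have "y \<le> F c" using Fge[of 0 c] by (simp add: c_def)
    moreover have "- c \<le> c" by (simp add: c_def)
    ultimately show ?thesis using IVT'[of F "-c" y c] Fcont by blast
  qed
  define H where "H = inv F"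
  have FH: "F (H y) = y" for y unfolding H_def using Fsurj by (metis f_inv_into_f rangeI)
  have HF: "H (F t) = t" for t unfolding H_def using Finj by (rule inv_f_f)
  have Hlip: "1-lipschitz_on UNIV H"
  proof (rule lipschitz_onI)
    fix x y show "dist (H x) (H y) \<le> 1 * dist x y"
      using Fge[of "H x" "H y"] Fge[of "H y" "H x"] FH[of x] FH[of y]
      by (auto simp: dist_real_def abs_if)
  qed simp
  then have "continuous_on UNIV H" by (rule lipschitz_on_continuous_on)
  then have Hm[measurable]: "H \<in> borel_measurable borel" by (rule borel_measurable_continuous_onI)
  define M where "M = distr lborel borel H"
  have vim: "H -` A = F ` A" for A
  proof (intro set_eqI iffI)
    fix y assume "y \<in> H -` A"
    then show "y \<in> F ` A" by (intro image_eqI[of _ _ "H y"]) (simp_all add: FH)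
  qed (auto simp: HF)
  have Mint: "emeasure M {s<..t} = ennreal (F t - F s)" if "s \<le> t" for s t
  proof -
    have "H -` {s<..t} = {F s<..F t}"
    proof (intro set_eqI)
      fix y show "y \<in> H -` {s<..t} \<longleftrightarrow> y \<in> {F s<..F t}"
        using FH[of y] Fmono[of s "H y"] Fmono[of "H y" s] Fmono[of "H y" t] Fmono[of t "H y"]
        by (cases "H y" s rule: linorder_cases; cases "H y" t rule: linorder_cases) auto
    qed
    moreover have "F s \<le> F t" using Fge[OF that] that by simp
    ultimately show ?thesis unfolding M_def by (simp add: emeasure_distr)
  qed
  have "absolutely_continuous lborel M"
    unfolding absolutely_continuous_def
  proof
    fix A :: "real set" assume A: "A \<in> null_sets lborel"
    then have "negligible A"
      by (metis negligible_iff_null_sets null_sets_completionI)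
    then have "negligible (F ` A)"
    proof (rule negligible_locally_Lipschitz_image[rotated])
      fix x assume "x \<in> A"
      show "\<exists>T B. open T \<and> x \<in> T \<and> (\<forall>y\<in>A \<inter> T. norm (F y - F x) \<le> B * norm (y - x))"
        by (intro exI[of _ UNIV] exI[of _ "2 * L + 1"]) (use Fle in auto)
    qed simp
    then have "emeasure lebesgue (F ` A) = 0"
      by (simp add: negligible_iff_null_sets null_setsD1)
    moreover have Ab: "A \<in> sets borel" using A by auto
    then have "F ` A \<in> sets borel" using measurable_sets[OF Hm Ab] vim by simp
    ultimately have "emeasure lborel (F ` A) = 0" by simp
    then show "A \<in> null_sets M"
      using Ab unfolding M_def by (auto simp: null_sets_def emeasure_distr vim)
  qed
  moreover have "sets M = sets lborel" by (simp add: M_def)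
  ultimately obtain h where h[measurable]: "h \<in> borel_measurable lborel" and hM: "density lborel h = M"
    using sigma_finite_measure.Radon_Nikodym[OF sigma_finite_lborel] by blast
  have hint: "(\<integral>\<^sup>+ x. h x * indicator {s<..t} x \<partial>lborel) = ennreal (F t - F s)" if "s \<le> t" for s t
    using Mint[OF that] unfolding hM[symmetric] by (subst (asm) emeasure_density) auto
  \<comment> \<open>The density is extended-valued; on \<open>{a<..b}\<close> it has finite mass,
    hence is finite almost everywhere and may be replaced by a real function.\<close>
  define k where "k x = enn2real (h x * indicator {a<..b} x)" for x
  have km[measurable]: "k \<in> borel_measurable borel" unfolding k_def using h by measurable
  have "AE x in lborel. h x * indicator {a<..b} x \<noteq> \<infinity>"
    by (rule nn_integral_PInf_AE) (use hint[OF ab] in auto)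
  then have kh: "AE x in lborel. ennreal (k x) = h x * indicator {a<..b} x"
    by eventually_elim (auto simp: k_def less_top)
  have kI: "(k has_integral (F t - F s)) {s..t}" if st: "a \<le> s" "s \<le> t" "t \<le> b" for s t
  proof -
    have pos: "0 \<le> F t - F s" using Fge[OF st(2)] st(2) by simp
    let ?k = "\<lambda>x. k x * indicator {s<..t} x"
    have "(\<integral>\<^sup>+ x. ennreal (?k x) \<partial>lborel) = (\<integral>\<^sup>+ x. h x * indicator {s<..t} x \<partial>lborel)"
      by (rule nn_integral_cong_AE) (use kh in eventually_elim, use st in \<open>auto simp: indicator_def\<close>)
    then have nn: "(\<integral>\<^sup>+ x. ennreal (?k x) \<partial>lborel) = ennreal (F t - F s)" using hint[OF st(2)] by simp
    have kn: "0 \<le> ?k x" for x by (simp add: k_def)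
    have "integrable lborel ?k"
      by (rule integrableI_nonneg) (use nn kn in auto)
    then have "(?k has_integral (\<integral>x. ?k x \<partial>lborel)) UNIV" by (rule has_integral_integral_lborel)
    moreover have "(\<integral>x. ?k x \<partial>lborel) = F t - F s"
      by (subst integral_eq_nn_integral) (use nn kn pos in auto)
    ultimately have "(?k has_integral (F t - F s)) UNIV" by simp
    moreover have "(\<lambda>x. if x \<in> {s<..t} then k x else 0) = ?k" by (auto simp: indicator_def)
    ultimately have "(k has_integral (F t - F s)) {s<..t}"
      using has_integral_restrict_UNIV[of "{s<..t}" k] by simp
    then show ?thesis
      by (subst has_integral_spike_set_eq[of "{s..t}" "{s<..t}"]) (auto intro: negligible_subset[of "{s}"])
  qed
  show thesis
  proof
    show "(\<lambda>x. k x - (L + 1)) \<in> borel_measurable borel" by measurable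
    fix s t assume st: "a \<le> s" "s \<le> t" "t \<le> b"
    have "((\<lambda>x. k x - (L + 1)) has_integral (F t - F s - (L + 1) * (t - s))) {s..t}"
      using has_integral_diff[OF kI[OF st] has_integral_const_real[of "L + 1" s t]] st
      by (simp add: mult.commute)
    moreover have "F t - F s - (L + 1) * (t - s) = f t - f s"
      using st by (simp add: F_def g_def algebra_simps)
    ultimately show "((\<lambda>x. k x - (L + 1)) has_integral (f t - f s)) {s..t}" by simp
  qed
qed

lemma has_vector_derivative_norm_le_lipschitz:
  fixes f :: "real \<Rightarrow> 'b::real_normed_vector"
  assumes f: "L-lipschitz_on {a..b} f" and ab: "a < b" and t: "t \<in> {a..b}"
    and d: "(f has_vector_derivative v) (at t within {a..b})"
  shows "norm v \<le> L"
proof (rule field_le_epsilon)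
  fix e :: real assume "0 < e"
  then obtain d where d: "d > 0" "\<And>y. y \<in> {a..b} \<Longrightarrow> norm (y - t) < d \<Longrightarrow>
      norm (f y - f t - (y - t) *\<^sub>R v) \<le> e * norm (y - t)"
    using d unfolding has_vector_derivative_def has_derivative_within_alt by blast
  obtain y where y: "y \<in> {a..b}" "y \<noteq> t" "\<bar>y - t\<bar> < d"
  proof (cases "t < b")
    case True
    then show thesis using d(1) t by (intro that[of "min b (t + d / 2)"]) auto
  next
    case False
    then show thesis using d(1) t ab by (intro that[of "max a (t - d / 2)"]) auto
  qed
  have "norm ((y - t) *\<^sub>R v) \<le> norm (f y - f t) + norm (f y - f t - (y - t) *\<^sub>R v)"
    by (metis norm_minus_commute norm_triangle_sub)
  also have "\<dots> \<le> L * \<bar>y - t\<bar> + e * \<bar>y - t\<bar>"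
    using lipschitz_onD[OF f y(1) t] d(2)[OF y(1)] y(3) by (auto simp: dist_norm)
  finally have "\<bar>y - t\<bar> * norm v \<le> \<bar>y - t\<bar> * (L + e)"
    unfolding norm_scaleR real_norm_def by (simp add: algebra_simps)
  then show "norm v \<le> L + e" using y(2) by simp
qed

lemma lipschitz_imp_AE_vector_derivative:
  fixes f :: "real \<Rightarrow> 'b::euclidean_space"
  assumes f: "L-lipschitz_on {a..b} f" and ab: "a < b"
  obtains u where "u \<in> borel_measurable borel" "\<And>t. norm (u t) \<le> L"
    "AE t in lebesgue_on {a..b}. (f has_vector_derivative u t) (at t within {a..b})"
    "\<And>s t. \<lbrakk>a \<le> s; s \<le> t; t \<le> b\<rbrakk> \<Longrightarrow> (u has_integral (f t - f s)) {s..t}"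
proof -
  have L: "0 \<le> L" using f by (rule lipschitz_on_nonneg)
  have "\<exists>u. u \<in> borel_measurable borel \<and>
      (\<forall>s t. a \<le> s \<and> s \<le> t \<and> t \<le> b \<longrightarrow> (u has_integral (f t \<bullet> i - f s \<bullet> i)) {s..t})" if "i \<in> Basis" for i
  proof -
    have "L-lipschitz_on {a..b} (\<lambda>t. f t \<bullet> i)"
    proof (rule lipschitz_onI[OF _ L])
      fix x y assume "x \<in> {a..b}" "y \<in> {a..b}"
      then have "norm (f x - f y) \<le> L * dist x y" using lipschitz_onD[OF f] by (simp add: dist_norm)
      then show "dist (f x \<bullet> i) (f y \<bullet> i) \<le> L * dist x y"
        using Basis_le_norm[OF that, of "f x - f y"] by (simp add: dist_real_def inner_diff_left)
    qed
    then obtain u where "u \<in> borel_measurable borel"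
      "\<And>s t. \<lbrakk>a \<le> s; s \<le> t; t \<le> b\<rbrakk> \<Longrightarrow> (u has_integral (f t \<bullet> i - f s \<bullet> i)) {s..t}"
      by (rule lipschitz_imp_indefinite_integral_real) (use ab in auto)
    then show ?thesis by blast
  qed
  then have "\<forall>i\<in>Basis. \<exists>u. u \<in> borel_measurable borel \<and>
      (\<forall>s t. a \<le> s \<and> s \<le> t \<and> t \<le> b \<longrightarrow> (u has_integral (f t \<bullet> i - f s \<bullet> i)) {s..t})" by blast
  from bchoice[OF this] obtain w where "\<forall>i\<in>Basis. w i \<in> borel_measurable borel \<and>
      (\<forall>s t. a \<le> s \<and> s \<le> t \<and> t \<le> b \<longrightarrow> (w i has_integral (f t \<bullet> i - f s \<bullet> i)) {s..t})" ..
  then have w: "\<And>i. i \<in> Basis \<Longrightarrow> w i \<in> borel_measurable borel"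
    "\<And>i s t. \<lbrakk>i \<in> Basis; a \<le> s; s \<le> t; t \<le> b\<rbrakk> \<Longrightarrow> (w i has_integral (f t \<bullet> i - f s \<bullet> i)) {s..t}"
    by blast+
  define u0 where "u0 t = (\<Sum>i\<in>Basis. w i t *\<^sub>R i)" for t
  have u0m[measurable]: "u0 \<in> borel_measurable borel"
    unfolding u0_def using w(1) by measurable
  have u0I: "(u0 has_integral (f t - f s)) {s..t}" if "a \<le> s" "s \<le> t" "t \<le> b" for s t
  proof -
    have "(u0 has_integral (\<Sum>i\<in>Basis. (f t \<bullet> i - f s \<bullet> i) *\<^sub>R i)) {s..t}"
      unfolding u0_def by (intro has_integral_sum has_integral_scaleR_left w(2) that) auto
    moreover have "(\<Sum>i\<in>Basis. (f t \<bullet> i - f s \<bullet> i) *\<^sub>R i) = f t - f s"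
      by (simp add: inner_diff_left[symmetric] euclidean_representation)
    ultimately show ?thesis by simp
  qed
  \<comment> \<open>Extended by 0, since the differentiation lemma asks for integrability on all
    intervals.\<close>
  define g where "g t = (if t \<in> {a..b} then u0 t else 0)" for t
  have "g integrable_on {s..t}" for s t
  proof -
    have "u0 integrable_on {a..b}" using u0I[of a b] ab by (auto simp: integrable_on_def)
    then have "g integrable_on UNIV" unfolding g_def by (simp only: integrable_restrict_UNIV)
    then show ?thesis using integrable_on_subinterval by blast
  qed
  then have "\<exists>N. negligible N \<and> (\<forall>a b. \<forall>t\<in>{a..b} - N.
       ((\<lambda>s. integral {a..s} g) has_vector_derivative g t) (at t within {a..b}))"
    by (rule vector_derivative_indefinite_integral_AE)
  then obtain N where N0: "negligible N \<and> (\<forall>a b. \<forall>t\<in>{a..b} - N.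
       ((\<lambda>s. integral {a..s} g) has_vector_derivative g t) (at t within {a..b}))" ..
  then have N: "negligible N" by blast
  have fg: "f s = f a + integral {a..s} g" if "s \<in> {a..b}" for s
  proof -
    have "integral {a..s} g = integral {a..s} u0"
      by (rule integral_cong) (use that in \<open>auto simp: g_def\<close>)
    also have "\<dots> = f s - f a" using u0I[of a s] that by auto
    finally show ?thesis by simp
  qed
  have der: "(f has_vector_derivative u0 t) (at t within {a..b})" if t: "t \<in> {a..b} - N" for t
  proof -
    have "((\<lambda>s. f a + integral {a..s} g) has_vector_derivative (0 + g t)) (at t within {a..b})"
    proof (rule has_vector_derivative_add[OF has_vector_derivative_const])
      show "((\<lambda>s. integral {a..s} g) has_vector_derivative g t) (at t within {a..b})"
        using t N0 by blast
    qed
    then have "(f has_vector_derivative (0 + g t)) (at t within {a..b})"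
    proof (rule has_vector_derivative_transform[rotated 2])
      show "t \<in> {a..b}" using t by simp
      show "f s = f a + integral {a..s} g" if "s \<in> {a..b}" for s by (rule fg[OF that])
    qed
    then show ?thesis using t by (simp add: g_def)
  qed
  have bd: "norm (u0 t) \<le> L" if "t \<in> {a..b} - N" for t
    using has_vector_derivative_norm_le_lipschitz[OF f ab _ der[OF that]] that by simp
  \<comment> \<open>The bound on \<open>u0\<close> is known off the null set only; the value 0 where
    it fails makes it hold at every \<open>t\<close> and keeps \<open>u\<close> Borel.\<close>
  define u where "u t = (if norm (u0 t) \<le> L then u0 t else 0)" for t
  have ueq: "u t = u0 t" if "t \<in> {a..b} - N" for t using bd[OF that] by (simp add: u_def)
  show thesis
  proof
    show "u \<in> borel_measurable borel" unfolding u_def by measurable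
    show "norm (u t) \<le> L" for t using L by (simp add: u_def)
    show "AE t in lebesgue_on {a..b}. (f has_vector_derivative u t) (at t within {a..b})"
    proof (subst lebesgue_on_AE_iff_negligible)
      show "\<exists>N. negligible N \<and> (\<forall>t\<in>{a..b} - N. (f has_vector_derivative u t) (at t within {a..b}))"
        using N ueq der by (intro exI[of _ N]) simp
    qed simp
    show "(u has_integral (f t - f s)) {s..t}" if st: "a \<le> s" "s \<le> t" "t \<le> b" for s t
    proof (rule has_integral_spike[OF N _ u0I[OF st]])
      show "u x = u0 x" if "x \<in> {s..t} - N" for x using ueq[of x] that st by simp
    qed
  qed
qed

text \<open>By uniqueness of derivatives, \<open>g\<close> agrees off a null set with the density
  from \<open>lipschitz_imp_AE_vector_derivative\<close>, so the fundamental theorem of calculus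
  carries over from that density.\<close>

lemma has_integral_AE_derivative_lipschitz:
  fixes f :: "real \<Rightarrow> 'b::euclidean_space"
  assumes f: "L-lipschitz_on {a..b} f"
    and g: "AE t in lebesgue_on {a..b}. (f has_vector_derivative g t) (at t within {a..b})"
    and st: "a \<le> s" "s \<le> t" "t \<le> b"
  shows "(g has_integral (f t - f s)) {s..t}"
proof (cases "a < b")
  case True
  obtain u where u: "AE t in lebesgue_on {a..b}. (f has_vector_derivative u t) (at t within {a..b})"
    "(u has_integral (f t - f s)) {s..t}"
    by (rule lipschitz_imp_AE_vector_derivative[OF f True]) (use st in blast)
  obtain N1 N2 where N: "negligible N1" "negligible N2"
    "\<forall>t\<in>{a..b} - N1. (f has_vector_derivative u t) (at t within {a..b})"
    "\<forall>t\<in>{a..b} - N2. (f has_vector_derivative g t) (at t within {a..b})"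
    using u(1) g by (auto simp: lebesgue_on_AE_iff_negligible)
  show ?thesis
  proof (rule has_integral_spike[OF negligible_Un[OF N(1,2)] _ u(2)])
    fix x assume "x \<in> {s..t} - (N1 \<union> N2)"
    then have x: "x \<in> {a..b} - N1" "x \<in> {a..b} - N2" using st by auto
    have "(f has_vector_derivative u x) (at x within {a..b})"
      "(f has_vector_derivative g x) (at x within {a..b})"
      using N(3) x(1) N(4) x(2) by auto
    then show "g x = u x"
      using vector_derivative_unique_within_closed_interval[of a b x f] True x by auto
  qed
next
  case False
  then have "s = t" using st by simp
  then show ?thesis using has_integral_refl(2)[of g t] by simp
qed

text \<open>Analytic continuation by hand: every derivative of \<open>\<pi> (z t)\<close> is
  \<open>\<pi>\<close> applied to a power of \<open>D\<close> at \<open>z t\<close>, so all of them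
  vanish inside \<open>{T1..T}\<close>, and a Taylor remainder bounded by a constant times
  \<open>(K * T)^n / n!\<close> forces the function to vanish further left.\<close>

lemma linear_flow_functional_eq_0:
  fixes z :: "real \<Rightarrow> 'e::euclidean_space" and \<pi> :: "'e \<Rightarrow> real"
  assumes D: "linear D" and \<pi>: "linear \<pi>"
    and der: "\<And>t. t \<in> {0..T} \<Longrightarrow> (z has_vector_derivative D (z t)) (at t within {0..T})"
    and T1: "0 \<le> T1" "T1 < T" and zero: "\<And>t. t \<in> {T1..T} \<Longrightarrow> \<pi> (z t) = 0"
    and t: "t \<in> {0..T}"
  shows "\<pi> (z t) = 0"
proof -
  define f where "f n t = \<pi> ((D ^^ n) (z t))" for n t
  have Dn: "linear (D ^^ n)" for n
    by (induction n) (auto simp: linear_compose[OF _ D, unfolded o_def] linear_id[unfolded id_def] intro: linear_compose D)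
  have pDn: "bounded_linear (\<lambda>v. \<pi> ((D ^^ n) v))" for n
    using linear_compose[OF Dn \<pi>] by (simp add: o_def linear_conv_bounded_linear)
  have fder: "(f n has_vector_derivative f (Suc n) t) (at t within {0..T})" if "t \<in> {0..T}" for n t
  proof -
    have "(f n has_vector_derivative \<pi> ((D ^^ n) (D (z t)))) (at t within {0..T})"
      unfolding f_def[abs_def] by (rule bounded_linear.has_vector_derivative[OF pDn der[OF that]])
    then show ?thesis by (simp only: f_def funpow_Suc_right o_apply)
  qed
  have fDERIV: "DERIV (f n) t :> f (Suc n) t" if "t \<in> {0<..<T}" for n t
  proof -
    have "at t within {0..T} = at t" using that by (intro at_within_interior) (auto simp: interior_atLeastAtMost_real)
    then show ?thesis using fder[of t n] that by (simp add: has_real_derivative_iff_has_vector_derivative)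
  qed
  have f0: "f n t = 0" if "t \<in> {T1<..<T}" for n t
    using that
  proof (induction n arbitrary: t)
    case 0 then show ?case using zero by (simp add: f_def)
  next
    case (Suc n)
    have "\<forall>\<^sub>F s in nhds t. s \<in> {T1<..<T}" using Suc.prems by (intro eventually_nhds_in_open) auto
    then have "\<forall>\<^sub>F s in nhds t. f n s = 0" by eventually_elim (rule Suc.IH)
    then have "DERIV (f n) t :> 0 \<longleftrightarrow> DERIV (\<lambda>_. 0 :: real) t :> 0" by (intro DERIV_cong_ev) auto
    then have "DERIV (f n) t :> 0" by simp
    then show ?case using fDERIV[of t n] Suc.prems T1 DERIV_unique by fastforce
  qed
  have zcont: "continuous_on {0..T} z"
    using der has_vector_derivative_continuous continuous_on_eq_continuous_within by blast
  then have "bounded (z ` {0..T})" by (intro compact_imp_bounded compact_continuous_image) auto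
  then obtain B where "0 < B" "\<forall>v\<in>z ` {0..T}. norm v \<le> B"
    unfolding bounded_pos by blast
  then have B: "\<And>t. t \<in> {0..T} \<Longrightarrow> norm (z t) \<le> B" "0 < B" by blast+
  obtain K where K: "0 < K" "\<And>x. norm (D x) \<le> K * norm x"
    using linear_bounded_pos[OF D] by blast
  obtain P where P: "0 < P" "\<And>x. norm (\<pi> x) \<le> P * norm x"
    using linear_bounded_pos[OF \<pi>] by blast
  have Dnb: "norm ((D ^^ n) x) \<le> K ^ n * norm x" for n x
  proof (induction n)
    case (Suc n)
    have "norm ((D ^^ Suc n) x) \<le> K * norm ((D ^^ n) x)" using K(2) by simp
    also have "\<dots> \<le> K * (K ^ n * norm x)" using Suc K(1) by (intro mult_left_mono) auto
    finally show ?case by (simp add: mult.assoc)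
  qed simp
  have fb: "\<bar>f n t\<bar> \<le> P * B * K ^ n" if "t \<in> {0..T}" for n t
  proof -
    have "\<bar>f n t\<bar> \<le> P * norm ((D ^^ n) (z t))" using P(2) by (simp add: f_def)
    also have "\<dots> \<le> P * (K ^ n * B)"
      using Dnb[of n "z t"] B(1)[OF that] K(1) P(1)
      by (intro mult_left_mono order.trans[OF Dnb]) auto
    finally show ?thesis by (simp add: algebra_simps)
  qed
  \<comment> \<open>A point interior to \<open>{T1..T}\<close>: there all Taylor coefficients are
    zero.\<close>
  define c where "c = (T1 + T) / 2"
  have c: "T1 < c" "c < T" using T1 by (auto simp: c_def)
  have main: "f 0 s = 0" if s: "0 < s" "s < c" for s
  proof -
    have le: "\<bar>f 0 s\<bar> \<le> P * B * ((K * T) ^ n /\<^sub>R fact n)" if n: "n > 0" for n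
    proof -
      have "\<exists>r. s < r \<and> r < c \<and> f 0 s =
          (\<Sum>m<n. f m c / fact m * (s - c) ^ m) + f n r / fact n * (s - c) ^ n"
        by (rule Taylor_down[where b = c and a = s]) (use s c n fDERIV in auto)
      then obtain r where r: "s < r" "r < c" "f 0 s = f n r / fact n * (s - c) ^ n"
        using f0[of c] c by auto
      have "\<bar>f 0 s\<bar> = \<bar>f n r\<bar> * \<bar>s - c\<bar> ^ n / fact n" by (simp add: r(3) abs_mult power_abs)
      also have "\<dots> \<le> P * B * K ^ n * T ^ n / fact n"
        using fb[of r n] r s c T1 P B K
        by (intro divide_right_mono mult_mono power_mono) auto
      finally show ?thesis by (simp add: power_mult_distrib divide_inverse algebra_simps)
    qed
    have "(\<lambda>n. P * B * ((K * T) ^ n /\<^sub>R fact n)) \<longlonglongrightarrow> P * B * 0"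
      by (intro tendsto_mult tendsto_const summable_LIMSEQ_zero summable_exp_generic)
    then have "\<bar>f 0 s\<bar> \<le> P * B * 0"
      by (rule tendsto_lowerbound) (use le in \<open>auto simp: eventually_sequentially intro!: exI[of _ 1]\<close>)
    then show ?thesis by simp
  qed
  show ?thesis
  proof (cases "t \<ge> T1")
    case True then show ?thesis using zero t by simp
  next
    case False
    have fc: "continuous_on {0..T} (f 0)"
      using fder has_vector_derivative_continuous continuous_on_eq_continuous_within by blast
    have "f 0 t = 0"
    \<comment> \<open>Two-sided derivatives exist only inside the interval, so Taylor's formula
      covers \<open>t > 0\<close> and the endpoint follows by continuity.\<close>
    proof (cases "t = 0")
      case True
      have "(f 0 \<longlongrightarrow> f 0 0) (at 0 within {0..T})"
        using fc T1 by (auto simp: continuous_on)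
      moreover have "\<forall>\<^sub>F s in at 0 within {0..T}. f 0 s = 0"
        unfolding eventually_at using main c T1 by (intro exI[of _ c]) (auto simp: dist_real_def)
      then have "(f 0 \<longlongrightarrow> 0) (at 0 within {0..T})" by (rule tendsto_eventually)
      moreover have "at 0 within {0..T} \<noteq> bot"
        using T1 by (simp add: trivial_limit_within islimpt_Icc)
      ultimately show ?thesis using tendsto_unique True by blast
    next
      case False
      then show ?thesis using main t \<open>\<not> t \<ge> T1\<close> c by auto
    qed
    then show ?thesis by (simp add: f_def)
  qed
qed

section \<open>A left-invariant gauge\<close>

lemma norm_outer_product:
  fixes v :: "real ^ 'm" and w :: "real ^ 'n"
  shows "norm (\<chi> i j. v $ i * w $ j) = norm v * norm w"
proof -
  have "norm (\<chi> j. v $ i * w $ j) = \<bar>v $ i\<bar> * norm w" for i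
  proof -
    have "(\<chi> j. v $ i * w $ j) = (v $ i) *\<^sub>R w" by (simp add: vec_eq_iff)
    then show ?thesis by simp
  qed
  then have "norm (\<chi> i j. v $ i * w $ j) = L2_set (\<lambda>i. \<bar>v $ i\<bar> * norm w) UNIV"
    by (subst norm_vec_def) simp
  also have "\<dots> = norm v * norm w"
    by (simp add: L2_set_left_distrib[symmetric] norm_vec_def)
  finally show ?thesis .
qed

lemma wedge_nth [simp]: "wedge v w $ i $ j = v $ i * w $ j - w $ i * v $ j"
  by (simp add: wedge_def)

lemma norm_wedge_le: "norm (wedge v w) \<le> 2 * (norm v * norm w)"
proof -
  have "wedge v w = (\<chi> i j. v $ i * w $ j) - (\<chi> i j. w $ i * v $ j)"
    by (simp add: vec_eq_iff)
  then have "norm (wedge v w) \<le> norm (\<chi> i j. v $ i * w $ j) + norm (\<chi> i j. w $ i * v $ j)"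
    by (metis norm_triangle_ineq4)
  then show ?thesis by (simp add: norm_outer_product)
qed

lemma bounded_bilinear_wedge: "bounded_bilinear (wedge :: real ^ 'k \<Rightarrow> real ^ 'k \<Rightarrow> real ^ 'k ^ 'k)"
proof
  show "\<exists>K. \<forall>a b :: real ^ 'k. norm (wedge a b) \<le> norm a * norm b * K"
    by (intro exI[of _ 2] allI) (use norm_wedge_le in \<open>simp add: mult.commute\<close>)
qed (simp_all add: vec_eq_iff algebra_simps)

interpretation wedge: bounded_bilinear "wedge :: real ^ 'k \<Rightarrow> real ^ 'k \<Rightarrow> real ^ 'k ^ 'k"
  by (rule bounded_bilinear_wedge)

lemma wedge_self [simp]: "wedge v v = 0"
  by (simp add: vec_eq_iff)

lemma wedge_swap: "wedge v w = - wedge w v"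
  by (simp add: vec_eq_iff)

lemma transpose_wedge: "transpose (wedge v w) = - wedge v w"
  by (simp add: vec_eq_iff transpose_def)

lemma transpose_linear:
  fixes X Y :: "real ^ 'm ^ 'n"
  shows "transpose (X + Y) = transpose X + transpose Y"
    "transpose (X - Y) = transpose X - transpose Y"
    "transpose (- X) = - transpose X"
    "transpose (c *\<^sub>R X) = c *\<^sub>R transpose X"
    "transpose (0 :: real ^ 'm ^ 'n) = 0"
  by (simp_all add: vec_eq_iff transpose_def)

lemma norm_transpose: "norm (transpose X) = norm (X :: real ^ 'm ^ 'n)"
proof -
  have "transpose X \<bullet> transpose X = (\<Sum>i\<in>UNIV. \<Sum>j\<in>UNIV. X $ j $ i * X $ j $ i)"
    by (simp add: inner_vec_def transpose_def)
  also have "\<dots> = X \<bullet> X" by (subst sum.swap) (simp add: inner_vec_def)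
  finally show ?thesis by (simp add: norm_eq_sqrt_inner)
qed

lemma wedge_matrix_vector_mult:
  "wedge (M *v v) (M *v w) = M ** wedge v w ** transpose M"
proof -
  have "(M ** wedge v w ** transpose M) $ i $ j = wedge (M *v v) (M *v w) $ i $ j" for i j
  proof -
    have "(M ** wedge v w ** transpose M) $ i $ j
        = (\<Sum>l\<in>UNIV. \<Sum>m\<in>UNIV. M $ i $ m * (v $ m * w $ l - w $ m * v $ l) * M $ j $ l)"
      by (simp add: matrix_matrix_mult_def transpose_def sum_distrib_right)
    also have "\<dots> = (\<Sum>l\<in>UNIV. \<Sum>m\<in>UNIV. (M $ i $ m * v $ m) * (M $ j $ l * w $ l))
        - (\<Sum>l\<in>UNIV. \<Sum>m\<in>UNIV. (M $ i $ m * w $ m) * (M $ j $ l * v $ l))"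
      by (simp add: sum_subtractf[symmetric] algebra_simps)
    also have "\<dots> = wedge (M *v v) (M *v w) $ i $ j"
      by (simp add: matrix_vector_mult_def sum_product) (subst (1 2) sum.swap, rule refl)
    finally show ?thesis .
  qed
  then show ?thesis by (simp add: vec_eq_iff)
qed

lemma wedge_vector_mult: "wedge v w *v z = (w \<bullet> z) *\<^sub>R v - (v \<bullet> z) *\<^sub>R w"
  by (simp add: vec_eq_iff matrix_vector_mult_def inner_vec_def left_diff_distrib right_diff_distrib
      sum_subtractf sum_distrib_left ac_simps)

text \<open>Pairing with a wedge sees only the skew part of \<open>B\<close>; in this form a
  multiplier on areas acts on the curve as the linear map \<open>B - transpose B\<close>.\<close>

lemma inner_wedge: "B \<bullet> wedge a b = a \<bullet> ((B - transpose B) *v b)"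
proof -
  have "B \<bullet> wedge a b = (\<Sum>i\<in>UNIV. \<Sum>j\<in>UNIV. B $ i $ j * (a $ i * b $ j)) - (\<Sum>i\<in>UNIV. \<Sum>j\<in>UNIV. B $ i $ j * (b $ i * a $ j))"
    by (simp add: inner_vec_def sum_subtractf[symmetric] algebra_simps)
  also have "(\<Sum>i\<in>UNIV. \<Sum>j\<in>UNIV. B $ i $ j * (b $ i * a $ j)) = (\<Sum>i\<in>UNIV. \<Sum>j\<in>UNIV. B $ j $ i * (b $ j * a $ i))"
    by (rule sum.swap)
  finally show ?thesis
    by (simp add: inner_vec_def matrix_vector_mult_def transpose_def sum_distrib_left
        sum_subtractf[symmetric] algebra_simps)
qed

text \<open>The group increment, the inverse of \<open>p\<close> times \<open>q\<close> for the law
  \<open>point_mult\<close>, is put into a homogeneous box: size \<open>r\<close> horizontally and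
  \<open>r^2\<close> vertically.\<close>

definition gauge_le :: "real \<Rightarrow> ('k::finite) point \<Rightarrow> 'k point \<Rightarrow> bool" where
  "gauge_le r p q \<longleftrightarrow> norm (fst q - fst p) \<le> r \<and>
     norm (snd q - snd p - (1/2) *\<^sub>R wedge (fst p) (fst q)) \<le> r\<^sup>2"

lemma gauge_le_0 [simp]: "gauge_le 0 p q \<longleftrightarrow> p = q"
  by (auto simp: gauge_le_def prod_eq_iff)

lemma gauge_le_nonneg: "gauge_le r p q \<Longrightarrow> 0 \<le> r"
  unfolding gauge_le_def by (meson norm_ge_zero order.trans)

lemma gauge_le_mono: "gauge_le r p q \<Longrightarrow> r \<le> s \<Longrightarrow> gauge_le s p q"
  using gauge_le_nonneg[of r p q] power_mono[of r s 2] by (auto simp: gauge_le_def intro: order.trans)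

lemma gauge_le_refl: "0 \<le> r \<Longrightarrow> gauge_le r p p"
  using gauge_le_mono[of 0 p p r] by simp

lemma gauge_le_sym: "gauge_le r p q \<Longrightarrow> gauge_le r q p"
proof -
  have "snd p - snd q - (1/2) *\<^sub>R wedge (fst q) (fst p) = - (snd q - snd p - (1/2) *\<^sub>R wedge (fst p) (fst q))"
    by (subst wedge_swap) simp
  then show "gauge_le r p q \<Longrightarrow> gauge_le r q p"
    by (simp only: gauge_le_def norm_minus_cancel norm_minus_commute)
qed

text \<open>Besides the two vertical increments there is half the wedge of the horizontal ones, of
  norm at most \<open>r * s\<close>. Since \<open>r^2 + s^2 + r * s \<le> (r + s)^2\<close>, no
  constant is lost, and lengths of concatenated curves simply add.\<close>

lemma gauge_le_triangle:
  assumes "gauge_le r p q" "gauge_le s q z"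
  shows "gauge_le (r + s) p z"
proof -
  have x: "norm (fst q - fst p) \<le> r" "norm (fst z - fst q) \<le> s" and rs: "0 \<le> r" "0 \<le> s"
    using assms assms[THEN gauge_le_nonneg] by (auto simp: gauge_le_def)
  let ?d = "\<lambda>p q. snd q - snd p - (1/2) *\<^sub>R wedge (fst p) (fst q)"
  have tri: "norm (A + B + C) \<le> norm A + norm B + norm C" for A B C :: "real ^ 'a ^ 'a"
    using norm_triangle_ineq[of "A + B" C] norm_triangle_ineq[of A B] by simp
  have d: "?d p z = ?d p q + ?d q z + (1/2) *\<^sub>R wedge (fst q - fst p) (fst z - fst q)"
    by (simp add: vec_eq_iff field_simps)
  have "norm (?d p z) \<le> norm (?d p q) + norm (?d q z) + norm ((1/2) *\<^sub>R wedge (fst q - fst p) (fst z - fst q))"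
    unfolding d by (rule tri)
  also have "norm ((1/2) *\<^sub>R wedge (fst q - fst p) (fst z - fst q)) \<le> r * s"
    using norm_wedge_le[of "fst q - fst p" "fst z - fst q"] mult_mono[OF x rs(1)] by simp
  finally have "norm (?d p z) \<le> r\<^sup>2 + s\<^sup>2 + r * s"
    using assms by (simp add: gauge_le_def)
  also have "\<dots> \<le> (r + s)\<^sup>2" using rs by (simp add: power2_sum)
  finally have "norm (?d p z) \<le> (r + s)\<^sup>2" .
  moreover have "norm (fst z - fst p) \<le> r + s"
    using norm_triangle_ineq[of "fst z - fst q" "fst q - fst p"] x by simp
  ultimately show ?thesis by (simp add: gauge_le_def)
qed

lemma gauge_le_tendsto:
  assumes "\<And>n. gauge_le (r n) (p n) (q n)" "r \<longlonglongrightarrow> r'" "p \<longlonglongrightarrow> p'" "q \<longlonglongrightarrow> q'"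
  shows "gauge_le r' p' q'"
  unfolding gauge_le_def
proof
  have "(\<lambda>n. norm (fst (q n) - fst (p n))) \<longlonglongrightarrow> norm (fst q' - fst p')"
    by (intro tendsto_intros assms)
  then show "norm (fst q' - fst p') \<le> r'"
    by (rule LIMSEQ_le[OF _ assms(2)]) (use assms(1) in \<open>auto simp: gauge_le_def\<close>)
  have "(\<lambda>n. norm (snd (q n) - snd (p n) - (1/2) *\<^sub>R wedge (fst (p n)) (fst (q n))))
      \<longlonglongrightarrow> norm (snd q' - snd p' - (1/2) *\<^sub>R wedge (fst p') (fst q'))"
    by (intro tendsto_intros wedge.tendsto assms)
  moreover have "(\<lambda>n. (r n)\<^sup>2) \<longlonglongrightarrow> r'\<^sup>2" by (intro tendsto_intros assms)
  ultimately show "norm (snd q' - snd p' - (1/2) *\<^sub>R wedge (fst p') (fst q')) \<le> r'\<^sup>2"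
    by (rule LIMSEQ_le) (use assms(1) in \<open>auto simp: gauge_le_def\<close>)
qed

text \<open>Euclidean control on bounded sets; it supplies the equicontinuity for Arzela-Ascoli and
  the Lipschitz condition in \<open>is_control\<close>.\<close>

lemma gauge_le_imp_norm_le:
  assumes "gauge_le r p q" "norm (fst p) \<le> B" "r \<le> R"
  shows "norm (q - p) \<le> (1 + R + B) * r"
proof -
  have r: "0 \<le> r" using assms(1) by (rule gauge_le_nonneg)
  have x: "norm (fst q - fst p) \<le> r" using assms(1) by (simp add: gauge_le_def)
  have B: "0 \<le> B" using assms(2) norm_ge_zero order.trans by blast
  have d: "snd q - snd p = (snd q - snd p - (1/2) *\<^sub>R wedge (fst p) (fst q)) + (1/2) *\<^sub>R wedge (fst p) (fst q - fst p)"
    by (simp add: wedge.diff_right)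
  have "norm (snd q - snd p) \<le> norm (snd q - snd p - (1/2) *\<^sub>R wedge (fst p) (fst q))
      + norm ((1/2) *\<^sub>R wedge (fst p) (fst q - fst p))"
    by (subst d) (rule norm_triangle_ineq)
  also have "norm (snd q - snd p - (1/2) *\<^sub>R wedge (fst p) (fst q)) \<le> r\<^sup>2"
    using assms(1) by (simp add: gauge_le_def)
  also have "norm ((1/2) *\<^sub>R wedge (fst p) (fst q - fst p)) \<le> B * r"
    using norm_wedge_le[of "fst p" "fst q - fst p"] mult_mono[OF assms(2) x B] by simp
  also have "r\<^sup>2 \<le> R * r" using assms(3) r by (simp add: power2_eq_square mult_right_mono)
  finally have "norm (snd q - snd p) \<le> R * r + B * r" by simp
  moreover have "norm (q - p) \<le> norm (fst q - fst p) + norm (snd q - snd p)"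
    unfolding fst_diff[symmetric] snd_diff[symmetric] by (metis norm_Pair_le prod.collapse)
  ultimately show ?thesis using x by (simp add: algebra_simps)
qed

section \<open>Left translations and the action of orthogonal matrices\<close>

definition point_mult :: "('k::finite) point \<Rightarrow> 'k point \<Rightarrow> 'k point" where
  "point_mult p q = (fst p + fst q, snd p + snd q + (1/2) *\<^sub>R wedge (fst p) (fst q))"

lemma gauge_le_point_mult: "gauge_le r (point_mult a p) (point_mult a q) \<longleftrightarrow> gauge_le r p q"
proof -
  have "snd (point_mult a q) - snd (point_mult a p)
        - (1/2) *\<^sub>R wedge (fst (point_mult a p)) (fst (point_mult a q))
      = snd q - snd p - (1/2) *\<^sub>R wedge (fst p) (fst q)"
    using wedge_swap[of "fst p" "fst a"]
    by (simp add: point_mult_def wedge.add_left wedge.add_right scaleR_add_right scaleR_diff_right)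
  moreover have "fst (point_mult a q) - fst (point_mult a p) = fst q - fst p"
    by (simp add: point_mult_def)
  ultimately show ?thesis unfolding gauge_le_def by (simp only:)
qed

lemma point_mult_carnot_group:
  "p \<in> carnot_group \<Longrightarrow> q \<in> carnot_group \<Longrightarrow> point_mult p q \<in> carnot_group"
  by (auto simp: carnot_group_def point_mult_def transpose_linear transpose_wedge)

text \<open>The group endomorphism that extends the linear map \<open>M\<close> of the horizontal
  layer.\<close>

definition point_conj :: "real ^ 'k ^ 'k \<Rightarrow> ('k::finite) point \<Rightarrow> 'k point" where
  "point_conj M p = (M *v fst p, M ** snd p ** transpose M)"

lemma norm_matrix_vector_orthogonal:
  "orthogonal_matrix (M :: real ^ 'k ^ 'k) \<Longrightarrow> norm (M *v x) = norm x"
  using orthogonal_transformation_matrix[of "(*v) M"] orthogonal_transformation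
  by (auto simp: orthogonal_transformation)

lemma norm_matrix_mult_transpose_orthogonal:
  fixes M X :: "real ^ 'k ^ 'k"
  assumes "orthogonal_matrix M"
  shows "norm (X ** transpose M) = norm X"
proof -
  have "(X ** transpose M) $ i = M *v (X $ i)" for i
    by (simp add: vec_eq_iff matrix_matrix_mult_def matrix_vector_mult_def transpose_def mult.commute)
  then show ?thesis
    by (simp add: norm_vec_def[of "X ** transpose M"] norm_vec_def[of X] norm_matrix_vector_orthogonal[OF assms])
qed

lemma norm_conj_orthogonal:
  fixes M X :: "real ^ 'k ^ 'k"
  assumes "orthogonal_matrix M"
  shows "norm (M ** X ** transpose M) = norm X"
proof -
  have "norm (M ** X ** transpose M) = norm (transpose (M ** X))"
    by (simp add: norm_matrix_mult_transpose_orthogonal assms norm_transpose)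
  also have "\<dots> = norm (transpose X ** transpose M)" by (simp add: matrix_transpose_mul)
  also have "\<dots> = norm X" by (simp add: norm_matrix_mult_transpose_orthogonal assms norm_transpose)
  finally show ?thesis .
qed

lemma matrix_mult_linear:
  fixes A :: "real ^ 'm ^ 'n" and B C :: "real ^ 'l ^ 'm" and D E :: "real ^ 'm ^ 'n"
  shows "A ** (B - C) = A ** B - A ** C" "(D - E) ** B = D ** B - E ** B"
    "A ** (B + C) = A ** B + A ** C" "(D + E) ** B = D ** B + E ** B"
    "A ** (c *\<^sub>R B) = c *\<^sub>R (A ** B)" "(c *\<^sub>R A) ** B = c *\<^sub>R (A ** B)"
    "A ** (- B) = - (A ** B)" "(- A) ** B = - (A ** B)"
  by (simp_all add: vec_eq_iff matrix_matrix_mult_def sum_subtractf sum.distrib sum_negf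
      sum_distrib_left algebra_simps)

lemma gauge_le_point_conj:
  assumes M: "orthogonal_matrix M" and "gauge_le r p q"
  shows "gauge_le r (point_conj M p) (point_conj M q)"
proof -
  have "fst (point_conj M q) - fst (point_conj M p) = M *v (fst q - fst p)"
    by (simp add: point_conj_def matrix_vector_mult_diff_distrib)
  moreover have "snd (point_conj M q) - snd (point_conj M p)
        - (1/2) *\<^sub>R wedge (fst (point_conj M p)) (fst (point_conj M q))
      = M ** (snd q - snd p - (1/2) *\<^sub>R wedge (fst p) (fst q)) ** transpose M"
    by (simp add: point_conj_def wedge_matrix_vector_mult matrix_mult_linear)
  ultimately show ?thesis
    using assms(2) unfolding gauge_le_def
    by (simp only: norm_matrix_vector_orthogonal[OF M] norm_conj_orthogonal[OF M])
qed

lemma point_conj_carnot_group: "p \<in> carnot_group \<Longrightarrow> point_conj M p \<in> carnot_group"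
  by (auto simp: carnot_group_def point_conj_def matrix_transpose_mul matrix_mul_assoc matrix_mult_linear)

lemma closed_carnot_group: "closed (carnot_group :: ('k::finite) point set)"
proof -
  have "linear (\<lambda>p :: 'k point. transpose (snd p) + snd p)"
    by (rule linearI) (auto simp: transpose_linear scaleR_add_right)
  then have "continuous_on UNIV (\<lambda>p :: 'k point. transpose (snd p) + snd p)"
    by (intro linear_continuous_on) (simp add: linear_conv_bounded_linear)
  then have "closed {p :: 'k point. transpose (snd p) + snd p = 0}"
    by (intro closed_Collect_eq continuous_on_const)
  also have "{p :: 'k point. transpose (snd p) + snd p = 0} = carnot_group"
    by (auto simp: carnot_group_def eq_neg_iff_add_eq_0)
  finally show ?thesis .
qed

lemma zero_mem_carnot_group: "0 \<in> carnot_group"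
  by (simp add: carnot_group_def zero_prod_def transpose_linear)

section \<open>Curves that are Lipschitz for the gauge\<close>

definition gauge_lipschitz :: "real \<Rightarrow> real set \<Rightarrow> (real \<Rightarrow> ('k::finite) point) \<Rightarrow> bool" where
  "gauge_lipschitz c S \<gamma> \<longleftrightarrow>
     \<gamma> ` S \<subseteq> carnot_group \<and> (\<forall>s\<in>S. \<forall>t\<in>S. gauge_le (c * \<bar>t - s\<bar>) (\<gamma> s) (\<gamma> t))"

lemma gauge_lipschitzI:
  assumes "\<And>t. t \<in> S \<Longrightarrow> \<gamma> t \<in> carnot_group"
    and "\<And>s t. s \<in> S \<Longrightarrow> t \<in> S \<Longrightarrow> s \<le> t \<Longrightarrow> gauge_le (c * (t - s)) (\<gamma> s) (\<gamma> t)"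
  shows "gauge_lipschitz c S \<gamma>"
  unfolding gauge_lipschitz_def
proof (intro conjI ballI)
  fix s t assume "s \<in> S" "t \<in> S"
  then show "gauge_le (c * \<bar>t - s\<bar>) (\<gamma> s) (\<gamma> t)"
    using assms(2)[of s t] gauge_le_sym[OF assms(2)[of t s]] by (cases "s \<le> t") auto
qed (use assms(1) in auto)

lemma gauge_lipschitz_mem: "gauge_lipschitz c S \<gamma> \<Longrightarrow> t \<in> S \<Longrightarrow> \<gamma> t \<in> carnot_group"
  by (auto simp: gauge_lipschitz_def)

lemma gauge_lipschitzD:
  assumes "gauge_lipschitz c S \<gamma>" "s \<in> S" "t \<in> S" "s \<le> t"
  shows "gauge_le (c * (t - s)) (\<gamma> s) (\<gamma> t)"
proof -
  have "gauge_le (c * \<bar>t - s\<bar>) (\<gamma> s) (\<gamma> t)" using assms(1-3) unfolding gauge_lipschitz_def by blast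
  then show ?thesis using assms(4) by simp
qed

lemma gauge_lipschitz_subset: "gauge_lipschitz c S \<gamma> \<Longrightarrow> T \<subseteq> S \<Longrightarrow> gauge_lipschitz c T \<gamma>"
  by (auto simp: gauge_lipschitz_def)

lemma gauge_lipschitz_cong:
  "(\<And>t. t \<in> S \<Longrightarrow> \<gamma> t = \<eta> t) \<Longrightarrow> gauge_lipschitz c S \<gamma> \<longleftrightarrow> gauge_lipschitz c S \<eta>"
  by (auto simp: gauge_lipschitz_def)

lemma gauge_lipschitz_nonneg: "gauge_lipschitz c {a..b} \<gamma> \<Longrightarrow> a < b \<Longrightarrow> 0 \<le> c"
  using gauge_lipschitzD[of c "{a..b}" \<gamma> a b] gauge_le_nonneg by (fastforce simp: zero_le_mult_iff)

lemma gauge_lipschitz_join: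
  assumes "gauge_lipschitz c {a..b} \<gamma>" "gauge_lipschitz c {b..e} \<gamma>"
  shows "gauge_lipschitz c {a..e} \<gamma>"
proof (rule gauge_lipschitzI)
  fix t assume "t \<in> {a..e}"
  then show "\<gamma> t \<in> carnot_group"
    using assms gauge_lipschitz_mem by (cases "t \<le> b") fastforce+
next
  fix s t assume st: "s \<in> {a..e}" "t \<in> {a..e}" "s \<le> t"
  consider "t \<le> b" | "b \<le> s" | "s \<le> b" "b \<le> t" by linarith
  then show "gauge_le (c * (t - s)) (\<gamma> s) (\<gamma> t)"
  proof cases
    case 3
    have "gauge_le (c * (b - s) + c * (t - b)) (\<gamma> s) (\<gamma> t)"
      using st 3 by (intro gauge_le_triangle[where q = "\<gamma> b"] gauge_lipschitzD[OF assms(1)] gauge_lipschitzD[OF assms(2)]) auto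
    then show ?thesis by (simp add: algebra_simps)
  qed (use st gauge_lipschitzD[OF assms(1)] gauge_lipschitzD[OF assms(2)] in auto)
qed

lemma gauge_lipschitz_affine:
  assumes "gauge_lipschitz c {m * a + d..m * b + d} \<gamma>" "0 \<le> m"
  shows "gauge_lipschitz (c * m) {a..b} (\<lambda>t. \<gamma> (m * t + d))"
proof (rule gauge_lipschitzI)
  have m: "m * t + d \<in> {m * a + d..m * b + d}" if "t \<in> {a..b}" for t
    using that assms(2) by (auto intro: mult_left_mono)
  then show "\<gamma> (m * t + d) \<in> carnot_group" if "t \<in> {a..b}" for t
    using that gauge_lipschitz_mem[OF assms(1)] by blast
  fix s t assume st: "s \<in> {a..b}" "t \<in> {a..b}" "s \<le> t"
  have "gauge_le (c * ((m * t + d) - (m * s + d))) (\<gamma> (m * s + d)) (\<gamma> (m * t + d))"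
    using st m assms(2) by (intro gauge_lipschitzD[OF assms(1)]) (auto intro: mult_left_mono)
  then show "gauge_le (c * m * (t - s)) (\<gamma> (m * s + d)) (\<gamma> (m * t + d))"
    by (simp add: algebra_simps)
qed

lemma gauge_lipschitz_fst:
  assumes "gauge_lipschitz c {a..b} \<gamma>" "0 \<le> c"
  shows "c-lipschitz_on {a..b} (\<lambda>t. fst (\<gamma> t))"
proof (rule lipschitz_onI[OF _ assms(2)])
  fix s t assume "s \<in> {a..b}" "t \<in> {a..b}"
  then have "gauge_le (c * \<bar>s - t\<bar>) (\<gamma> t) (\<gamma> s)" using assms(1) by (auto simp: gauge_lipschitz_def)
  then show "dist (fst (\<gamma> s)) (fst (\<gamma> t)) \<le> c * dist s t"
    by (simp add: gauge_le_def dist_norm dist_real_def)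
qed

lemma gauge_lipschitz_norm_bounds:
  assumes \<gamma>: "gauge_lipschitz c {a..b} \<gamma>" and "0 \<le> c" and s: "s \<in> {a..b}"
  shows "norm (fst (\<gamma> s)) \<le> norm (fst (\<gamma> a)) + c * (b - a)"
    and "t \<in> {a..b} \<Longrightarrow>
      norm (\<gamma> t - \<gamma> s) \<le> (1 + c * (b - a) + (norm (fst (\<gamma> a)) + c * (b - a))) * (c * \<bar>t - s\<bar>)"
proof -
  let ?B = "norm (fst (\<gamma> a)) + c * (b - a)"
  have "gauge_le (c * (s - a)) (\<gamma> a) (\<gamma> s)" using s by (intro gauge_lipschitzD[OF \<gamma>]) auto
  then have "norm (fst (\<gamma> s)) \<le> norm (fst (\<gamma> a)) + c * (s - a)"
    using norm_triangle_sub[of "fst (\<gamma> s)" "fst (\<gamma> a)"] by (simp add: gauge_le_def)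
  also have "c * (s - a) \<le> c * (b - a)" using s \<open>0 \<le> c\<close> by (intro mult_left_mono) auto
  finally show B: "norm (fst (\<gamma> s)) \<le> ?B" by simp
  assume t: "t \<in> {a..b}"
  have "gauge_le (c * \<bar>t - s\<bar>) (\<gamma> s) (\<gamma> t)" using \<gamma> s t by (auto simp: gauge_lipschitz_def)
  moreover have "c * \<bar>t - s\<bar> \<le> c * (b - a)" using s t \<open>0 \<le> c\<close> by (intro mult_left_mono) auto
  ultimately show "norm (\<gamma> t - \<gamma> s) \<le> (1 + c * (b - a) + ?B) * (c * \<bar>t - s\<bar>)"
    using gauge_le_imp_norm_le B by blast
qed

lemma borel_measurable_lebesgue_on:
  "u \<in> borel_measurable borel \<Longrightarrow> u \<in> borel_measurable (lebesgue_on S)"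
  by (intro measurable_restrict_space1 measurable_completion) simp

text \<open>The vertical gauge bound says that \<open>Y\<close> deviates from its horizontal
  prediction at time \<open>t\<close> by at most a multiple of \<open>(s - t)^2\<close>. The
  deviation therefore has derivative 0, and \<open>Y\<close> moves as the derivative of
  \<open>x\<close> dictates.\<close>

lemma gauge_lipschitz_imp_control:
  assumes \<gamma>: "gauge_lipschitz c {a..b} \<gamma>" and ab: "a < b"
  obtains u where "is_control a b \<gamma> u" "u \<in> borel_measurable borel" "\<And>t. norm (u t) \<le> c"
proof -
  have c: "0 \<le> c" using gauge_lipschitz_nonneg[OF \<gamma> ab] .
  obtain u where u: "u \<in> borel_measurable borel" "\<And>t. norm (u t) \<le> c"
    "AE t in lebesgue_on {a..b}. ((\<lambda>t. fst (\<gamma> t)) has_vector_derivative u t) (at t within {a..b})"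
    by (rule lipschitz_imp_AE_vector_derivative[OF gauge_lipschitz_fst[OF \<gamma> c] ab]) blast
  let ?B = "norm (fst (\<gamma> a)) + c * (b - a)"
  have "(\<gamma> has_vector_derivative (\<Sum>i\<in>UNIV. (u t $ i) *\<^sub>R frame_field i (\<gamma> t))) (at t within {a..b})"
    if t: "t \<in> {a..b}" and d: "((\<lambda>t. fst (\<gamma> t)) has_vector_derivative u t) (at t within {a..b})" for t
  proof -
    define R where "R s = snd (\<gamma> s) - snd (\<gamma> t) - (1/2) *\<^sub>R wedge (fst (\<gamma> t)) (fst (\<gamma> s))" for s
    have Rb: "norm (R s) \<le> (c * \<bar>s - t\<bar>)\<^sup>2" if "s \<in> {a..b}" for s
      using \<gamma> t that unfolding gauge_lipschitz_def gauge_le_def R_def by blast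
    have "(R has_vector_derivative 0) (at t within {a..b})"
      unfolding has_vector_derivative_def has_derivative_within_alt
    proof (intro conjI allI impI)
      fix e :: real assume "0 < e"
      have "norm (R s - R t - (s - t) *\<^sub>R 0) \<le> e * norm (s - t)"
        if "s \<in> {a..b}" "norm (s - t) < e / (c\<^sup>2 + 1)" for s
      proof -
        have "R t = 0" by (simp add: R_def)
        then have "norm (R s - R t - (s - t) *\<^sub>R 0) \<le> (c\<^sup>2 * \<bar>s - t\<bar>) * \<bar>s - t\<bar>"
          using Rb[OF that(1)] by (simp add: power2_eq_square algebra_simps)
        also have "c\<^sup>2 * \<bar>s - t\<bar> \<le> (c\<^sup>2 + 1) * \<bar>s - t\<bar>" by (intro mult_right_mono) auto
        also have "\<dots> \<le> e" using that(2) by (simp add: field_simps add_pos_nonneg)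
        finally show ?thesis by (simp add: mult_right_mono)
      qed
      then show "\<exists>d>0. \<forall>y\<in>{a..b}. norm (y - t) < d \<longrightarrow>
          norm (R y - R t - (y - t) *\<^sub>R 0) \<le> e * norm (y - t)"
        using \<open>0 < e\<close> by (intro exI[of _ "e / (c\<^sup>2 + 1)"]) (auto simp: add_nonneg_pos)
    qed simp
    moreover have "((\<lambda>s. snd (\<gamma> t) + (1/2) *\<^sub>R wedge (fst (\<gamma> t)) (fst (\<gamma> s))) has_vector_derivative
        0 + (1/2) *\<^sub>R wedge (fst (\<gamma> t)) (u t)) (at t within {a..b})"
      by (intro has_vector_derivative_add has_vector_derivative_const
          bounded_linear.has_vector_derivative[OF bounded_linear_scaleR_right]
          bounded_linear.has_vector_derivative[OF wedge.bounded_linear_right] d)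
    ultimately have "((\<lambda>s. R s + (snd (\<gamma> t) + (1/2) *\<^sub>R wedge (fst (\<gamma> t)) (fst (\<gamma> s)))) has_vector_derivative
        0 + (0 + (1/2) *\<^sub>R wedge (fst (\<gamma> t)) (u t))) (at t within {a..b})"
      by (rule has_vector_derivative_add)
    then have "((\<lambda>s. snd (\<gamma> s)) has_vector_derivative (1/2) *\<^sub>R wedge (fst (\<gamma> t)) (u t)) (at t within {a..b})"
      by (simp add: R_def)
    from has_vector_derivative_Pair[OF d this] show ?thesis
      by (simp add: sum_frame_field)
  qed
  moreover have "\<exists>L. L-lipschitz_on {a..b} \<gamma>"
  proof (intro exI lipschitz_onI)
    fix s t assume "s \<in> {a..b}" "t \<in> {a..b}"
    then show "dist (\<gamma> s) (\<gamma> t) \<le> ((1 + c * (b - a) + ?B) * c) * dist s t"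
      using gauge_lipschitz_norm_bounds(2)[OF \<gamma> c, of t s] by (simp add: dist_norm dist_real_def)
  qed (use c ab in simp)
  moreover have "AE t in lebesgue_on {a..b}. t \<in> {a..b}" by (rule AE_I2) simp
  ultimately have "is_control a b \<gamma> u"
    unfolding is_control_def
    using u \<gamma> gauge_lipschitz_mem[OF \<gamma>]
    by (auto intro: borel_measurable_lebesgue_on elim!: eventually_elim2)
  then show thesis using that u by blast
qed

lemma has_integral_0_nonneg_AE:
  fixes f :: "'a::euclidean_space \<Rightarrow> real"
  assumes "(f has_integral 0) S" "S \<in> sets lebesgue" "\<And>x. x \<in> S \<Longrightarrow> 0 \<le> f x"
  shows "AE x in lebesgue_on S. f x = 0"
proof -
  have "f absolutely_integrable_on S"
    using assms by (intro nonnegative_absolutely_integrable_1) (auto simp: integrable_on_def)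
  then have I: "integrable (lebesgue_on S) f"
    using assms(2) by (rule absolutely_integrable_imp_integrable)
  have "integral\<^sup>L (lebesgue_on S) f = 0"
    using lebesgue_integral_eq_integral[OF I assms(2)] assms(1) by (simp add: integral_unique)
  moreover have "AE x in lebesgue_on S. 0 \<le> f x" using assms(3) by (intro AE_I2) auto
  ultimately show ?thesis using integral_nonneg_eq_0_iff_AE[OF I] by blast
qed

lemma control_has_integral:
  assumes u: "is_control a b \<gamma> u" and st: "a \<le> s" "s \<le> t" "t \<le> b"
  shows "(u has_integral (fst (\<gamma> t) - fst (\<gamma> s))) {s..t}"
    and "((\<lambda>r. (1/2) *\<^sub>R wedge (fst (\<gamma> r)) (u r)) has_integral (snd (\<gamma> t) - snd (\<gamma> s))) {s..t}"
proof -
  obtain L where L: "L-lipschitz_on {a..b} \<gamma>" using u by (auto simp: is_control_def)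
  have "AE t in lebesgue_on {a..b}. (\<gamma> has_vector_derivative (u t, (1/2) *\<^sub>R wedge (fst (\<gamma> t)) (u t))) (at t within {a..b})"
    using u by (simp add: is_control_def sum_frame_field)
  then have I: "((\<lambda>t. (u t, (1/2) *\<^sub>R wedge (fst (\<gamma> t)) (u t))) has_integral (\<gamma> t - \<gamma> s)) {s..t}"
    by (rule has_integral_AE_derivative_lipschitz[OF L _ st])
  show "(u has_integral (fst (\<gamma> t) - fst (\<gamma> s))) {s..t}"
    using has_integral_linear[OF I bounded_linear_fst] by (simp add: o_def)
  show "((\<lambda>r. (1/2) *\<^sub>R wedge (fst (\<gamma> r)) (u r)) has_integral (snd (\<gamma> t) - snd (\<gamma> s))) {s..t}"
    using has_integral_linear[OF I bounded_linear_snd] by (simp add: o_def)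
qed

lemma control_norm_integral:
  assumes u: "is_control a b \<gamma> u"
  shows "(\<lambda>t. norm (u t)) integrable_on {a..b}"
    and "curve_length a b \<gamma> = integral {a..b} (\<lambda>t. norm (u t))"
proof -
  obtain C where C: "AE t in lebesgue_on {a..b}. norm (u t) \<le> C"
    using u by (auto simp: is_control_def)
  have "finite_measure (lebesgue_on {a..b})"
    by (rule finite_measure_lebesgue_on) simp
  then have I: "integrable (lebesgue_on {a..b}) (\<lambda>t. norm (u t))"
    by (rule finite_measure.integrable_const_bound[where B = C])
       (use C u in \<open>auto simp: is_control_def\<close>)
  show "(\<lambda>t. norm (u t)) integrable_on {a..b}"
    using I by (rule integrable_on_lebesgue_on) simp
  show "curve_length a b \<gamma> = integral {a..b} (\<lambda>t. norm (u t))"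
    using curve_length_eq[OF u] lebesgue_integral_eq_integral[OF I] by simp
qed

text \<open>On \<open>{s..t}\<close> the curve \<open>x\<close> stays within the length from
  \<open>x s\<close>, so the vertical increment, an integral of half the wedge of
  \<open>x r - x s\<close> with \<open>u r\<close>, is at most the square of the length. This is the
  scaling that the gauge encodes.\<close>

lemma gauge_le_integral:
  fixes a b :: real
  assumes x: "\<And>s t. \<lbrakk>a \<le> s; s \<le> t; t \<le> b\<rbrakk> \<Longrightarrow> (u has_integral (x t - x s)) {s..t}"
    and Y: "\<And>s t. \<lbrakk>a \<le> s; s \<le> t; t \<le> b\<rbrakk> \<Longrightarrow>
      ((\<lambda>r. (1/2) *\<^sub>R wedge (x r) (u r)) has_integral (Y t - Y s)) {s..t}"
    and n: "(\<lambda>t. norm (u t)) integrable_on {a..b}"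
    and st: "a \<le> s" "s \<le> t" "t \<le> b"
  shows "gauge_le (integral {s..t} (\<lambda>r. norm (u r))) (x s, Y s) (x t, Y t)"
proof -
  let ?\<phi> = "integral {s..t} (\<lambda>r. norm (u r))"
  have nst: "(\<lambda>t. norm (u t)) integrable_on {p..q}" if "a \<le> p" "q \<le> b" for p q
    by (rule integrable_on_subinterval[OF n]) (use that in auto)
  have pos: "0 \<le> ?\<phi>" by (intro integral_nonneg nst st) auto
  have bd: "norm (x r - x s) \<le> ?\<phi>" if r: "r \<in> {s..t}" for r
  proof -
    have "norm (integral {s..r} u) \<le> integral {s..r} (\<lambda>r. norm (u r))"
      using x[of s r] r st by (intro integral_norm_bound_integral nst) (auto simp: integrable_on_def)
    also have "\<dots> \<le> ?\<phi>"
      using r st by (intro integral_subset_le nst) auto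
    finally show ?thesis using x[of s r] r st by (auto simp: integral_unique)
  qed
  have "((\<lambda>r. (1/2) *\<^sub>R wedge (x r) (u r) - (1/2) *\<^sub>R wedge (x s) (u r)) has_integral
      (Y t - Y s - (1/2) *\<^sub>R wedge (x s) (x t - x s))) {s..t}"
    by (intro has_integral_diff Y st has_integral_cmul
        has_integral_linear[OF x[OF st] wedge.bounded_linear_right, unfolded o_def])
  then have I1: "((\<lambda>r. (1/2) *\<^sub>R wedge (x r - x s) (u r)) has_integral
      (Y t - Y s - (1/2) *\<^sub>R wedge (x s) (x t))) {s..t}"
    by (simp add: wedge.diff_left wedge.diff_right scaleR_diff_right)
  have I2: "((\<lambda>r. ?\<phi> * norm (u r)) has_integral ?\<phi> * ?\<phi>) {s..t}"
    by (intro has_integral_mult_right integrable_integral nst st)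
  have le: "norm ((1/2) *\<^sub>R wedge (x r - x s) (u r)) \<le> ?\<phi> * norm (u r)" if "r \<in> {s..t}" for r
  proof -
    have "norm ((1/2) *\<^sub>R wedge (x r - x s) (u r)) \<le> norm (x r - x s) * norm (u r)"
      using norm_wedge_le[of "x r - x s" "u r"] by simp
    also have "\<dots> \<le> ?\<phi> * norm (u r)" by (intro mult_right_mono bd that) simp
    finally show ?thesis .
  qed
  have "norm (Y t - Y s - (1/2) *\<^sub>R wedge (x s) (x t)) \<le> ?\<phi> * ?\<phi>"
    using integral_norm_bound_integral[OF has_integral_integrable[OF I1] has_integral_integrable[OF I2] le]
    unfolding integral_unique[OF I1] integral_unique[OF I2] .
  then show ?thesis using bd[of t] st by (simp add: gauge_le_def power2_eq_square)
qed

section \<open>Existence of minimizers\<close>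

text \<open>Reachability with length at most \<open>r\<close>. The distance becomes the least such
  \<open>r\<close>, so that upper bounds on it need only a gauge-Lipschitz curve.\<close>

definition joins :: "real \<Rightarrow> ('k::finite) point \<Rightarrow> 'k point \<Rightarrow> bool" where
  "joins r p q \<longleftrightarrow> 0 \<le> r \<and> (\<exists>\<gamma>. gauge_lipschitz 1 {0..r} \<gamma> \<and> \<gamma> 0 = p \<and> \<gamma> r = q)"

text \<open>Arc length parametrisation; \<open>\<phi>\<close> need not be injective, since \<open>\<phi> s = \<phi> t\<close> forces \<open>\<gamma> s = \<gamma> t\<close>.\<close>

lemma joins_reparametrize:
  fixes a b :: real
  assumes \<phi>: "continuous_on {a..b} \<phi>" "\<phi> a = 0" and ab: "a \<le> b"
    and g: "\<And>s t. \<lbrakk>a \<le> s; s \<le> t; t \<le> b\<rbrakk> \<Longrightarrow> gauge_le (\<phi> t - \<phi> s) (\<gamma> s) (\<gamma> t)"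
    and G: "\<And>t. t \<in> {a..b} \<Longrightarrow> \<gamma> t \<in> carnot_group"
  shows "joins (\<phi> b) (\<gamma> a) (\<gamma> b)"
proof -
  have mono: "\<phi> s \<le> \<phi> t" if "a \<le> s" "s \<le> t" "t \<le> b" for s t
    using gauge_le_nonneg[OF g[OF that]] by simp
  have pos: "0 \<le> \<phi> b" using mono[of a b] \<phi>(2) ab by simp
  have "\<exists>t. t \<in> {a..b} \<and> \<phi> t = r" if "r \<in> {0..\<phi> b}" for r
    using IVT'[of \<phi> a r b] \<phi> ab that by auto
  then have "\<forall>r\<in>{0..\<phi> b}. \<exists>t. t \<in> {a..b} \<and> \<phi> t = r" by blast
  from bchoice[OF this] obtain \<tau> where "\<forall>r\<in>{0..\<phi> b}. \<tau> r \<in> {a..b} \<and> \<phi> (\<tau> r) = r" ..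
  then have \<tau>: "\<And>r. r \<in> {0..\<phi> b} \<Longrightarrow> \<tau> r \<in> {a..b} \<and> \<phi> (\<tau> r) = r" by blast
  have eq: "\<gamma> s = \<gamma> t" if "s \<in> {a..b}" "t \<in> {a..b}" "\<phi> s = \<phi> t" for s t
  proof (cases "s \<le> t")
    case True
    then show ?thesis using g[of s t] that by simp
  next
    case False
    then show ?thesis using g[of t s] that by simp
  qed
  have "gauge_lipschitz 1 {0..\<phi> b} (\<lambda>r. \<gamma> (\<tau> r))"
  proof (rule gauge_lipschitzI)
    show "\<gamma> (\<tau> t) \<in> carnot_group" if "t \<in> {0..\<phi> b}" for t using G \<tau> that by blast
    fix s t assume st: "s \<in> {0..\<phi> b}" "t \<in> {0..\<phi> b}" "s \<le> t"
    show "gauge_le (1 * (t - s)) (\<gamma> (\<tau> s)) (\<gamma> (\<tau> t))"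
    proof (cases "\<tau> s \<le> \<tau> t")
      case True
      then show ?thesis using g[of "\<tau> s" "\<tau> t"] \<tau>[OF st(1)] \<tau>[OF st(2)] by simp
    next
      case False
      then have "\<phi> (\<tau> s) = \<phi> (\<tau> t)" using mono[of "\<tau> t" "\<tau> s"] \<tau>[OF st(1)] \<tau>[OF st(2)] st(3) by simp
      then have "\<gamma> (\<tau> s) = \<gamma> (\<tau> t)" using eq[of "\<tau> s" "\<tau> t"] \<tau>[OF st(1)] \<tau>[OF st(2)] by simp
      then show ?thesis using st(3) by (simp add: gauge_le_refl)
    qed
  qed
  moreover have "\<gamma> (\<tau> 0) = \<gamma> a"
    by (rule eq) (use \<tau>[of 0] pos ab \<phi>(2) in auto)
  moreover have "\<gamma> (\<tau> (\<phi> b)) = \<gamma> b"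
    by (rule eq) (use \<tau>[of "\<phi> b"] pos ab in auto)
  ultimately show ?thesis unfolding joins_def using pos by (intro conjI exI[of _ "\<lambda>r. \<gamma> (\<tau> r)"])
qed

lemma joins_integral:
  fixes a b :: real
  assumes x: "\<And>s t. \<lbrakk>a \<le> s; s \<le> t; t \<le> b\<rbrakk> \<Longrightarrow> (u has_integral (x t - x s)) {s..t}"
    and Y: "\<And>s t. \<lbrakk>a \<le> s; s \<le> t; t \<le> b\<rbrakk> \<Longrightarrow>
      ((\<lambda>r. (1/2) *\<^sub>R wedge (x r) (u r)) has_integral (Y t - Y s)) {s..t}"
    and n: "(\<lambda>t. norm (u t)) integrable_on {a..b}" and ab: "a \<le> b"
    and G: "\<And>t. t \<in> {a..b} \<Longrightarrow> (x t, Y t) \<in> carnot_group"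
  shows "joins (integral {a..b} (\<lambda>t. norm (u t))) (x a, Y a) (x b, Y b)"
proof -
  define \<phi> where "\<phi> t = integral {a..t} (\<lambda>t. norm (u t))" for t
  have "joins (\<phi> b) ((\<lambda>t. (x t, Y t)) a) ((\<lambda>t. (x t, Y t)) b)"
  proof (rule joins_reparametrize[OF _ _ ab])
    show "continuous_on {a..b} \<phi>" unfolding \<phi>_def by (rule indefinite_integral_continuous_1[OF n])
    show "\<phi> a = 0" by (simp add: \<phi>_def)
    fix s t assume st: "a \<le> s" "s \<le> t" "t \<le> b"
    have "(\<lambda>t. norm (u t)) integrable_on {a..t}"
      by (rule integrable_on_subinterval[OF n]) (use st in auto)
    then have "\<phi> t - \<phi> s = integral {s..t} (\<lambda>r. norm (u r))"
      using Henstock_Kurzweil_Integration.integral_combine[of a s t "\<lambda>r. norm (u r)"] st by (simp add: \<phi>_def)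
    then show "gauge_le (\<phi> t - \<phi> s) (x s, Y s) (x t, Y t)"
      using gauge_le_integral[OF x Y n st] by simp
  qed (use G in auto)
  then show ?thesis by (simp add: \<phi>_def)
qed

lemma control_gauge_le:
  assumes u: "is_control a b \<gamma> u" and st: "a \<le> s" "s \<le> t" "t \<le> b"
  shows "gauge_le (integral {s..t} (\<lambda>r. norm (u r))) (\<gamma> s) (\<gamma> t)"
  using gauge_le_integral[OF control_has_integral[OF u] control_norm_integral(1)[OF u] st] by simp

lemma control_joins:
  assumes u: "is_control a b \<gamma> u" and ab: "a \<le> b"
  shows "joins (curve_length a b \<gamma>) (\<gamma> a) (\<gamma> b)"
proof -
  have "\<gamma> t \<in> carnot_group" if "t \<in> {a..b}" for t using u that by (auto simp: is_control_def)
  then show ?thesis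
    using joins_integral[OF control_has_integral[OF u] control_norm_integral(1)[OF u] ab]
      control_norm_integral(2)[OF u] by simp
qed

lemma gauge_lipschitz_joins:
  assumes \<gamma>: "gauge_lipschitz c {a..b} \<gamma>" and st: "a \<le> s" "s \<le> t" "t \<le> b"
  shows "joins (c * (t - s)) (\<gamma> s) (\<gamma> t)"
proof -
  have "joins ((\<lambda>r. c * (r - s)) t) (\<gamma> s) (\<gamma> t)"
  proof (rule joins_reparametrize[of s t])
    fix p q assume "s \<le> p" "p \<le> q" "q \<le> t"
    then have "gauge_le (c * (q - p)) (\<gamma> p) (\<gamma> q)" using st by (intro gauge_lipschitzD[OF \<gamma>]) auto
    then show "gauge_le (c * (q - s) - c * (p - s)) (\<gamma> p) (\<gamma> q)" by (simp add: algebra_simps)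
  qed (use st gauge_lipschitz_mem[OF \<gamma>] in \<open>auto intro!: continuous_intros\<close>)
  then show ?thesis by simp
qed

lemma joins_mem: "joins r p q \<Longrightarrow> p \<in> carnot_group \<and> q \<in> carnot_group"
  unfolding joins_def by (auto dest: gauge_lipschitz_mem)

lemma joins_trans:
  assumes "joins r p q" "joins s q z"
  shows "joins (r + s) p z"
proof -
  obtain \<gamma> \<eta> where \<gamma>: "gauge_lipschitz 1 {0..r} \<gamma>" "\<gamma> 0 = p" "\<gamma> r = q"
    and \<eta>: "gauge_lipschitz 1 {0..s} \<eta>" "\<eta> 0 = q" "\<eta> s = z" and pos: "0 \<le> r" "0 \<le> s"
    using assms unfolding joins_def by blast
  define \<zeta> where "\<zeta> t = (if t \<le> r then \<gamma> t else \<eta> (t - r))" for t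
  have "gauge_lipschitz 1 {0..r} \<zeta>"
    using \<gamma>(1) by (subst gauge_lipschitz_cong[of _ _ \<gamma>]) (auto simp: \<zeta>_def)
  moreover have "gauge_lipschitz 1 {r..r + s} (\<lambda>t. \<eta> (t - r))"
    using gauge_lipschitz_affine[of 1 1 r "-r" "r + s" \<eta>] \<eta>(1) by simp
  then have "gauge_lipschitz 1 {r..r + s} \<zeta>"
    by (subst gauge_lipschitz_cong[of _ _ "\<lambda>t. \<eta> (t - r)"]) (auto simp: \<zeta>_def \<gamma>(3) \<eta>(2))
  ultimately have "gauge_lipschitz 1 {0..r + s} \<zeta>" by (rule gauge_lipschitz_join)
  moreover have "\<zeta> 0 = p" "\<zeta> (r + s) = z" using pos \<gamma> \<eta> by (auto simp: \<zeta>_def)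
  ultimately show ?thesis unfolding joins_def using pos by auto
qed

lemma joins_refl: "p \<in> carnot_group \<Longrightarrow> 0 \<le> r \<Longrightarrow> joins r p p"
  unfolding joins_def
  by (intro conjI exI[of _ "\<lambda>_. p"]) (auto simp: gauge_lipschitz_def intro: gauge_le_refl)

lemma joins_mono: "joins r p q \<Longrightarrow> r \<le> s \<Longrightarrow> joins s p q"
  using joins_trans[of r p q "s - r" q] joins_refl[of q "s - r"] joins_mem[of r p q] by simp

section \<open>Translations, commutators and connectivity\<close>

lemma joins_point_mult:
  assumes "joins r p q" "a \<in> carnot_group"
  shows "joins r (point_mult a p) (point_mult a q)"
proof -
  obtain \<gamma> where \<gamma>: "gauge_lipschitz 1 {0..r} \<gamma>" "\<gamma> 0 = p" "\<gamma> r = q" "0 \<le> r"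
    using assms(1) unfolding joins_def by blast
  have "gauge_lipschitz 1 {0..r} (\<lambda>t. point_mult a (\<gamma> t))"
    using \<gamma>(1) assms(2) unfolding gauge_lipschitz_def
    by (auto simp: gauge_le_point_mult intro!: point_mult_carnot_group)
  then show ?thesis unfolding joins_def using \<gamma> by blast
qed

lemma joins_line: "joins (norm v) 0 (v, 0)"
proof -
  have "gauge_lipschitz (norm v) {0..1} (\<lambda>t. (t *\<^sub>R v, 0))"
  proof (rule gauge_lipschitzI)
    fix s t :: real assume "s \<le> t"
    then show "gauge_le (norm v * (t - s)) (s *\<^sub>R v, 0) (t *\<^sub>R v, 0)"
      by (simp add: gauge_le_def wedge.scaleR_left wedge.scaleR_right scaleR_diff_left[symmetric] mult.commute)
  qed (simp add: carnot_group_def transpose_linear)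
  from gauge_lipschitz_joins[OF this, of 0 1] show ?thesis by (simp add: zero_prod_def)
qed

lemma joins_mult:
  assumes "joins r 0 p" "joins s 0 q"
  shows "joins (r + s) 0 (point_mult p q)"
proof -
  have "joins s (point_mult p 0) (point_mult p q)"
    by (rule joins_point_mult[OF assms(2)]) (use joins_mem[OF assms(1)] in simp)
  moreover have "point_mult p 0 = p" by (simp add: point_mult_def wedge.zero_right)
  ultimately show ?thesis using joins_trans[OF assms(1)] by metis
qed

text \<open>The path along \<open>v\<close>, \<open>w\<close>, \<open>-v\<close>, \<open>-w\<close>
  closes up horizontally and leaves the area \<open>wedge v w\<close>.\<close>

lemma joins_commutator: "joins (2 * norm v + 2 * norm w) 0 (0, wedge v w)"
proof -
  have "joins (norm v + norm w + (norm (- v) + norm (- w))) 0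
      (point_mult (point_mult (v, 0) (w, 0)) (point_mult (- v, 0) (- w, 0)))"
    by (intro joins_mult joins_line)
  moreover have "point_mult (point_mult (v, 0) (w, 0)) (point_mult (- v, 0) (- w, 0)) = (0, wedge v w)"
    by (simp add: point_mult_def vec_eq_iff) (simp add: algebra_simps)
  ultimately show ?thesis by (simp add: algebra_simps)
qed

text \<open>A vertical displacement costs only the square root of its size: each elementary
  coefficient \<open>e\<close> is realized by a commutator of two vectors of length
  \<open>sqrt |e|\<close>. The factor \<open>CARD('k) * CARD('k)\<close> counts ordered pairs of
  indices.\<close>

lemma joins_vertical:
  fixes E :: "real ^ 'k::finite ^ 'k"
  assumes E: "transpose E = - E"
  shows "joins (real (CARD('k) * CARD('k)) * (4 * sqrt (norm E))) 0 (0, E)"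
proof -
  define R where "R = 4 * sqrt (norm E)"
  \<comment> \<open>Ordered pairs meet every entry twice by skew-symmetry; hence the half.\<close>
  define W where "W = (\<lambda>(i, j). (E $ i $ j / 2) *\<^sub>R wedge (axis i 1 :: real ^ 'k) (axis j 1))"
  have W: "joins R 0 (0, W ij)" for ij
  proof -
    obtain i j where ij: "ij = (i, j)" by (cases ij)
    define e where "e = E $ i $ j / 2"
    have "\<bar>E $ i $ j\<bar> \<le> norm E"
      using component_le_norm_cart[of "E $ i" j] Finite_Cartesian_Product.norm_nth_le[of E i] by linarith
    then have e: "sqrt \<bar>e\<bar> \<le> sqrt (norm E)"
      by (intro real_sqrt_le_mono) (auto simp: e_def)
    have "W ij = wedge (sqrt \<bar>e\<bar> *\<^sub>R axis i 1) ((sgn e * sqrt \<bar>e\<bar>) *\<^sub>R axis j 1)"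
    proof -
      have "sqrt \<bar>e\<bar> * (sgn e * sqrt \<bar>e\<bar>) = e"
        by (simp add: mult.left_commute[of _ "sgn e"] sgn_mult_abs)
      then have "wedge (sqrt \<bar>e\<bar> *\<^sub>R axis i 1) ((sgn e * sqrt \<bar>e\<bar>) *\<^sub>R axis j 1) = e *\<^sub>R wedge (axis i 1 :: real ^ 'k) (axis j 1)"
        unfolding wedge.scaleR_left wedge.scaleR_right scaleR_scaleR by (simp only: mult.commute)
      then show ?thesis by (simp add: W_def ij e_def)
    qed
    moreover have "2 * norm (sqrt \<bar>e\<bar> *\<^sub>R (axis i 1 :: real ^ 'k)) + 2 * norm ((sgn e * sqrt \<bar>e\<bar>) *\<^sub>R (axis j 1 :: real ^ 'k)) \<le> R"
      using e by (cases "e = 0") (auto simp: R_def abs_mult abs_sgn_eq)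
    ultimately show ?thesis using joins_mono[OF joins_commutator] by metis
  qed
  have "joins (real (card I) * R) 0 (0, \<Sum>ij\<in>I. W ij)" if "finite I" for I
    using that
  proof induction
    case empty
    then show ?case using joins_refl[OF zero_mem_carnot_group, of 0] by (simp add: zero_prod_def)
  next
    case (insert ij I)
    have "joins (R + real (card I) * R) 0 (point_mult (0, W ij) (0, \<Sum>ij\<in>I. W ij))"
      by (intro joins_mult W insert.IH)
    then show ?case using insert.hyps by (simp add: point_mult_def algebra_simps wedge.zero_left)
  qed
  from this[of UNIV] have "joins (real (card (UNIV :: ('k \<times> 'k) set)) * R) 0 (0, \<Sum>ij\<in>UNIV. W ij)" by simp
  moreover have "(\<Sum>ij\<in>UNIV. W ij) = E"
  proof -
    have sk: "E $ m $ l = - E $ l $ m" for l m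
      using arg_cong[OF E, of "\<lambda>X. X $ l $ m"] by (simp add: transpose_def)
    have "(\<Sum>ij\<in>UNIV. W ij) $ l $ m = E $ l $ m" for l m
    proof -
      have "(\<Sum>ij\<in>UNIV. W ij) $ l $ m = (\<Sum>i\<in>UNIV. \<Sum>j\<in>UNIV. W (i, j) $ l $ m)"
        by (simp add: UNIV_Times_UNIV[symmetric] sum.cartesian_product del: UNIV_Times_UNIV)
      also have "\<dots> = (\<Sum>i\<in>UNIV. \<Sum>j\<in>UNIV. (if j = m then if i = l then E $ i $ j / 2 else 0 else 0)
          - (if j = l then if i = m then E $ i $ j / 2 else 0 else 0))"
        by (intro sum.cong refl) (auto simp: W_def axis_def)
      also have "\<dots> = E $ l $ m / 2 - E $ m $ l / 2"
        by (simp add: sum_subtractf)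
      finally show ?thesis using sk[of m l] by simp
    qed
    then show ?thesis by (simp add: vec_eq_iff)
  qed
  ultimately show ?thesis by (simp add: R_def)
qed

text \<open>A horizontal segment reaches the first component and commutators the second: Chow's
  theorem in this group.\<close>

lemma joins_exists:
  assumes "q \<in> carnot_group"
  shows "\<exists>r. joins r 0 q"
proof -
  have "transpose (snd q) = - snd q" using assms by (auto simp: carnot_group_def)
  note joins_mult[OF joins_line joins_vertical[OF this]]
  moreover have "point_mult (fst q, 0) (0, snd q) = q" by (simp add: point_mult_def wedge.zero_right)
  ultimately show ?thesis by metis
qed

lemma joins_imp_horizontal:
  assumes "joins r p q"
  shows "\<exists>T \<gamma>. 0 < T \<and> horizontal 0 T \<gamma> \<and> \<gamma> 0 = p \<and> \<gamma> T = q \<and> curve_length 0 T \<gamma> \<le> r"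
proof -
  have *: "horizontal 0 T \<gamma> \<and> curve_length 0 T \<gamma> \<le> c * T"
    if \<gamma>: "gauge_lipschitz c {0..T} \<gamma>" and T: "0 < T" for T c and \<gamma> :: "real \<Rightarrow> 'a point"
  proof -
    obtain u where u: "is_control 0 T \<gamma> u" "\<And>t. norm (u t) \<le> c"
      using gauge_lipschitz_imp_control[OF \<gamma> T] by metis
    have "integral {0..T} (\<lambda>t. norm (u t)) \<le> integral {0..T} (\<lambda>t. c)"
      by (intro integral_le control_norm_integral(1)[OF u(1)] u(2)) auto
    then show ?thesis using u(1) T control_norm_integral(2)[OF u(1)]
      by (auto simp: horizontal_def mult.commute)
  qed
  obtain \<gamma> where \<gamma>: "gauge_lipschitz 1 {0..r} \<gamma>" "\<gamma> 0 = p" "\<gamma> r = q" "0 \<le> r"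
    using assms unfolding joins_def by blast
  show ?thesis
  \<comment> \<open>\<open>cc_dist\<close> admits only curves on intervals of positive length, so
    for \<open>r = 0\<close> the constant curve on \<open>{0..1}\<close> stands in.\<close>
  proof (cases "r = 0")
    case True
    have "gauge_lipschitz 0 {0..1} (\<lambda>_. p)"
      using joins_mem[OF assms] by (auto simp: gauge_lipschitz_def)
    from *[OF this] show ?thesis using \<gamma> True by (intro exI[of _ 1] exI[of _ "\<lambda>_. p"]) auto
  next
    case False
    then show ?thesis using *[OF \<gamma>(1)] \<gamma> by (intro exI[of _ r] exI[of _ \<gamma>]) auto
  qed
qed

text \<open>Every horizontal curve reparametrizes to an instance of \<open>joins\<close> with its
  own length, and \<open>joins_imp_horizontal\<close> goes back without lengthening. The hypothesis
  makes both sets non-empty, as \<open>Inf\<close> on the reals requires.\<close>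

lemma cc_dist_eq_Inf_joins:
  assumes "joins r p q"
  shows "cc_dist p q = Inf {r. joins r p q}"
proof -
  let ?S = "{curve_length 0 T \<gamma> | T \<gamma>. 0 < T \<and> horizontal 0 T \<gamma> \<and> \<gamma> 0 = p \<and> \<gamma> T = q}"
  have sub: "?S \<subseteq> {r. joins r p q}"
    using control_joins by (fastforce simp: horizontal_def)
  have bdd: "bdd_below {r. joins r p q}"
    by (rule bdd_belowI[of _ 0]) (simp add: joins_def)
  have ne: "?S \<noteq> {}" using joins_imp_horizontal[OF assms] by blast
  show ?thesis
    unfolding cc_dist_def
  proof (rule antisym)
    show "Inf ?S \<le> Inf {r. joins r p q}"
    proof (rule cInf_greatest)
      fix s assume "s \<in> {r. joins r p q}"
      then obtain T \<gamma> where "0 < T \<and> horizontal 0 T \<gamma> \<and> \<gamma> 0 = p \<and> \<gamma> T = q" "curve_length 0 T \<gamma> \<le> s"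
        using joins_imp_horizontal by blast
      then show "Inf ?S \<le> s"
        by (intro cInf_lower2[OF _ _ bdd_below_mono[OF bdd sub]]) auto
    qed (use assms in auto)
    show "Inf {r. joins r p q} \<le> Inf ?S"
      by (rule cInf_superset_mono[OF ne bdd sub])
  qed
qed

lemma cc_dist_le: "joins r p q \<Longrightarrow> cc_dist p q \<le> r"
  by (subst cc_dist_eq_Inf_joins, assumption)
     (auto intro!: cInf_lower bdd_belowI[of _ 0] simp: joins_def)

text \<open>Existence of minimizers: the gauge-Lipschitz condition is closed under pointwise limits.\<close>

lemma joins_cc_dist:
  fixes p q :: "('k::finite) point"
  assumes "joins r p q"
  shows "joins (cc_dist p q) p q"
proof -
  define d where "d = cc_dist p q"
  have d_eq: "d = Inf {r. joins r p q}" unfolding d_def by (rule cc_dist_eq_Inf_joins[OF assms])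
  have "\<exists>s. joins s p q \<and> s < d + 1 / real (Suc n)" for n
    using cInf_lessD[of "{r. joins r p q}" "d + 1 / real (Suc n)"] assms d_eq by auto
  then have "\<forall>n. \<exists>s. joins s p q \<and> s < d + 1 / real (Suc n)" by blast
  from choice[OF this] obtain s where "\<forall>n. joins (s n) p q \<and> s n < d + 1 / real (Suc n)" ..
  then have s: "\<And>n. joins (s n) p q" "\<And>n. s n < d + 1 / real (Suc n)" by blast+
  have sd: "d \<le> s n" for n unfolding d_def by (rule cc_dist_le[OF s(1)])
  have s0: "0 \<le> s n" for n using s(1) by (simp add: joins_def)
  have s1: "s n \<le> d + 1" for n
  proof -
    have "1 / real (Suc n) \<le> 1" by simp
    then show ?thesis using s(2)[of n] by linarith
  qed
  have d0: "0 \<le> d + 1" using s0[of 0] s1[of 0] by linarith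
  have "(\<lambda>n. d + 1 / real (Suc n)) \<longlonglongrightarrow> d + 0"
    by (intro tendsto_add tendsto_const LIMSEQ_Suc[OF lim_1_over_n])
  then have slim: "s \<longlonglongrightarrow> d"
    by (intro tendsto_sandwich[OF _ _ tendsto_const[of d], of s])
       (use sd less_imp_le[OF s(2)] in auto)
  \<comment> \<open>Rescaling to \<open>{0..1}\<close> gives all curves one domain, as Arzela-Ascoli
    demands; the lengths turn into speeds \<open>s n\<close>, which converge to
    \<open>d\<close>.\<close>
  have "\<exists>\<gamma>. gauge_lipschitz (s n) {0..1} \<gamma> \<and> \<gamma> 0 = p \<and> \<gamma> 1 = q" for n
  proof -
    obtain \<gamma> where "gauge_lipschitz 1 {0..s n} \<gamma>" "\<gamma> 0 = p" "\<gamma> (s n) = q"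
      using s(1) unfolding joins_def by blast
    then show ?thesis
      using gauge_lipschitz_affine[of 1 "s n" 0 0 1 \<gamma>] s0[of n]
      by (intro exI[of _ "\<lambda>t. \<gamma> (s n * t)"]) simp
  qed
  then have "\<forall>n. \<exists>\<gamma>. gauge_lipschitz (s n) {0..1} \<gamma> \<and> \<gamma> 0 = p \<and> \<gamma> 1 = q" by blast
  from choice[OF this] obtain \<gamma>
    where "\<forall>n. gauge_lipschitz (s n) {0..1} (\<gamma> n) \<and> \<gamma> n 0 = p \<and> \<gamma> n 1 = q" ..
  then have \<gamma>: "\<And>n. gauge_lipschitz (s n) {0..1} (\<gamma> n)" "\<And>n. \<gamma> n 0 = p" "\<And>n. \<gamma> n 1 = q"
    by blast+
  define B where "B = norm (fst p) + (d + 1)"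
  define K where "K = (1 + (d + 1) + B) * (d + 1)"
  have K: "0 \<le> K" 
  proof -
    have "0 \<le> 1 + (d + 1) + B" unfolding B_def using d0 norm_ge_zero[of "fst p"] by linarith
    then show ?thesis unfolding K_def using d0 by (rule mult_nonneg_nonneg)
  qed
  have lip: "norm (\<gamma> n t - \<gamma> n t') \<le> K * \<bar>t - t'\<bar>" if t: "t \<in> {0..1}" "t' \<in> {0..1}" for n t t'
  proof -
    have "norm (fst (\<gamma> n t')) \<le> B"
      using gauge_lipschitz_norm_bounds(1)[OF \<gamma>(1) s0 t(2), of n] s1[of n] by (simp add: \<gamma>(2) B_def)
    moreover have "gauge_le ((d + 1) * \<bar>t - t'\<bar>) (\<gamma> n t') (\<gamma> n t)"
    proof (rule gauge_le_mono)
      show "gauge_le (s n * \<bar>t - t'\<bar>) (\<gamma> n t') (\<gamma> n t)" using \<gamma>(1)[of n] t by (auto simp: gauge_lipschitz_def)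
    qed (intro mult_right_mono s1, simp)
    moreover have "(d + 1) * \<bar>t - t'\<bar> \<le> d + 1" using t d0 by (intro mult_left_le) auto
    ultimately have "norm (\<gamma> n t - \<gamma> n t') \<le> (1 + (d + 1) + B) * ((d + 1) * \<bar>t - t'\<bar>)"
      by (intro gauge_le_imp_norm_le)
    then show ?thesis by (simp only: K_def mult.assoc)
  qed
  obtain g k where g: "continuous_on {0..1} g" "strict_mono (k :: nat \<Rightarrow> nat)"
    "\<And>e. 0 < e \<Longrightarrow> \<exists>N. \<forall>n x. N \<le> n \<and> x \<in> {0..1} \<longrightarrow> norm (\<gamma> (k n) x - g x) < e"
  proof (rule Arzela_Ascoli[of "{0..1::real}" \<gamma> "norm p + K"])
    show "norm (\<gamma> n x) \<le> norm p + K" if "x \<in> {0..1}" for n x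
    proof -
      have "norm (\<gamma> n x - \<gamma> n 0) \<le> K * \<bar>x - 0\<bar>" by (rule lip) (use that in auto)
      also have "\<dots> \<le> K" using that K by (auto intro: mult_left_le)
      finally show ?thesis using norm_triangle_sub[of "\<gamma> n x" p] by (simp add: \<gamma>(2))
    qed
    show "\<exists>\<delta>>0. \<forall>n y. y \<in> {0..1} \<and> norm (x - y) < \<delta> \<longrightarrow> norm (\<gamma> n x - \<gamma> n y) < e"
      if "x \<in> {0..1}" "0 < e" for x e
    proof (intro exI[of _ "e / (K + 1)"] conjI allI impI)
      show "0 < e / (K + 1)" using that(2) K by simp
      fix n y assume y: "y \<in> {0..1} \<and> norm (x - y) < e / (K + 1)"
      have "norm (\<gamma> n x - \<gamma> n y) \<le> K * \<bar>x - y\<bar>" using y by (intro lip that(1)) simp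
      also have "\<dots> \<le> (K + 1) * \<bar>x - y\<bar>" by (intro mult_right_mono) auto
      also have "\<dots> < e" using y K by (simp add: field_simps)
      finally show "norm (\<gamma> n x - \<gamma> n y) < e" .
    qed
    show "compact {0..1::real}" by simp
    fix g k assume A: "continuous_on {0..1} g" "strict_mono (k :: nat \<Rightarrow> nat)"
      "\<And>e. 0 < e \<Longrightarrow> \<exists>N. \<forall>n x. n \<ge> N \<and> x \<in> {0..1} \<longrightarrow> norm (\<gamma> (k n) x - g x) < e"
    show thesis by (rule that[OF A(1,2)]) (rule A(3), assumption)
  qed
  have lim: "(\<lambda>n. \<gamma> (k n) x) \<longlonglongrightarrow> g x" if "x \<in> {0..1}" for x
  proof (rule LIMSEQ_I)
    fix e :: real assume "0 < e"
    from g(3)[OF this] obtain N where "\<forall>n x. N \<le> n \<and> x \<in> {0..1} \<longrightarrow> norm (\<gamma> (k n) x - g x) < e" ..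
    then show "\<exists>N. \<forall>n\<ge>N. norm (\<gamma> (k n) x - g x) < e" using that by (intro exI[of _ N]) simp
  qed
  have "gauge_lipschitz d {0..1} g"
    unfolding gauge_lipschitz_def
  proof (intro conjI ballI image_subsetI)
    fix x :: real assume x: "x \<in> {0..1}"
    show "g x \<in> carnot_group"
      by (rule closed_sequentially[OF closed_carnot_group _ lim[OF x]])
         (rule gauge_lipschitz_mem[OF \<gamma>(1) x])
    fix y :: real assume y: "y \<in> {0..1}"
    have "(\<lambda>n. s (k n)) \<longlonglongrightarrow> d" using LIMSEQ_subseq_LIMSEQ[OF slim g(2)] by (simp add: o_def)
    then have r: "(\<lambda>n. s (k n) * \<bar>y - x\<bar>) \<longlonglongrightarrow> d * \<bar>y - x\<bar>" by (intro tendsto_intros)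
    have "gauge_le (s (k n) * \<bar>y - x\<bar>) (\<gamma> (k n) x) (\<gamma> (k n) y)" for n
      by (rule \<gamma>(1)[of "k n", unfolded gauge_lipschitz_def, THEN conjunct2, THEN bspec, OF x, THEN bspec, OF y])
    then show "gauge_le (d * \<bar>y - x\<bar>) (g x) (g y)"
      by (rule gauge_le_tendsto[OF _ r lim[OF x] lim[OF y]])
  qed
  moreover have "g 0 = p" "g 1 = q"
    using LIMSEQ_unique[OF lim[of 0], of p] LIMSEQ_unique[OF lim[of 1], of q] by (simp_all add: \<gamma>)
  ultimately show ?thesis using gauge_lipschitz_joins[of d 0 1 g 0 1] by (simp add: d_def)
qed

text \<open>If the middle piece could be shortened, so could the whole curve.\<close>

lemma minimal_subcurve:
  assumes \<gamma>: "gauge_lipschitz c {a..b} \<gamma>" and min: "cc_dist (\<gamma> a) (\<gamma> b) = c * (b - a)"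
    and st: "a \<le> s" "s \<le> t" "t \<le> b"
  shows "cc_dist (\<gamma> s) (\<gamma> t) = c * (t - s)"
proof (rule antisym)
  note j = gauge_lipschitz_joins[OF \<gamma>]
  show "cc_dist (\<gamma> s) (\<gamma> t) \<le> c * (t - s)" by (intro cc_dist_le j st)
  have "cc_dist (\<gamma> a) (\<gamma> b) \<le> c * (s - a) + cc_dist (\<gamma> s) (\<gamma> t) + c * (b - t)"
    using st by (intro cc_dist_le joins_trans[of _ _ "\<gamma> t"] joins_trans[of _ _ "\<gamma> s"] joins_cc_dist[OF j] j) auto
  then show "c * (t - s) \<le> cc_dist (\<gamma> s) (\<gamma> t)" using min by (simp add: algebra_simps)
qed

text \<open>The nonnegative function \<open>c - norm (u t)\<close> integrates to 0, because the
  length cannot drop below the distance \<open>c * (b - a)\<close>; hence the speed is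
  \<open>c\<close> almost everywhere.\<close>

lemma minimal_control:
  assumes \<gamma>: "gauge_lipschitz c {a..b} \<gamma>" and min: "cc_dist (\<gamma> a) (\<gamma> b) = c * (b - a)" and ab: "a < b"
  obtains u where "is_control a b \<gamma> u" "u \<in> borel_measurable borel" "\<And>t. norm (u t) \<le> c"
    "AE t in lebesgue_on {a..b}. norm (u t) = c" "minimizing a b \<gamma>"
proof -
  obtain u where u: "is_control a b \<gamma> u" "u \<in> borel_measurable borel" "\<And>t. norm (u t) \<le> c"
    using gauge_lipschitz_imp_control[OF \<gamma> ab] by metis
  note I = control_norm_integral[OF u(1)]
  have le: "cc_dist (\<gamma> a) (\<gamma> b) \<le> curve_length a b \<gamma>"
    using ab by (intro cc_dist_le control_joins[OF u(1)]) simp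
  have "((\<lambda>t. c - norm (u t)) has_integral (c * (b - a) - curve_length a b \<gamma>)) {a..b}"
    using ab I has_integral_const_real[of c a b]
    by (intro has_integral_diff) (auto simp: mult.commute has_integral_integral)
  then have D: "(\<lambda>t. c - norm (u t)) integrable_on {a..b}"
    "integral {a..b} (\<lambda>t. c - norm (u t)) = c * (b - a) - curve_length a b \<gamma>"
    by (auto simp: integrable_on_def integral_unique)
  have "0 \<le> integral {a..b} (\<lambda>t. c - norm (u t))"
    by (rule integral_nonneg[OF D(1)]) (use u(3) in auto)
  then have eq: "curve_length a b \<gamma> = c * (b - a)" using le min D(2) by simp
  then have "((\<lambda>t. c - norm (u t)) has_integral 0) {a..b}"
    using D by (metis diff_self integrable_integral)
  then have "AE t in lebesgue_on {a..b}. c - norm (u t) = 0"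
    by (rule has_integral_0_nonneg_AE) (use u(3) in auto)
  then have "AE t in lebesgue_on {a..b}. norm (u t) = c" by eventually_elim simp
  moreover have "minimizing a b \<gamma>"
    unfolding minimizing_def horizontal_def using u(1) eq min by auto
  ultimately show thesis using that u by blast
qed

text \<open>The way back from \<open>geodesic\<close>, which speaks of controls of constant speed,
  to the gauge.\<close>

lemma unit_speed_control_gauge_lipschitz:
  assumes u: "is_control a b \<gamma> u" "AE t in lebesgue_on {a..b}. norm (u t) = c"
  shows "gauge_lipschitz c {a..b} \<gamma>"
    and "a \<le> b \<Longrightarrow> curve_length a b \<gamma> = c * (b - a)"
proof -
  obtain N where N: "negligible N" "\<forall>t\<in>{a..b} - N. norm (u t) = c"
    using u(2) by (auto simp: lebesgue_on_AE_iff_negligible)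
  have I: "integral {s..t} (\<lambda>t. norm (u t)) = c * (t - s)" if "a \<le> s" "s \<le> t" "t \<le> b" for s t
  proof -
    have "integral {s..t} (\<lambda>t. norm (u t)) = integral {s..t} (\<lambda>_. c)"
      by (rule integral_spike[OF N(1)]) (use N(2) that in auto)
    then show ?thesis using that by (simp add: mult.commute)
  qed
  show "gauge_lipschitz c {a..b} \<gamma>"
  proof (rule gauge_lipschitzI)
    show "\<gamma> t \<in> carnot_group" if "t \<in> {a..b}" for t using u(1) that by (auto simp: is_control_def)
    show "gauge_le (c * (t - s)) (\<gamma> s) (\<gamma> t)" if "s \<in> {a..b}" "t \<in> {a..b}" "s \<le> t" for s t
      using control_gauge_le[OF u(1), of s t] I[of s t] that by simp
  qed
  show "a \<le> b \<Longrightarrow> curve_length a b \<gamma> = c * (b - a)"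
    using control_norm_integral(2)[OF u(1)] I[of a b] by simp
qed

section \<open>The first-order condition\<close>

lemma orthogonal_projection_exists:
  fixes V :: "'a::euclidean_space set"
  assumes "subspace V"
  obtains P where "linear P" "\<And>z. P z \<in> V" "\<And>z. z \<in> V \<Longrightarrow> P z = z" "\<And>a b. P a \<bullet> b = a \<bullet> P b"
proof -
  obtain B where B: "pairwise orthogonal B" "\<forall>b\<in>B. norm b = 1" "independent B" "span B = V"
    by (rule orthonormal_basis_subspace[OF assms], rule that) simp_all
  define P where "P z = (\<Sum>b\<in>B. (z \<bullet> b) *\<^sub>R b)" for z
  have fin: "finite B" using B(3) by (rule independent_imp_finite)
  have "bounded_linear P"
    unfolding P_def[abs_def] by (rule bounded_linear_sum) (rule bounded_linear_scaleR_const[OF bounded_linear_inner_left])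
  then have lin: "linear P" by (rule bounded_linear.linear)
  have "P b = id b" if "b \<in> B" for b
  proof -
    have "P b = (\<Sum>c\<in>B. if c = b then b else 0)"
      unfolding P_def
    proof (intro sum.cong refl)
      fix c assume c: "c \<in> B"
      have "b \<bullet> b = 1" unfolding norm_eq_1[symmetric] using B(2) that by simp
      moreover have "b \<bullet> c = 0" if "c \<noteq> b"
        using pairwiseD[OF B(1) \<open>b \<in> B\<close> c] that by (simp add: orthogonal_def)
      ultimately show "(b \<bullet> c) *\<^sub>R c = (if c = b then b else 0)" by (cases "c = b") simp_all
    qed
    then show ?thesis using fin that by simp
  qed
  then have eq: "\<And>b. b \<in> B \<Longrightarrow> P b = id b" by blast
  have id: "P z = z" if "z \<in> V" for z
  proof -
    have "z \<in> span B" using \<open>z \<in> V\<close> unfolding B(4) .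
    then have "P z = id z" by (intro linear_eq_on_span[OF lin linear_id eq])
    then show ?thesis by simp
  qed
  show thesis
  proof (rule that[OF lin _ id])
    show "P z \<in> V" for z
      unfolding P_def B(4)[symmetric] by (intro span_sum span_scale span_base)
    show "P a \<bullet> b = a \<bullet> P b" for a b
    proof -
      have "P a \<bullet> b = (\<Sum>c\<in>B. (a \<bullet> c) * (c \<bullet> b))" by (simp add: P_def inner_sum_left)
      also have "\<dots> = (\<Sum>c\<in>B. (b \<bullet> c) * (a \<bullet> c))"
        by (rule sum.cong[OF refl]) (simp only: inner_commute[of b] mult.commute)
      also have "\<dots> = a \<bullet> P b" by (simp add: P_def inner_sum_right)
      finally show ?thesis .
    qed
  qed
qed

section \<open>Bounded controls, their primitives and enclosed areas\<close>

definition bmeas :: "real \<Rightarrow> (real \<Rightarrow> 'a::euclidean_space) \<Rightarrow> bool" where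
  "bmeas T w \<longleftrightarrow> w \<in> borel_measurable (lebesgue_on {0..T}) \<and> (\<exists>K. \<forall>t\<in>{0..T}. norm (w t) \<le> K)"

definition prim :: "(real \<Rightarrow> 'a::euclidean_space) \<Rightarrow> real \<Rightarrow> 'a" where
  "prim w t = integral {0..t} w"

lemma bmeas_integrable_on:
  assumes "bmeas T w" "0 \<le> s" "t \<le> T"
  shows "w integrable_on {s..t}"
proof -
  obtain K where K: "\<forall>t\<in>{0..T}. norm (w t) \<le> K" using assms(1) by (auto simp: bmeas_def)
  have "finite_measure (lebesgue_on {0..T})"
    by (rule finite_measure_lebesgue_on) simp
  then have "integrable (lebesgue_on {0..T}) w"
    by (rule finite_measure.integrable_const_bound[where B = K])
       (use assms(1) K in \<open>auto simp: bmeas_def intro!: AE_I2\<close>)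
  then have "w integrable_on {0..T}" by (rule integrable_on_lebesgue_on) simp
  then show ?thesis by (rule integrable_on_subinterval) (use assms in auto)
qed

lemma bmeas_bilinear:
  fixes h :: "'a::euclidean_space \<Rightarrow> 'b::euclidean_space \<Rightarrow> 'c::euclidean_space"
  assumes h: "bounded_bilinear h" and "bmeas T v" "bmeas T w"
  shows "bmeas T (\<lambda>t. h (v t) (w t))"
proof -
  interpret bounded_bilinear h by (rule h)
  obtain K L where K: "\<forall>t\<in>{0..T}. norm (v t) \<le> K" "\<forall>t\<in>{0..T}. norm (w t) \<le> L"
    using assms(2,3) by (auto simp: bmeas_def)
  obtain C where C: "0 < C" "\<And>a b. norm (h a b) \<le> norm a * norm b * C"
    using pos_bounded by blast
  have "(\<lambda>t. h (v t) (w t)) \<in> borel_measurable (lebesgue_on {0..T})"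
  proof (rule borel_measurable_continuous_Pair[where H = h and f = v and g = w])
    show "continuous_on UNIV (\<lambda>x. h (fst x) (snd x))"
      by (rule continuous_on[OF continuous_on_fst[OF continuous_on_id] continuous_on_snd[OF continuous_on_id]])
    show "v \<in> borel_measurable (lebesgue_on {0..T})" "w \<in> borel_measurable (lebesgue_on {0..T})"
      using assms(2,3) by (simp_all add: bmeas_def)
  qed
  moreover have "\<forall>t\<in>{0..T}. norm (h (v t) (w t)) \<le> K * L * C"
  proof
    fix t assume t: "t \<in> {0..T}"
    have "norm (h (v t) (w t)) \<le> norm (v t) * norm (w t) * C" by (rule C(2))
    also have "\<dots> \<le> K * L * C"
      using K t C(1) order.trans[OF norm_ge_zero, of "v t" K] by (intro mult_right_mono mult_mono) auto
    finally show "norm (h (v t) (w t)) \<le> K * L * C" .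
  qed
  ultimately show ?thesis unfolding bmeas_def by blast
qed

lemma bmeas_linear:
  fixes h :: "'a::euclidean_space \<Rightarrow> 'b::euclidean_space"
  assumes h: "bounded_linear h" and "bmeas T w"
  shows "bmeas T (\<lambda>t. h (w t))"
proof -
  interpret bounded_linear h by (rule h)
  obtain K where K: "\<forall>t\<in>{0..T}. norm (w t) \<le> K" using assms(2) by (auto simp: bmeas_def)
  obtain C where C: "0 < C" "\<And>a. norm (h a) \<le> norm a * C" using pos_bounded by blast
  have "h \<in> borel_measurable borel"
    by (rule borel_measurable_continuous_onI[OF continuous_on[OF continuous_on_id]])
  then have "(\<lambda>t. h (w t)) \<in> borel_measurable (lebesgue_on {0..T})"
    using assms(2) measurable_compose[of w "lebesgue_on {0..T}" borel h borel] by (simp add: bmeas_def)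
  moreover have "\<forall>t\<in>{0..T}. norm (h (w t)) \<le> K * C"
  proof
    fix t assume "t \<in> {0..T}"
    then have "norm (w t) * C \<le> K * C" using K C(1) by (intro mult_right_mono) auto
    then show "norm (h (w t)) \<le> K * C" using C(2)[of "w t"] by simp
  qed
  ultimately show ?thesis unfolding bmeas_def by blast
qed

lemma bmeas_continuous:
  assumes "continuous_on {0..T} w"
  shows "bmeas T w"
proof -
  have "bounded (w ` {0..T})" using assms by (intro compact_imp_bounded compact_continuous_image) auto
  then have "\<exists>K. \<forall>t\<in>{0..T}. norm (w t) \<le> K" by (auto simp: bounded_iff)
  moreover have "w \<in> borel_measurable (lebesgue_on {0..T})"
    using assms by (rule continuous_imp_measurable_on_sets_lebesgue) simp
  ultimately show ?thesis by (simp add: bmeas_def)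
qed

lemma bmeas_const: "bmeas T (\<lambda>_. c)"
  by (rule bmeas_continuous) simp

lemma bmeas_add:
  assumes "bmeas T v" "bmeas T w"
  shows "bmeas T (\<lambda>t. v t + w t)"
proof -
  obtain K L where K: "\<forall>t\<in>{0..T}. norm (v t) \<le> K" "\<forall>t\<in>{0..T}. norm (w t) \<le> L"
    using assms by (auto simp: bmeas_def)
  have "\<forall>t\<in>{0..T}. norm (v t + w t) \<le> K + L"
    using K by (auto intro: norm_triangle_mono)
  moreover have "(\<lambda>t. v t + w t) \<in> borel_measurable (lebesgue_on {0..T})"
    using assms by (auto simp: bmeas_def)
  ultimately show ?thesis unfolding bmeas_def by blast
qed

lemma bmeas_scaleR: "bmeas T w \<Longrightarrow> bmeas T (\<lambda>t. c *\<^sub>R w t)"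
  by (rule bmeas_linear[OF bounded_linear_scaleR_right])

lemma prim_diff:
  assumes "bmeas T w" "0 \<le> s" "s \<le> t" "t \<le> T"
  shows "(w has_integral (prim w t - prim w s)) {s..t}"
proof -
  have "integral {0..s} w + integral {s..t} w = integral {0..t} w"
    by (rule Henstock_Kurzweil_Integration.integral_combine)
       (use assms bmeas_integrable_on[OF assms(1), of 0 t] in auto)
  moreover have "w integrable_on {s..t}" using assms by (intro bmeas_integrable_on) auto
  ultimately show ?thesis by (simp add: prim_def has_integral_iff algebra_simps)
qed

lemma prim_lipschitz:
  assumes "bmeas T w"
  shows "\<exists>L. L-lipschitz_on {0..T} (prim w)"
proof -
  obtain K where K: "\<forall>t\<in>{0..T}. norm (w t) \<le> K" using assms by (auto simp: bmeas_def)
  have le: "norm (prim w t - prim w s) \<le> \<bar>K\<bar> * (t - s)" if "0 \<le> s" "s \<le> t" "t \<le> T" for s t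
  proof -
    have "norm (prim w t - prim w s) \<le> \<bar>K\<bar> * measure lborel (cbox s t)"
      using prim_diff[OF assms that] K that
      by (intro has_integral_bound[where f = w]) (auto simp: intro: order.trans[OF _ abs_ge_self])
    then show ?thesis using that by simp
  qed
  have "\<bar>K\<bar>-lipschitz_on {0..T} (prim w)"
  proof (rule lipschitz_onI)
    fix s t assume st: "s \<in> {0..T}" "t \<in> {0..T}"
    show "dist (prim w s) (prim w t) \<le> \<bar>K\<bar> * dist s t"
    proof (cases "s \<le> t")
      case True
      then show ?thesis using le[of s t] st by (simp add: dist_norm norm_minus_commute dist_real_def)
    next
      case False
      then show ?thesis using le[of t s] st by (simp add: dist_norm dist_real_def)
    qed
  qed simp
  then show ?thesis ..
qed

lemma prim_continuous:
  assumes "bmeas T w"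
  shows "continuous_on {0..T} (prim w)"
  using prim_lipschitz[OF assms] lipschitz_on_continuous_on by blast

lemma bmeas_prim: "bmeas T w \<Longrightarrow> bmeas T (prim w)"
  by (rule bmeas_continuous[OF prim_continuous])

lemma prim_derivative_AE:
  assumes w: "bmeas T w"
  shows "AE t in lebesgue_on {0..T}. (prim w has_vector_derivative w t) (at t within {0..T})"
proof -
  define g where "g t = (if t \<in> {0..T} then w t else 0)" for t
  have "g integrable_on {s..t}" for s t
  proof -
    have "g integrable_on UNIV"
      unfolding g_def using bmeas_integrable_on[OF w, of 0 T] by (simp only: integrable_restrict_UNIV)
    then show ?thesis using integrable_on_subinterval by blast
  qed
  then have "\<exists>N. negligible N \<and> (\<forall>a b. \<forall>t\<in>{a..b} - N.
       ((\<lambda>s. integral {a..s} g) has_vector_derivative g t) (at t within {a..b}))"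
    by (rule vector_derivative_indefinite_integral_AE)
  then obtain N where N: "negligible N \<and> (\<forall>a b. \<forall>t\<in>{a..b} - N.
       ((\<lambda>s. integral {a..s} g) has_vector_derivative g t) (at t within {a..b}))" ..
  have eq: "prim w s = integral {0..s} g" if "s \<in> {0..T}" for s
    unfolding prim_def by (rule integral_cong) (use that in \<open>auto simp: g_def\<close>)
  have "(prim w has_vector_derivative w t) (at t within {0..T})" if t: "t \<in> {0..T} - N" for t
  proof (rule has_vector_derivative_transform)
    show "t \<in> {0..T}" using t by simp
    show "prim w s = integral {0..s} g" if "s \<in> {0..T}" for s by (rule eq[OF that])
    have "((\<lambda>s. integral {0..s} g) has_vector_derivative g t) (at t within {0..T})" using N t by blast
    then show "((\<lambda>s. integral {0..s} g) has_vector_derivative w t) (at t within {0..T})"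
      using t by (simp add: g_def)
  qed
  then show ?thesis
    by (subst lebesgue_on_AE_iff_negligible) (use N in \<open>auto intro!: exI[of _ N]\<close>)
qed

lemma integral_by_parts_prim:
  fixes h :: "'a::euclidean_space \<Rightarrow> 'b::euclidean_space \<Rightarrow> 'c::euclidean_space"
  assumes h: "bounded_bilinear h" and v: "bmeas T v" and w: "bmeas T w" and T: "0 \<le> T"
  shows "integral {0..T} (\<lambda>t. h (prim v t) (w t)) + integral {0..T} (\<lambda>t. h (v t) (prim w t))
      = h (prim v T) (prim w T)"
proof -
  interpret bounded_bilinear h by (rule h)
  obtain L M where LM: "L-lipschitz_on {0..T} (prim v)" "M-lipschitz_on {0..T} (prim w)"
    using prim_lipschitz[OF v] prim_lipschitz[OF w] by blast
  obtain K where K: "\<forall>t\<in>{0..T}. norm (prim v t) \<le> K" using bmeas_prim[OF v] by (auto simp: bmeas_def)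
  obtain K' where K': "\<forall>t\<in>{0..T}. norm (prim w t) \<le> K'" using bmeas_prim[OF w] by (auto simp: bmeas_def)
  obtain C where C: "0 < C" "\<And>a b. norm (h a b) \<le> norm a * norm b * C" using pos_bounded by blast
  have pos: "0 \<le> L" "0 \<le> M" using LM lipschitz_on_nonneg by blast+
  have "norm (prim v 0) \<le> K" "norm (prim w 0) \<le> K'" using K K' T by simp_all
  then have Kp: "0 \<le> K" "0 \<le> K'" using order.trans[OF norm_ge_zero] by blast+
  have lip: "((K * M + L * K') * C)-lipschitz_on {0..T} (\<lambda>t. h (prim v t) (prim w t))"
  proof (rule lipschitz_onI)
    fix s t assume st: "s \<in> {0..T}" "t \<in> {0..T}"
    have d: "norm (prim v s - prim v t) \<le> L * dist s t" "norm (prim w s - prim w t) \<le> M * dist s t"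
      using lipschitz_onD[OF LM(1) st] lipschitz_onD[OF LM(2) st] by (simp_all add: dist_norm)
    have "h (prim v s) (prim w s) - h (prim v t) (prim w t)
        = h (prim v s) (prim w s - prim w t) + h (prim v s - prim v t) (prim w t)"
      by (simp add: diff_left diff_right)
    then have "norm (h (prim v s) (prim w s) - h (prim v t) (prim w t))
        \<le> norm (h (prim v s) (prim w s - prim w t)) + norm (h (prim v s - prim v t) (prim w t))"
      by (simp only: norm_triangle_ineq)
    also have "\<dots> \<le> norm (prim v s) * norm (prim w s - prim w t) * C + norm (prim v s - prim v t) * norm (prim w t) * C"
      by (intro add_mono C(2))
    also have "\<dots> \<le> K * (M * dist s t) * C + (L * dist s t) * K' * C"
      using K K' st d C(1) pos Kp by (intro add_mono mult_right_mono mult_mono) auto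
    finally show "dist (h (prim v s) (prim w s)) (h (prim v t) (prim w t)) \<le> (K * M + L * K') * C * dist s t"
      by (simp add: dist_norm algebra_simps)
  qed (use C pos Kp in simp)
  have der: "AE t in lebesgue_on {0..T}. ((\<lambda>t. h (prim v t) (prim w t)) has_vector_derivative
      (h (prim v t) (w t) + h (v t) (prim w t))) (at t within {0..T})"
    using prim_derivative_AE[OF v] prim_derivative_AE[OF w]
    by eventually_elim (rule has_vector_derivative)
  have "((\<lambda>t. h (prim v t) (w t) + h (v t) (prim w t)) has_integral
      (h (prim v T) (prim w T) - h (prim v 0) (prim w 0))) {0..T}"
    by (rule has_integral_AE_derivative_lipschitz[OF lip der]) (use T in auto)
  then have "integral {0..T} (\<lambda>t. h (prim v t) (w t) + h (v t) (prim w t)) = h (prim v T) (prim w T)"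
    by (simp add: integral_unique prim_def zero_left)
  moreover have "integral {0..T} (\<lambda>t. h (prim v t) (w t) + h (v t) (prim w t))
      = integral {0..T} (\<lambda>t. h (prim v t) (w t)) + integral {0..T} (\<lambda>t. h (v t) (prim w t))"
    by (intro integral_add bmeas_integrable_on[where T = T] bmeas_bilinear[OF h] bmeas_prim v w order.refl)
  ultimately show ?thesis by simp
qed

text \<open>The bilinear form behind the endpoint map: the curve from 0 with control
  \<open>w\<close> ends at height \<open>(1/2) *\<^sub>R area_form T w w\<close>.\<close>

definition area_form :: "real \<Rightarrow> (real \<Rightarrow> real ^ 'k::finite) \<Rightarrow> (real \<Rightarrow> real ^ 'k) \<Rightarrow> real ^ 'k ^ 'k" where
  "area_form T v w = integral {0..T} (\<lambda>t. wedge (prim v t) (w t))"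

lemma prim_add_scaleR:
  assumes "bmeas T v" "bmeas T w" "t \<le> T"
  shows "prim (\<lambda>t. v t + c *\<^sub>R w t) t = prim v t + c *\<^sub>R prim w t"
proof -
  have "integral {0..t} (\<lambda>t. v t + c *\<^sub>R w t) = integral {0..t} v + integral {0..t} (\<lambda>t. c *\<^sub>R w t)"
    using assms by (intro integral_add bmeas_integrable_on bmeas_scaleR) auto
  then show ?thesis by (simp add: prim_def)
qed

lemma integral_bilinear_add_scaleR:
  fixes h :: "'a::euclidean_space \<Rightarrow> 'a \<Rightarrow> 'c::euclidean_space"
  assumes h: "bounded_bilinear h" and v: "bmeas T v" "bmeas T v'" and w: "bmeas T w"
  shows "integral {0..T} (\<lambda>t. h (v t + c *\<^sub>R v' t) (w t))
      = integral {0..T} (\<lambda>t. h (v t) (w t)) + c *\<^sub>R integral {0..T} (\<lambda>t. h (v' t) (w t))"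
    and "integral {0..T} (\<lambda>t. h (w t) (v t + c *\<^sub>R v' t))
      = integral {0..T} (\<lambda>t. h (w t) (v t)) + c *\<^sub>R integral {0..T} (\<lambda>t. h (w t) (v' t))"
proof -
  interpret bounded_bilinear h by (rule h)
  have i: "(\<lambda>t. h (v t) (w t)) integrable_on {0..T}" "(\<lambda>t. h (w t) (v t)) integrable_on {0..T}"
    "(\<lambda>t. c *\<^sub>R h (v' t) (w t)) integrable_on {0..T}" "(\<lambda>t. c *\<^sub>R h (w t) (v' t)) integrable_on {0..T}"
    by (intro bmeas_integrable_on[where T = T] bmeas_scaleR bmeas_bilinear[OF h] v w order.refl)+
  show "integral {0..T} (\<lambda>t. h (v t + c *\<^sub>R v' t) (w t))
      = integral {0..T} (\<lambda>t. h (v t) (w t)) + c *\<^sub>R integral {0..T} (\<lambda>t. h (v' t) (w t))"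
    using integral_add[OF i(1,3)] by (simp add: add_left scaleR_left)
  show "integral {0..T} (\<lambda>t. h (w t) (v t + c *\<^sub>R v' t))
      = integral {0..T} (\<lambda>t. h (w t) (v t)) + c *\<^sub>R integral {0..T} (\<lambda>t. h (w t) (v' t))"
    using integral_add[OF i(2,4)] by (simp add: add_right scaleR_right)
qed

lemma area_form_add_scaleR:
  assumes "bmeas T v" "bmeas T v'" "bmeas T w"
  shows "area_form T (\<lambda>t. v t + c *\<^sub>R v' t) w = area_form T v w + c *\<^sub>R area_form T v' w"
    and "area_form T w (\<lambda>t. v t + c *\<^sub>R v' t) = area_form T w v + c *\<^sub>R area_form T w v'"
proof -
  have "area_form T (\<lambda>t. v t + c *\<^sub>R v' t) w = integral {0..T} (\<lambda>t. wedge (prim v t + c *\<^sub>R prim v' t) (w t))"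
    unfolding area_form_def by (rule integral_cong) (use prim_add_scaleR[OF assms(1,2)] in simp)
  also have "\<dots> = area_form T v w + c *\<^sub>R area_form T v' w"
    unfolding area_form_def
    by (rule integral_bilinear_add_scaleR(1)[OF bounded_bilinear_wedge bmeas_prim[OF assms(1)] bmeas_prim[OF assms(2)] assms(3)])
  finally show "area_form T (\<lambda>t. v t + c *\<^sub>R v' t) w = area_form T v w + c *\<^sub>R area_form T v' w" .
  show "area_form T w (\<lambda>t. v t + c *\<^sub>R v' t) = area_form T w v + c *\<^sub>R area_form T w v'"
    unfolding area_form_def
    by (rule integral_bilinear_add_scaleR(2)[OF bounded_bilinear_wedge assms(1,2) bmeas_prim[OF assms(3)]])
qed

text \<open>Integration by parts exchanges the arguments with a sign, skewness of the wedge cancels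
  the sign, and the boundary term vanishes with \<open>prim w T\<close>. In the expansion of the
  quadratic endpoint map the cross terms thus coincide.\<close>

lemma area_form_commute:
  assumes "bmeas T v" "bmeas T w" "prim w T = 0" "0 \<le> T"
  shows "area_form T w v = area_form T v w"
proof -
  have "integral {0..T} (\<lambda>t. wedge (v t) (prim w t)) = - area_form T w v"
  proof -
    have "(\<lambda>t. wedge (v t) (prim w t)) = (\<lambda>t. - wedge (prim w t) (v t))"
      by (rule ext) (rule wedge_swap)
    then show ?thesis by (simp add: area_form_def)
  qed
  then show ?thesis
    using integral_by_parts_prim[OF bounded_bilinear_wedge assms(1,2,4)] assms(3)
    by (simp add: area_form_def wedge.zero_right)
qed

lemma transpose_integral:
  fixes f :: "real \<Rightarrow> real ^ 'k::finite ^ 'k"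
  assumes "f integrable_on S"
  shows "transpose (integral S f) = integral S (\<lambda>t. transpose (f t))"
proof -
  have "linear (transpose :: real ^ 'k ^ 'k \<Rightarrow> _)" by (rule linearI) (simp_all add: transpose_linear)
  then have "bounded_linear (transpose :: real ^ 'k ^ 'k \<Rightarrow> _)" by (simp add: linear_conv_bounded_linear)
  from integral_linear[OF assms this] show ?thesis by (simp add: o_def)
qed

lemma joins_area_form:
  assumes w: "bmeas T w" and T: "0 \<le> T"
  shows "joins (integral {0..T} (\<lambda>t. norm (w t))) 0 (prim w T, (1/2) *\<^sub>R area_form T w w)"
proof -
  let ?f = "\<lambda>t. wedge (prim w t) (w t)"
  have f: "bmeas T ?f" by (intro bmeas_bilinear[OF bounded_bilinear_wedge] bmeas_prim w)
  have "bmeas T (\<lambda>t. norm (w t))"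
  proof -
    obtain K where "\<forall>t\<in>{0..T}. norm (w t) \<le> K" using w by (auto simp: bmeas_def)
    then show ?thesis using w unfolding bmeas_def by (auto intro!: exI[of _ K])
  qed
  then have n: "(\<lambda>t. norm (w t)) integrable_on {0..T}" by (intro bmeas_integrable_on) auto
  have "joins (integral {0..T} (\<lambda>t. norm (w t))) (prim w 0, (1/2) *\<^sub>R prim ?f 0) (prim w T, (1/2) *\<^sub>R prim ?f T)"
  proof (rule joins_integral[OF prim_diff[OF w] _ n T])
    fix s t assume st: "0 \<le> s" "s \<le> t" "t \<le> T"
    from has_integral_cmul[OF prim_diff[OF f st], of "1/2"]
    show "((\<lambda>r. (1/2) *\<^sub>R wedge (prim w r) (w r)) has_integral ((1/2) *\<^sub>R prim ?f t - (1/2) *\<^sub>R prim ?f s)) {s..t}"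
      by (simp add: scaleR_diff_right)
  next
    fix t assume t: "t \<in> {0..T}"
    have "transpose (prim ?f t) = integral {0..t} (\<lambda>r. transpose (?f r))"
      unfolding prim_def[of ?f] by (rule transpose_integral) (use bmeas_integrable_on[OF f] t in auto)
    also have "\<dots> = - prim ?f t" by (simp add: transpose_wedge prim_def[of ?f])
    finally show "(prim w t, (1/2) *\<^sub>R prim ?f t) \<in> carnot_group"
      by (simp add: carnot_group_def transpose_linear)
  qed
  then show ?thesis by (simp add: prim_def[of _ 0] prim_def[of ?f] area_form_def zero_prod_def)
qed

text \<open>Length is compared through energy: \<open>|w| \<le> (|w|^2 + c^2) / (2 c)\<close>, with
  equality where \<open>|w| = c\<close>, so that a polynomial expansion in the size of the variation
  replaces the non-smooth length.\<close>

lemma no_descent_direction: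
  fixes u v z :: "real \<Rightarrow> real ^ 'k::finite"
  assumes T: "0 < T" and c: "0 < c" and u: "bmeas T u" and v: "bmeas T v" and z: "bmeas T z"
    and ub: "\<And>t. t \<in> {0..T} \<Longrightarrow> norm (u t) \<le> c"
    and v0: "prim v T = 0" and z0: "prim z T = 0"
    and uv: "area_form T u v = 0" and uz: "area_form T u z = - (1/2) *\<^sub>R area_form T v v"
    and min: "cc_dist 0 (prim u T, (1/2) *\<^sub>R area_form T u u) = c * T"
  shows "integral {0..T} (\<lambda>t. u t \<bullet> v t) \<le> 0"
proof (rule ccontr)
  define I where "I f g = integral {0..T} (\<lambda>t. f t \<bullet> g t)" for f g :: "real \<Rightarrow> real ^ 'k"
  define A :: "(real \<Rightarrow> real ^ 'k) \<Rightarrow> (real \<Rightarrow> real ^ 'k) \<Rightarrow> real ^ 'k ^ 'k" where "A = area_form T"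
  assume "\<not> integral {0..T} (\<lambda>t. u t \<bullet> v t) \<le> 0"
  then have pos: "0 < I u v" by (simp add: I_def)
  have T0: "0 \<le> T" using T by simp
  define E1 where "E1 = norm (A v z + A z v) + norm (A z z)"
  define K1 where "K1 = (\<bar>I v v + 2 * I u z\<bar> + 2 * \<bar>I v z\<bar> + \<bar>I z z\<bar>) / (2 * c)"
  define K2 where "K2 = real (CARD('k) * CARD('k)) * (4 * sqrt E1)"
  have K0: "0 \<le> K1" "0 \<le> K2" using c by (auto simp: K1_def K2_def E1_def intro!: mult_nonneg_nonneg)
  \<comment> \<open>\<open>\<eta>\<close> is the square root of the size \<open>\<delta>\<close> of
    the variation; a detour of order \<open>\<delta> powr (3/2)\<close> then reads
    \<open>\<eta> ^ 3\<close>, and no fractional power occurs.\<close>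
  have main: "\<eta>\<^sup>2 * (I u v / c) \<le> (K1 + K2) * \<eta> ^ 3" if \<eta>: "0 < \<eta>" "\<eta> \<le> 1" for \<eta>
  proof -
    define \<delta> where "\<delta> = \<eta>\<^sup>2"
    have \<delta>: "0 < \<delta>" "\<delta> \<le> 1" using \<eta> by (auto simp: \<delta>_def power_le_one)
    \<comment> \<open>The energy grows along \<open>v\<close> at rate \<open>2 * I u v\<close>, so
      the variation goes along \<open>-v\<close>.\<close>
    define a where "a = (\<lambda>t. u t + (- \<delta>) *\<^sub>R v t)"
    define w where "w = (\<lambda>t. a t + (\<delta>\<^sup>2) *\<^sub>R z t)"
    have a: "bmeas T a" unfolding a_def by (intro bmeas_add bmeas_scaleR u v)
    have w: "bmeas T w" unfolding w_def by (intro bmeas_add bmeas_scaleR a z)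
    have pw: "prim w T = prim u T"
      unfolding w_def prim_add_scaleR[OF a z order.refl] unfolding a_def prim_add_scaleR[OF u v order.refl]
      by (simp add: v0 z0)
    note bi = area_form_add_scaleR
    have Aw: "A f w = A f a + (\<delta>\<^sup>2) *\<^sub>R A f z" "A w f = A a f + (\<delta>\<^sup>2) *\<^sub>R A z f" if "bmeas T f" for f
      unfolding A_def w_def by (rule bi(2)[OF a z that], rule bi(1)[OF a z that])
    have Aa: "A f a = A f u + (- \<delta>) *\<^sub>R A f v" "A a f = A u f + (- \<delta>) *\<^sub>R A v f" if "bmeas T f" for f
      unfolding A_def a_def by (rule bi(2)[OF u v that], rule bi(1)[OF u v that])
    have vu: "A v u = 0" "A u v = 0" using area_form_commute[OF u v v0 T0] uv by (simp_all add: A_def)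
    have zu: "A z u = - (1/2) *\<^sub>R A v v" "A u z = - (1/2) *\<^sub>R A v v"
      using area_form_commute[OF u z z0 T0] uz by (simp_all add: A_def)
    \<comment> \<open>The first order vanishes by \<open>uv\<close>. At second order
      \<open>A v v\<close> is cancelled by \<open>A u z + A z u\<close>, which is what
      \<open>uz\<close> is for.\<close>
    have Aww: "A w w = A u u - (\<delta> ^ 3) *\<^sub>R (A v z + A z v) + (\<delta> ^ 4) *\<^sub>R A z z"
      unfolding Aw(1)[OF w] Aw(2)[OF a] Aw(2)[OF z] Aa(1)[OF a] Aa(1)[OF z] Aa(2)[OF z] Aa(2)[OF u] Aa(2)[OF v] vu zu
      by (simp add: vec_eq_iff field_simps eval_nat_numeral)
    have AE: "(1/2) *\<^sub>R A u u - (1/2) *\<^sub>R A w w = (1/2) *\<^sub>R ((\<delta> ^ 3) *\<^sub>R (A v z + A z v) - (\<delta> ^ 4) *\<^sub>R A z z)"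
      (is "_ = ?E") unfolding Aww by (simp add: scaleR_diff_right scaleR_add_right)
    have nE: "norm ?E \<le> E1 * \<delta> ^ 3"
    proof -
      have "norm ((\<delta> ^ 3) *\<^sub>R (A v z + A z v) - (\<delta> ^ 4) *\<^sub>R A z z) \<le> \<delta> ^ 3 * norm (A v z + A z v) + \<delta> ^ 4 * norm (A z z)"
        using norm_triangle_ineq4[of "(\<delta> ^ 3) *\<^sub>R (A v z + A z v)" "(\<delta> ^ 4) *\<^sub>R A z z"] \<delta> by simp
      also have "\<dots> \<le> \<delta> ^ 3 * norm (A v z + A z v) + \<delta> ^ 3 * norm (A z z)"
        using \<delta> by (intro add_left_mono mult_right_mono power_decreasing) auto
      also have "\<dots> = E1 * \<delta> ^ 3" by (simp add: E1_def algebra_simps)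
      finally show ?thesis using norm_ge_zero[of "(\<delta> ^ 3) *\<^sub>R (A v z + A z v) - (\<delta> ^ 4) *\<^sub>R A z z"]
        unfolding norm_scaleR by linarith
    qed
    have ju: "joins (integral {0..T} (\<lambda>t. norm (u t))) 0 (prim u T, (1/2) *\<^sub>R A u u)"
      unfolding A_def by (rule joins_area_form[OF u T0])
    have jw: "joins (integral {0..T} (\<lambda>t. norm (w t))) 0 (prim u T, (1/2) *\<^sub>R A w w)"
      using joins_area_form[OF w T0] by (simp add: A_def pw)
    have "transpose ?E = - ?E"
      using joins_mem[OF ju] joins_mem[OF jw] unfolding AE[symmetric]
      by (simp add: carnot_group_def transpose_linear)
    from joins_vertical[OF this]
    have "joins (real (CARD('k) * CARD('k)) * (4 * sqrt (norm ?E)))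
        (point_mult (prim u T, (1/2) *\<^sub>R A w w) 0) (point_mult (prim u T, (1/2) *\<^sub>R A w w) (0, ?E))"
      by (rule joins_point_mult) (use joins_mem[OF jw] in simp)
    then have jE: "joins (real (CARD('k) * CARD('k)) * (4 * sqrt (norm ?E)))
        (prim u T, (1/2) *\<^sub>R A w w) (prim u T, (1/2) *\<^sub>R A u u)"
      unfolding AE[symmetric] by (simp add: point_mult_def wedge.zero_right)
    have "c * T \<le> integral {0..T} (\<lambda>t. norm (w t)) + real (CARD('k) * CARD('k)) * (4 * sqrt (norm ?E))"
      using cc_dist_le[OF joins_trans[OF jw jE]] min by (simp add: A_def)
    moreover have "real (CARD('k) * CARD('k)) * (4 * sqrt (norm ?E)) \<le> K2 * \<eta> ^ 3"
    proof -
      have d: "\<delta> ^ 3 = (\<eta> ^ 3)\<^sup>2" by (simp add: \<delta>_def power_mult[symmetric])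
      have "sqrt (E1 * \<delta> ^ 3) = sqrt E1 * \<eta> ^ 3"
        unfolding d real_sqrt_mult real_sqrt_abs using \<eta> by simp
      then have "sqrt (norm ?E) \<le> sqrt E1 * \<eta> ^ 3" using real_sqrt_le_mono[OF nE] by simp
      then have "real (CARD('k) * CARD('k)) * (4 * sqrt (norm ?E)) \<le> real (CARD('k) * CARD('k)) * (4 * (sqrt E1 * \<eta> ^ 3))"
        by (intro mult_left_mono) auto
      then show ?thesis by (simp add: K2_def mult.assoc)
    qed
    moreover have "integral {0..T} (\<lambda>t. norm (w t)) \<le> c * T - \<delta> * (I u v / c) + K1 * \<delta>\<^sup>2"
    proof -
      note bb = bounded_bilinear_inner
      have int2: "(\<lambda>t. f t \<bullet> g t) integrable_on {0..T}" if "bmeas T f" "bmeas T g" for f g :: "real \<Rightarrow> real ^ 'k"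
        by (intro bmeas_integrable_on[where T = T] bmeas_bilinear[OF bb] that order.refl)
      note bi = integral_bilinear_add_scaleR[OF bb]
      have Iw: "I f w = I f a + (\<delta>\<^sup>2) * I f z" "I w f = I a f + (\<delta>\<^sup>2) * I z f" if "bmeas T f" for f
        unfolding I_def w_def using bi[OF a z that, of "\<delta>\<^sup>2"] by simp_all
      have Ia: "I f a = I f u - \<delta> * I f v" "I a f = I u f - \<delta> * I v f" if "bmeas T f" for f
        unfolding I_def a_def using bi[OF u v that, of "- \<delta>"] by simp_all
      have Icom: "I f g = I g f" for f g unfolding I_def by (simp only: inner_commute)
      have "I w w = I u u - 2 * \<delta> * I u v + \<delta>\<^sup>2 * (I v v + 2 * I u z) - 2 * \<delta> ^ 3 * I v z + \<delta> ^ 4 * I z z"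
        unfolding Iw(1)[OF w] Iw(2)[OF a] Iw(2)[OF z] Ia(1)[OF a] Ia(1)[OF z] Ia(2)[OF z] Ia(2)[OF u] Ia(2)[OF v]
          Icom[of v u] Icom[of z u] Icom[of z v]
        by (simp add: field_simps eval_nat_numeral)
      moreover have "I u u \<le> c\<^sup>2 * T"
      proof -
        have "I u u \<le> integral {0..T} (\<lambda>_. c\<^sup>2)"
          unfolding I_def
        proof (rule integral_le[OF int2[OF u u]])
          fix t assume "t \<in> {0..T}"
          then show "u t \<bullet> u t \<le> c\<^sup>2" unfolding dot_square_norm by (intro power_mono ub norm_ge_zero)
        qed (rule integrable_const_ivl)
        then show ?thesis using T by (simp add: mult.commute)
      qed
      moreover have "\<delta>\<^sup>2 * (I v v + 2 * I u z) \<le> \<delta>\<^sup>2 * \<bar>I v v + 2 * I u z\<bar>"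
        by (intro mult_left_mono) auto
      moreover have "- (2 * \<delta> ^ 3 * I v z) \<le> \<delta>\<^sup>2 * (2 * \<bar>I v z\<bar>)"
      proof -
        have "- (2 * \<delta> ^ 3 * I v z) \<le> \<delta> ^ 3 * (2 * \<bar>I v z\<bar>)"
        proof -
          have "\<delta> ^ 3 * - I v z \<le> \<delta> ^ 3 * \<bar>I v z\<bar>"
            using \<delta>(1) by (intro mult_left_mono) auto
          then show ?thesis by linarith
        qed
        also have "\<dots> \<le> \<delta>\<^sup>2 * (2 * \<bar>I v z\<bar>)" using \<delta> by (intro mult_right_mono power_decreasing) auto
        finally show ?thesis .
      qed
      moreover have "\<delta> ^ 4 * I z z \<le> \<delta>\<^sup>2 * \<bar>I z z\<bar>"
      proof -
        have "\<delta> ^ 4 * I z z \<le> \<delta> ^ 4 * \<bar>I z z\<bar>" by (rule mult_left_mono) simp_all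
        also have "\<dots> \<le> \<delta>\<^sup>2 * \<bar>I z z\<bar>" using \<delta> by (intro mult_right_mono power_decreasing) auto
        finally show ?thesis .
      qed
      moreover have "\<delta>\<^sup>2 * (\<bar>I v v + 2 * I u z\<bar> + 2 * \<bar>I v z\<bar> + \<bar>I z z\<bar>)
          = \<delta>\<^sup>2 * \<bar>I v v + 2 * I u z\<bar> + \<delta>\<^sup>2 * (2 * \<bar>I v z\<bar>) + \<delta>\<^sup>2 * \<bar>I z z\<bar>"
        by (simp only: distrib_left)
      ultimately have "I w w \<le> c\<^sup>2 * T - 2 * \<delta> * I u v + \<delta>\<^sup>2 * (\<bar>I v v + 2 * I u z\<bar> + 2 * \<bar>I v z\<bar> + \<bar>I z z\<bar>)"
        by linarith
      also have "\<dots> = c\<^sup>2 * T - 2 * \<delta> * I u v + \<delta>\<^sup>2 * (2 * c * K1)" using c by (simp add: K1_def)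
      finally have Iww: "I w w \<le> c\<^sup>2 * T - 2 * \<delta> * I u v + \<delta>\<^sup>2 * (2 * c * K1)" .
      have i1: "(\<lambda>t. (w t \<bullet> w t + c\<^sup>2) / (2 * c)) integrable_on {0..T}"
        by (intro integrable_on_divide integrable_add int2 w integrable_const_ivl)
      have "integral {0..T} (\<lambda>t. norm (w t)) \<le> integral {0..T} (\<lambda>t. (w t \<bullet> w t + c\<^sup>2) / (2 * c))"
      proof (rule integral_le[OF _ i1])
        have "bmeas T (\<lambda>t. norm (w t))"
        proof -
          obtain K where "\<forall>t\<in>{0..T}. norm (w t) \<le> K" using w by (auto simp: bmeas_def)
          then show ?thesis using w unfolding bmeas_def by (auto intro!: exI[of _ K])
        qed
        then show "(\<lambda>t. norm (w t)) integrable_on {0..T}" by (intro bmeas_integrable_on[where T = T]) auto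
        fix t
        have "0 \<le> (norm (w t) - c)\<^sup>2" by simp
        then have "norm (w t) * (2 * c) \<le> w t \<bullet> w t + c\<^sup>2"
          unfolding dot_square_norm by (simp add: power2_diff)
        then show "norm (w t) \<le> (w t \<bullet> w t + c\<^sup>2) / (2 * c)" using c by (simp add: pos_le_divide_eq)
      qed
      also have "\<dots> = (I w w + c\<^sup>2 * T) / (2 * c)"
        using integral_add[OF int2[OF w w] integrable_const_ivl[of "c\<^sup>2" 0 T]] T by (simp add: I_def mult.commute)
      also have "\<dots> \<le> (c\<^sup>2 * T - 2 * \<delta> * I u v + \<delta>\<^sup>2 * (2 * c * K1) + c\<^sup>2 * T) / (2 * c)"
        by (rule divide_right_mono) (use Iww c in linarith)+
      also have "\<dots> = c * T - \<delta> * (I u v / c) + K1 * \<delta>\<^sup>2"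
      proof -
        have "\<delta> * (I u v / c) * (2 * c) = 2 * \<delta> * I u v" using c by simp
        then have "c\<^sup>2 * T - 2 * \<delta> * I u v + \<delta>\<^sup>2 * (2 * c * K1) + c\<^sup>2 * T
            = (c * T - \<delta> * (I u v / c) + K1 * \<delta>\<^sup>2) * (2 * c)"
          unfolding distrib_right left_diff_distrib by (simp add: power2_eq_square)
        then show ?thesis using c by (simp only: nonzero_divide_eq_eq[of "2 * c"])
      qed
      finally show ?thesis .
    qed
    ultimately have "\<delta> * (I u v / c) \<le> K1 * \<delta>\<^sup>2 + K2 * \<eta> ^ 3" by linarith
    also have "K1 * \<delta>\<^sup>2 \<le> K1 * \<eta> ^ 3"
      unfolding \<delta>_def power_mult[symmetric] using \<eta> K0 by (intro mult_left_mono power_decreasing) auto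
    finally show ?thesis by (simp add: \<delta>_def algebra_simps)
  qed
  define q where "q = I u v / c"
  have q: "0 < q" using pos c by (simp add: q_def)
  \<comment> \<open>Chosen so that \<open>(K1 + K2) * \<eta> \<le> q / 2\<close>, which contradicts
    \<open>q \<le> (K1 + K2) * \<eta>\<close>; the added 1 keeps the denominator positive.\<close>
  define \<eta> where "\<eta> = min 1 (q / (2 * (K1 + K2 + 1)))"
  have \<eta>: "0 < \<eta>" "\<eta> \<le> 1" using q K0 by (auto simp: \<eta>_def)
  have "\<eta>\<^sup>2 * q \<le> \<eta>\<^sup>2 * ((K1 + K2) * \<eta>)"
    using main[OF \<eta>] by (simp add: q_def power2_eq_square power3_eq_cube mult_ac)
  then have "q \<le> (K1 + K2) * \<eta>" using \<eta> by simp
  also have "\<dots> \<le> (K1 + K2) * (q / (2 * (K1 + K2 + 1)))"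
    using K0 by (intro mult_left_mono) (auto simp: \<eta>_def)
  also have "\<dots> = ((K1 + K2) / (K1 + K2 + 1)) * (q / 2)" using K0 by simp
  also have "\<dots> \<le> 1 * (q / 2)" using K0 q by (intro mult_right_mono) auto
  finally show False using q by simp
qed

lemma inner_matrix_skew:
  fixes B :: "real ^ 'k::finite ^ 'k"
  shows "a \<bullet> ((B - transpose B) *v b) = - (((B - transpose B) *v a) \<bullet> b)"
proof -
  have "(A *v a) \<bullet> b = a \<bullet> (transpose A *v b)" for A :: "real ^ 'k ^ 'k"
    by (metis dot_lmul_matrix transpose_matrix_vector transpose_transpose)
  from this[of "B - transpose B"] show ?thesis
    by (simp add: transpose_linear matrix_vector_mult_diff_rdistrib inner_diff_right inner_diff_left)
qed

lemma inner_area_form: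
  assumes "bmeas T v" "bmeas T w"
  shows "B \<bullet> area_form T v w = - integral {0..T} (\<lambda>t. ((B - transpose B) *v prim v t) \<bullet> w t)"
proof -
  have "B \<bullet> area_form T v w = integral {0..T} (\<lambda>t. B \<bullet> wedge (prim v t) (w t))"
    unfolding area_form_def
    by (subst integral_linear[OF _ bounded_linear_inner_right, symmetric, unfolded o_def])
       (auto intro!: bmeas_integrable_on[where T = T] bmeas_bilinear[OF bounded_bilinear_wedge] bmeas_prim assms)
  also have "\<dots> = integral {0..T} (\<lambda>t. - (((B - transpose B) *v prim v t) \<bullet> w t))"
    by (simp only: inner_wedge inner_matrix_skew)
  finally show ?thesis by simp
qed

lemma bmeas_inner_self_integral_0:
  assumes q: "bmeas T q" and "integral {0..T} (\<lambda>t. q t \<bullet> q t) = 0"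
  shows "AE t in lebesgue_on {0..T}. q t = 0"
proof -
  have "(\<lambda>t. q t \<bullet> q t) integrable_on {0..T}"
    by (intro bmeas_integrable_on[where T = T] bmeas_bilinear[OF bounded_bilinear_inner] q order.refl)
  then have "((\<lambda>t. q t \<bullet> q t) has_integral 0) {0..T}"
    using assms(2) by (simp add: has_integral_iff)
  then have "AE t in lebesgue_on {0..T}. q t \<bullet> q t = 0"
    by (rule has_integral_0_nonneg_AE) auto
  then show ?thesis by simp
qed

text \<open>
  A vector \<open>B\<close> orthogonal to all areas \<open>\<integral> x \<and> z\<close> with \<open>\<integral> z = 0\<close> kills the curve \<open>x\<close>
  (test with \<open>z = Bx\<close> minus its mean), hence also the span of \<open>x\<close>.
\<close>

lemma area_form_attained:
  fixes u v :: "real \<Rightarrow> real ^ 'k::finite"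
  assumes T: "0 < T" and u: "bmeas T u" and v: "bmeas T v"
    and vV: "\<And>t. t \<in> {0..T} \<Longrightarrow> v t \<in> span (prim u ` {0..T})"
  shows "\<exists>z. bmeas T z \<and> prim z T = 0 \<and> area_form T u z = - (1/2) *\<^sub>R area_form T v v"
proof -
  define D where "D = {area_form T u z | z. bmeas T z \<and> prim z T = 0}"
  define b where "b = - (1/2) *\<^sub>R area_form T v v"
  have zero: "prim (\<lambda>_. 0 :: real ^ 'k) T = 0" by (simp add: prim_def)
  have D: "subspace D"
  proof (rule subspaceI)
    show "0 \<in> D" unfolding D_def using zero bmeas_const[of T 0]
      by (intro CollectI exI[of _ "\<lambda>_. 0"]) (simp add: area_form_def wedge.zero_right)
    fix p q assume "p \<in> D" "q \<in> D"
    then obtain z z' where z: "bmeas T z" "prim z T = 0" "p = area_form T u z"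
      "bmeas T z'" "prim z' T = 0" "q = area_form T u z'" unfolding D_def by blast
    have "area_form T u (\<lambda>t. z t + 1 *\<^sub>R z' t) = p + q" "prim (\<lambda>t. z t + 1 *\<^sub>R z' t) T = 0"
      "bmeas T (\<lambda>t. z t + 1 *\<^sub>R z' t)"
      using z area_form_add_scaleR(2)[OF z(1,4) u, of 1] prim_add_scaleR[OF z(1,4) order.refl, of 1]
        bmeas_add[OF z(1,4)] by simp_all
    then show "p + q \<in> D" unfolding D_def by (metis (mono_tags, lifting) mem_Collect_eq)
  next
    fix r p assume "p \<in> D"
    then obtain z where z: "bmeas T z" "prim z T = 0" "p = area_form T u z" unfolding D_def by blast
    have "area_form T u (\<lambda>t. 0 + r *\<^sub>R z t) = r *\<^sub>R p" "prim (\<lambda>t. 0 + r *\<^sub>R z t) T = 0"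
      "bmeas T (\<lambda>t. 0 + r *\<^sub>R z t)"
      using z area_form_add_scaleR(2)[OF bmeas_const[of T 0] z(1) u, of r] prim_add_scaleR[OF bmeas_const[of T 0] z(1) order.refl, of r]
        bmeas_add[OF bmeas_const[of T 0] bmeas_scaleR[OF z(1), of r]] zero by (simp_all add: area_form_def wedge.zero_right)
    then show "r *\<^sub>R p \<in> D" unfolding D_def by (metis (mono_tags, lifting) mem_Collect_eq)
  qed
  \<comment> \<open>\<open>B\<close> is the part of the target \<open>b\<close> orthogonal to all
    attainable areas; the aim is \<open>B = 0\<close>.\<close>
  obtain y B where yB: "y \<in> span D" "\<And>w. w \<in> span D \<Longrightarrow> orthogonal B w" "b = y + B"
    using orthogonal_subspace_decomp_exists[of D b] by blast
  define S where "S = B - transpose B"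
  \<comment> \<open>Subtracting the mean makes the test control admissible, that is of vanishing
    integral.\<close>
  define m where "m = (1 / T) *\<^sub>R prim (\<lambda>t. S *v prim u t) T"
  define z where "z t = S *v prim u t - m" for t
  have cz: "continuous_on {0..T} z"
    unfolding z_def by (intro continuous_intros bounded_linear.continuous_on[OF matrix_vector_mul_bounded_linear] prim_continuous u)
  have Su: "bmeas T (\<lambda>t. S *v prim u t)"
    by (intro bmeas_linear[OF matrix_vector_mul_bounded_linear] bmeas_prim u)
  have z: "bmeas T z" by (rule bmeas_continuous[OF cz])
  have zT: "prim z T = 0"
  proof -
    have "prim z T = prim (\<lambda>t. S *v prim u t) T - integral {0..T} (\<lambda>_. m)"
      unfolding prim_def[of z] prim_def[of "\<lambda>t. S *v prim u t"] z_def
      by (intro integral_diff bmeas_integrable_on[where T = T] Su bmeas_const) auto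
    then show ?thesis using T by (simp add: m_def)
  qed
  have "area_form T u z \<in> span D" using z zT by (auto simp: D_def intro!: span_base)
  then have "0 = B \<bullet> area_form T u z" using yB(2) by (simp add: orthogonal_def)
  also have "\<dots> = - integral {0..T} (\<lambda>t. (z t + m) \<bullet> z t)"
    by (simp add: inner_area_form[OF u z] S_def[symmetric] z_def)
  also have "integral {0..T} (\<lambda>t. (z t + m) \<bullet> z t) = integral {0..T} (\<lambda>t. z t \<bullet> z t)"
  proof -
    have "integral {0..T} (\<lambda>t. m \<bullet> z t) = m \<bullet> prim z T"
      unfolding prim_def
      by (subst integral_linear[OF _ bounded_linear_inner_right, symmetric, unfolded o_def])
         (use bmeas_integrable_on[OF z, of 0 T] in auto)
    then show ?thesis
      using integral_bilinear_add_scaleR(1)[OF bounded_bilinear_inner z bmeas_const[of T m] z, of 1] zT by simp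
  qed
  finally have z2: "integral {0..T} (\<lambda>t. z t \<bullet> z t) = 0" by simp
  have z_0: "z t = 0" if t: "t \<in> {0..T}" for t
  proof -
    have "((\<lambda>t. z t \<bullet> z t) has_integral 0) (cbox 0 T)"
      using z2 bmeas_integrable_on[OF bmeas_bilinear[OF bounded_bilinear_inner z z], of 0 T]
      by (simp add: has_integral_iff)
    moreover have "continuous_on (cbox 0 T) (\<lambda>t. z t \<bullet> z t)" using cz by (auto intro!: continuous_intros)
    ultimately have "z t \<bullet> z t = 0"
      using has_integral_0_cbox_imp_0[of 0 T "\<lambda>t. z t \<bullet> z t" t] t T by (simp add: box_real)
    then show ?thesis by simp
  qed
  \<comment> \<open>The curve starts at the origin, so \<open>z 0 = - m\<close>.\<close>
  have "m = 0" using z_0[of 0] T by (simp add: z_def prim_def matrix_vector_mult_0_right)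
  then have "S *v prim u t = 0" if "t \<in> {0..T}" for t using z_0[OF that] by (simp add: z_def)
  then have "\<And>x. x \<in> prim u ` {0..T} \<Longrightarrow> S *v x = 0" by blast
  then have "S *v y = 0" if "y \<in> span (prim u ` {0..T})" for y
    using linear_eq_0_on_span[of "(*v) S" "prim u ` {0..T}" y] that by simp
  then have Sv: "S *v v t = 0" if "t \<in> {0..T}" for t using vV that by blast
  have "B \<bullet> area_form T v v = integral {0..T} (\<lambda>t. B \<bullet> wedge (prim v t) (v t))"
    unfolding area_form_def
    by (subst integral_linear[OF _ bounded_linear_inner_right, symmetric, unfolded o_def])
       (auto intro!: bmeas_integrable_on[where T = T] bmeas_bilinear[OF bounded_bilinear_wedge] bmeas_prim v)
  also have "\<dots> = integral {0..T} (\<lambda>_. 0)"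
    by (rule integral_cong) (simp add: inner_wedge S_def[symmetric] Sv)
  finally have "B \<bullet> b = 0" by (simp add: b_def)
  moreover have "B \<bullet> y = 0" using yB(1,2) by (simp add: orthogonal_def)
  ultimately have "B = 0" using yB(3) by (simp add: inner_add_right)
  then have "b \<in> D" using yB(1,3) D by (simp add: span_eq_iff[THEN iffD2])
  then show ?thesis by (auto simp: D_def b_def)
qed

text \<open>Lagrange multipliers by orthogonal projection: \<open>val\<close> collects the
  first-order data of energy and endpoint, and \<open>e\<close> stands for a gain without change of
  the endpoint. As \<open>e\<close> lies outside the range, its component \<open>n\<close>
  orthogonal to the range is a multiplier whose energy entry \<open>l\<close> can be divided
  by.\<close>

lemma minimizer_linear_ode:
  fixes \<gamma> :: "real \<Rightarrow> ('k::finite) point"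
  assumes \<gamma>: "gauge_lipschitz c {0..T} \<gamma>" and \<gamma>0: "\<gamma> 0 = 0" and T: "0 < T" and c: "0 < c"
    and min: "cc_dist 0 (\<gamma> T) = c * T"
  obtains p L where "linear L"
    "\<And>t. t \<in> {0..T} \<Longrightarrow>
       ((\<lambda>t. fst (\<gamma> t)) has_vector_derivative (p + L (fst (\<gamma> t)))) (at t within {0..T})"
proof -
  define x where "x t = fst (\<gamma> t)" for t
  define V where "V = span (x ` {0..T})"
  have "subspace V" by (simp add: V_def subspace_span)
  then obtain P where P: "linear P" "\<And>z. P z \<in> V" "\<And>z. z \<in> V \<Longrightarrow> P z = z" "\<And>a b. P a \<bullet> b = a \<bullet> P b"
    by (rule orthogonal_projection_exists) blast
  have bP: "bounded_linear P" using P(1) by (simp add: linear_conv_bounded_linear)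
  have nP: "norm (P z) \<le> norm z" for z
  proof -
    have "norm (P z) * norm (P z) = P z \<bullet> P z" by (simp add: norm_eq_sqrt_inner)
    also have "\<dots> = z \<bullet> P z" using P(4)[of z "P z"] P(3)[OF P(2), of z] by simp
    also have "\<dots> \<le> norm z * norm (P z)" by (rule norm_cauchy_schwarz)
    finally show ?thesis by (cases "norm (P z) = 0") auto
  qed
  obtain u0 where u0: "is_control 0 T \<gamma> u0" "u0 \<in> borel_measurable borel" "\<And>t. norm (u0 t) \<le> c"
    by (rule gauge_lipschitz_imp_control[OF \<gamma> T]) blast
  \<comment> \<open>Since \<open>x = P x\<close>, projecting to \<open>V\<close> changes
    \<open>u0\<close> on a null set only, and it yields a control with values in \<open>V\<close> at
    every time.\<close>
  define u where "u t = P (u0 t)" for t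
  have "bmeas T u0" using u0(2,3) unfolding bmeas_def by (blast intro: borel_measurable_lebesgue_on)
  then have u: "bmeas T u" unfolding u_def by (rule bmeas_linear[OF bP])
  have ub: "norm (u t) \<le> c" for t unfolding u_def by (rule order.trans[OF nP u0(3)])
  have "AE t in lebesgue_on {0..T}. (\<gamma> has_vector_derivative (u0 t, (1/2) *\<^sub>R wedge (fst (\<gamma> t)) (u0 t))) (at t within {0..T})"
    using u0(1) by (simp add: is_control_def sum_frame_field)
  then have "\<exists>N. negligible N \<and> (\<forall>t\<in>{0..T} - N.
      (\<gamma> has_vector_derivative (u0 t, (1/2) *\<^sub>R wedge (fst (\<gamma> t)) (u0 t))) (at t within {0..T}))"
    by (subst (asm) lebesgue_on_AE_iff_negligible) auto
  then obtain N where N: "negligible N" "\<forall>t\<in>{0..T} - N.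
      (\<gamma> has_vector_derivative (u0 t, (1/2) *\<^sub>R wedge (fst (\<gamma> t)) (u0 t))) (at t within {0..T})" by blast
  have uu0: "u t = u0 t" if t: "t \<in> {0..T} - N" for t
  proof -
    have d: "(x has_vector_derivative u0 t) (at t within {0..T})"
      using bounded_linear.has_vector_derivative[OF bounded_linear_fst N(2)[rule_format, OF t]]
      by (simp add: x_def[abs_def])
    have "((\<lambda>s. P (x s)) has_vector_derivative P (u0 t)) (at t within {0..T})"
      by (rule bounded_linear.has_vector_derivative[OF bP d])
    then have "(x has_vector_derivative P (u0 t)) (at t within {0..T})"
    proof (rule has_vector_derivative_transform[rotated 2])
      show "t \<in> {0..T}" using t by simp
      show "x s = P (x s)" if "s \<in> {0..T}" for s
        using P(3)[of "x s"] that by (simp add: V_def span_base)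
    qed
    then show ?thesis
      using vector_derivative_unique_within_closed_interval[of 0 T t x] d T t by (simp add: u_def)
  qed
  have pu: "prim u t = x t" if t: "t \<in> {0..T}" for t
  proof -
    have "prim u t = integral {0..t} u0"
      unfolding prim_def by (rule integral_spike[OF N(1)]) (use uu0 t in auto)
    also have "\<dots> = x t"
      using integral_unique[OF control_has_integral(1)[OF u0(1), of 0 t]] t by (simp add: x_def \<gamma>0)
    finally show ?thesis .
  qed
  have "integral {0..T} (\<lambda>r. (1/2) *\<^sub>R wedge (fst (\<gamma> r)) (u0 r)) = snd (\<gamma> T)"
    using integral_unique[OF control_has_integral(2)[OF u0(1), of 0 T]] T by (simp add: \<gamma>0)
  moreover have "integral {0..T} (\<lambda>r. (1/2) *\<^sub>R wedge (fst (\<gamma> r)) (u0 r)) = integral {0..T} (\<lambda>r. (1/2) *\<^sub>R wedge (prim u r) (u r))"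
  proof (rule integral_spike[OF N(1)])
    fix r assume "r \<in> {0..T} - N"
    then show "(1/2) *\<^sub>R wedge (prim u r) (u r) = (1/2) *\<^sub>R wedge (fst (\<gamma> r)) (u0 r)"
      using uu0[of r] pu[of r] by (simp add: x_def)
  qed
  ultimately have "(1/2) *\<^sub>R area_form T u u = snd (\<gamma> T)" by (simp add: area_form_def)
  then have end_pt: "(prim u T, (1/2) *\<^sub>R area_form T u u) = \<gamma> T"
    using pu[of T] T by (simp add: x_def prod_eq_iff)
  have V: "V = span (prim u ` {0..T})" unfolding V_def using pu by (metis image_cong)
  define val where "val w = (integral {0..T} (\<lambda>t. w t \<bullet> u t), prim w T, area_form T u w)" for w
  have val: "val (\<lambda>t. w t + r *\<^sub>R w' t) = val w + r *\<^sub>R val w'" if "bmeas T w" "bmeas T w'" for w w' r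
    unfolding val_def
    using integral_bilinear_add_scaleR(1)[OF bounded_bilinear_inner that u, of r]
      prim_add_scaleR[OF that order.refl, of r] area_form_add_scaleR(2)[OF that u, of r] by simp
  \<comment> \<open>Variations take values in \<open>V\<close>, since those are the ones
    \<open>area_form_attained\<close> can correct.\<close>
  define Rng where "Rng = {val w | w. bmeas T w \<and> (\<forall>t\<in>{0..T}. w t \<in> V)}"
  have RngI: "val w \<in> Rng" if "bmeas T w" "\<forall>t\<in>{0..T}. w t \<in> V" for w
    unfolding Rng_def using that by blast
  have val0: "val (\<lambda>_. 0) = 0"
    by (simp add: val_def prim_def area_form_def wedge.zero_right zero_prod_def)
  have "subspace Rng"
  proof (rule subspaceI)
    show "0 \<in> Rng" using RngI[OF bmeas_const[of T 0]] val0 by (simp add: V_def span_zero)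
    fix a b assume "a \<in> Rng" "b \<in> Rng"
    then obtain w w' where w: "bmeas T w" "\<forall>t\<in>{0..T}. w t \<in> V" "a = val w"
      "bmeas T w'" "\<forall>t\<in>{0..T}. w' t \<in> V" "b = val w'" unfolding Rng_def by blast
    have "val (\<lambda>t. w t + 1 *\<^sub>R w' t) \<in> Rng"
      using w by (intro RngI bmeas_add bmeas_scaleR) (auto simp: V_def span_add)
    then show "a + b \<in> Rng" using val[OF w(1,4), of 1] w by simp
  next
    fix r a assume "a \<in> Rng"
    then obtain w where w: "bmeas T w" "\<forall>t\<in>{0..T}. w t \<in> V" "a = val w" unfolding Rng_def by blast
    have "val (\<lambda>t. 0 + r *\<^sub>R w t) \<in> Rng"
      using w by (intro RngI bmeas_add bmeas_scaleR bmeas_const) (auto simp: V_def span_mul)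
    then show "r *\<^sub>R a \<in> Rng" using val[OF bmeas_const[of T 0] w(1), of r] w val0 by simp
  qed
  define e where "e = (1 :: real, 0 :: real ^ 'k, 0 :: real ^ 'k ^ 'k)"
  have "e \<notin> Rng"
  proof
    assume "e \<in> Rng"
    then obtain v where v: "bmeas T v" "\<forall>t\<in>{0..T}. v t \<in> V" "e = val v" unfolding Rng_def by blast
    then have v': "integral {0..T} (\<lambda>t. v t \<bullet> u t) = 1" "prim v T = 0" "area_form T u v = 0"
      by (simp_all add: e_def val_def)
    obtain z where z: "bmeas T z" "prim z T = 0" "area_form T u z = - (1/2) *\<^sub>R area_form T v v"
      using area_form_attained[OF T u v(1)] v(2) V by blast
    have "integral {0..T} (\<lambda>t. u t \<bullet> v t) \<le> 0"
      by (rule no_descent_direction[OF T c u v(1) z(1) ub v'(2) z(2) v'(3) z(3)])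
         (simp only: end_pt min)
    then show False using v'(1) by (simp add: inner_commute)
  qed
  obtain y n where yn: "y \<in> span Rng" "\<And>w. w \<in> span Rng \<Longrightarrow> orthogonal n w" "e = y + n"
    using orthogonal_subspace_decomp_exists[of Rng e] by blast
  have y: "y \<in> Rng" using yn(1) \<open>subspace Rng\<close> by (simp add: span_eq_iff[THEN iffD2])
  have "n \<noteq> 0" using y yn(3) \<open>e \<notin> Rng\<close> by auto
  obtain l p B where n: "n = (l, p, B)" by (cases n)
  \<comment> \<open>The product of \<open>n\<close> with \<open>e\<close> is both
    \<open>|n|^2\<close> and \<open>l\<close>, so \<open>n \<noteq> 0\<close> rules out the abnormal
    case \<open>l = 0\<close>.\<close>
  have "n \<bullet> e = n \<bullet> n" using yn(2)[OF yn(1)] by (simp add: yn(3) inner_add_right orthogonal_def)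
  moreover have "n \<bullet> e = l" by (simp add: n e_def)
  ultimately have l: "l \<noteq> 0" using \<open>n \<noteq> 0\<close> by auto
  define S where "S = B - transpose B"
  define q where "q t = (l *\<^sub>R u t + p) - S *v prim u t" for t
  have Su: "bmeas T (\<lambda>t. S *v prim u t)"
    by (rule bmeas_linear[OF matrix_vector_mul_bounded_linear bmeas_prim[OF u]])
  have lup: "bmeas T (\<lambda>t. l *\<^sub>R u t + p)" by (rule bmeas_add[OF bmeas_scaleR[OF u] bmeas_const])
  have "q = (\<lambda>t. (l *\<^sub>R u t + p) + (-1) *\<^sub>R (S *v prim u t))" by (rule ext) (simp add: q_def)
  then have q: "bmeas T q" using bmeas_add[OF lup bmeas_scaleR[OF Su, of "-1"]] by simp
  \<comment> \<open>Testing with the projection of \<open>q\<close> itself turns orthogonality into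
    a vanishing integral of \<open>|w|^2\<close>: the Euler-Lagrange equation, projected to
    \<open>V\<close>.\<close>
  define w where "w t = P (q t)" for t
  have w: "bmeas T w" unfolding w_def by (rule bmeas_linear[OF bP q])
  have wV: "w t \<in> V" for t by (simp add: w_def P(2))
  have "val w \<in> span Rng" by (intro span_base RngI w) (use wV in blast)
  then have "n \<bullet> val w = 0" using yn(2) by (simp add: orthogonal_def)
  then have "l * integral {0..T} (\<lambda>t. w t \<bullet> u t) + p \<bullet> prim w T - integral {0..T} (\<lambda>t. (S *v prim u t) \<bullet> w t) = 0"
    by (simp add: n val_def inner_area_form[OF u w] S_def)
  moreover have "integral {0..T} (\<lambda>t. q t \<bullet> w t)
      = l * integral {0..T} (\<lambda>t. w t \<bullet> u t) + p \<bullet> prim w T - integral {0..T} (\<lambda>t. (S *v prim u t) \<bullet> w t)"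
  proof -
    have i: "(\<lambda>t. f t \<bullet> w t) integrable_on {0..T}" if "bmeas T f" for f
      by (intro bmeas_integrable_on[where T = T] bmeas_bilinear[OF bounded_bilinear_inner] that w order.refl)
    have "integral {0..T} (\<lambda>t. q t \<bullet> w t) = integral {0..T} (\<lambda>t. (l *\<^sub>R u t + p) \<bullet> w t) - integral {0..T} (\<lambda>t. (S *v prim u t) \<bullet> w t)"
      unfolding q_def inner_diff_left by (intro integral_diff i lup Su)
    moreover have "integral {0..T} (\<lambda>t. (l *\<^sub>R u t + p) \<bullet> w t) = integral {0..T} (\<lambda>t. (l *\<^sub>R u t) \<bullet> w t) + integral {0..T} (\<lambda>t. p \<bullet> w t)"
      unfolding inner_add_left by (intro integral_add i bmeas_scaleR u bmeas_const)
    moreover have "integral {0..T} (\<lambda>t. p \<bullet> w t) = p \<bullet> prim w T"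
      unfolding prim_def
      by (subst integral_linear[OF _ bounded_linear_inner_right, symmetric, unfolded o_def])
         (use bmeas_integrable_on[OF w, of 0 T] in auto)
    moreover have "integral {0..T} (\<lambda>t. (l *\<^sub>R u t) \<bullet> w t) = l * integral {0..T} (\<lambda>t. w t \<bullet> u t)"
      by (simp add: inner_commute)
    ultimately show ?thesis by simp
  qed
  moreover have "q t \<bullet> w t = w t \<bullet> w t" for t
    unfolding w_def using P(4)[of "q t" "P (q t)"] P(3)[OF P(2), of "q t"] by simp
  ultimately have "integral {0..T} (\<lambda>t. w t \<bullet> w t) = 0" by simp
  then have "AE t in lebesgue_on {0..T}. w t = 0" by (rule bmeas_inner_self_integral_0[OF w])
  then have "\<exists>N. negligible N \<and> (\<forall>t\<in>{0..T} - N. w t = 0)"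
    by (subst (asm) lebesgue_on_AE_iff_negligible) auto
  then obtain N' where N': "negligible N'" "\<forall>t\<in>{0..T} - N'. w t = 0" by blast
  define p' where "p' = - ((1 / l) *\<^sub>R P p)"
  define L where "L y = (1 / l) *\<^sub>R P (S *v y)" for y
  have L: "linear L"
    unfolding L_def by (intro linear_compose_scale_right linear_compose[OF matrix_vector_mul_linear P(1), unfolded o_def])
  have uL: "u t = p' + L (prim u t)" if t: "t \<in> {0..T} - N'" for t
  proof -
    have "P (u t) = u t" unfolding u_def by (rule P(3)[OF P(2)])
    then have "0 = l *\<^sub>R u t + P p - P (S *v prim u t)"
      using N'(2)[rule_format, OF t]
      by (simp add: w_def q_def linear_add[OF P(1)] linear_diff[OF P(1)] linear_scale[OF P(1)])
    then have "l *\<^sub>R u t = P (S *v prim u t) - P p" by (simp add: algebra_simps)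
    then have "(1 / l) *\<^sub>R (l *\<^sub>R u t) = (1 / l) *\<^sub>R (P (S *v prim u t) - P p)" by simp
    then show ?thesis using l by (simp add: p'_def L_def scaleR_diff_right)
  qed
  have cont: "continuous_on {0..T} (\<lambda>t. p' + L (prim u t))"
    using L by (intro continuous_intros bounded_linear.continuous_on[where f = L] prim_continuous u)
       (simp add: linear_conv_bounded_linear)
  show thesis
  proof (rule that[OF L, of p'])
    fix t assume t: "t \<in> {0..T}"
    \<comment> \<open>The equation for \<open>u\<close> holds almost everywhere, but its right side
      is continuous, so the integral \<open>x\<close> is differentiable at every time.\<close>
    have "((\<lambda>s. integral {0..s} (\<lambda>t. p' + L (prim u t))) has_vector_derivative p' + L (prim u t)) (at t within {0..T})"
      by (rule integral_has_vector_derivative[OF cont t])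
    then show "((\<lambda>t. fst (\<gamma> t)) has_vector_derivative (p' + L (fst (\<gamma> t)))) (at t within {0..T})"
    proof (rule has_vector_derivative_transform[rotated 2, THEN has_vector_derivative_eq_rhs])
      show "t \<in> {0..T}" by (rule t)
      show "p' + L (prim u t) = p' + L (fst (\<gamma> t))" using pu[OF t] by (simp add: x_def)
      fix s assume s: "s \<in> {0..T}"
      have "prim u s = integral {0..s} (\<lambda>t. p' + L (prim u t))"
        unfolding prim_def[of u s] by (rule integral_spike[OF N'(1)]) (use uL s in auto)
      then show "fst (\<gamma> s) = integral {0..s} (\<lambda>t. p' + L (prim u t))" using pu[OF s] by (simp add: x_def)
    qed
  qed
qed

text \<open>Constant coordinates 1 make the affine equations linear, and stacking both solutions
  gives one linear flow; each component of the difference is a linear functional of it.\<close>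

lemma affine_flows_agree:
  fixes x y :: "real \<Rightarrow> 'a::euclidean_space"
  assumes L: "linear L" and M: "linear M"
    and x: "\<And>t. t \<in> {0..T} \<Longrightarrow> (x has_vector_derivative (p + L (x t))) (at t within {0..T})"
    and y: "\<And>t. t \<in> {0..T} \<Longrightarrow> (y has_vector_derivative (q + M (y t))) (at t within {0..T})"
    and T1: "0 \<le> T1" "T1 < T" and eq: "\<And>t. t \<in> {T1..T} \<Longrightarrow> x t = y t"
    and t: "t \<in> {0..T}"
  shows "x t = y t"
proof -
  define z where "z t = ((x t, 1 :: real), (y t, 1 :: real))" for t
  define D where "D v = ((snd (fst v) *\<^sub>R p + L (fst (fst v)), 0 :: real), (snd (snd v) *\<^sub>R q + M (fst (snd v)), 0 :: real))"
    for v :: "('a \<times> real) \<times> ('a \<times> real)"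
  have D: "linear D"
    by (rule linearI)
       (simp_all add: D_def linear_add[OF L] linear_add[OF M] linear_scale[OF L] linear_scale[OF M]
          scaleR_add_left scaleR_add_right)
  have "(x t - y t) \<bullet> i = 0" for i
  proof -
    define \<pi> where "\<pi> v = (fst (fst v) - fst (snd v)) \<bullet> i" for v :: "('a \<times> real) \<times> ('a \<times> real)"
    have \<pi>: "linear \<pi>"
      by (rule linearI) (simp_all add: \<pi>_def inner_diff_left inner_add_left algebra_simps)
    have "\<pi> (z t) = 0"
    proof (rule linear_flow_functional_eq_0[OF D \<pi> _ T1 _ t])
      fix t assume t: "t \<in> {0..T}"
      have "(z has_vector_derivative ((p + L (x t), 0), (q + M (y t), 0))) (at t within {0..T})"
        unfolding z_def[abs_def]
        by (intro has_vector_derivative_Pair x[OF t] y[OF t] has_vector_derivative_const)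
      then show "(z has_vector_derivative D (z t)) (at t within {0..T})" by (simp add: D_def z_def)
    next
      fix t assume "t \<in> {T1..T}"
      then show "\<pi> (z t) = 0" using eq by (simp add: \<pi>_def z_def)
    qed
    then show ?thesis by (simp add: \<pi>_def z_def)
  qed
  from this[of "x t - y t"] show ?thesis by simp
qed

text \<open>Agreement spreads backwards from a final arc; in this form an initial arc is compared
  with its image under a symmetry that fixes the rest of the curve.\<close>

lemma minimizers_do_not_branch:
  assumes \<gamma>: "gauge_lipschitz c {0..T} \<gamma>" "\<gamma> 0 = 0" "cc_dist 0 (\<gamma> T) = c * T"
    and \<eta>: "gauge_lipschitz c {0..T} \<eta>" "\<eta> 0 = 0" "cc_dist 0 (\<eta> T) = c * T"
    and c: "0 < c" and T1: "0 \<le> T1" "T1 < T" and eq: "\<And>t. t \<in> {T1..T} \<Longrightarrow> \<gamma> t = \<eta> t"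
    and t: "t \<in> {0..T}"
  shows "fst (\<gamma> t) = fst (\<eta> t)"
proof -
  have T: "0 < T" using T1 by simp
  obtain p L where L: "linear L" "\<And>t. t \<in> {0..T} \<Longrightarrow>
       ((\<lambda>t. fst (\<gamma> t)) has_vector_derivative (p + L (fst (\<gamma> t)))) (at t within {0..T})"
    by (rule minimizer_linear_ode[OF \<gamma>(1,2) T c \<gamma>(3)]) (rule that)
  obtain q M where M: "linear M" "\<And>t. t \<in> {0..T} \<Longrightarrow>
       ((\<lambda>t. fst (\<eta> t)) has_vector_derivative (q + M (fst (\<eta> t)))) (at t within {0..T})"
    by (rule minimizer_linear_ode[OF \<eta>(1,2) T c \<eta>(3)]) (rule that)
  show ?thesis
    by (rule affine_flows_agree[OF L(1) M(1) L(2) M(2) T1 _ t]) (simp_all add: eq)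
qed

section \<open>Extension of geodesics\<close>

lemma is_control_cong:
  assumes eq: "\<And>t. t \<in> {a..b} \<Longrightarrow> \<gamma> t = \<eta> t"
  shows "is_control a b \<gamma> u \<longleftrightarrow> is_control a b \<eta> u"
proof -
  have *: "is_control a b \<eta> u" if eq: "\<And>t. t \<in> {a..b} \<Longrightarrow> \<gamma> t = \<eta> t" and u: "is_control a b \<gamma> u" for \<gamma> \<eta>
  proof -
    let ?D = "\<lambda>\<gamma> t. (\<gamma> has_vector_derivative (\<Sum>i\<in>UNIV. (u t $ i) *\<^sub>R frame_field i (\<gamma> t))) (at t within {a..b})"
    have "?D \<eta> t" if t: "t \<in> {a..b}" and d: "?D \<gamma> t" for t
    proof -
      have "(\<eta> has_vector_derivative (\<Sum>i\<in>UNIV. (u t $ i) *\<^sub>R frame_field i (\<gamma> t))) (at t within {a..b})"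
        by (rule has_vector_derivative_transform[OF t _ d]) (simp add: eq)
      then show ?thesis by (simp only: eq[OF t])
    qed
    note impl = this
    have A: "AE t in lebesgue_on {a..b}. t \<in> {a..b}" by (rule AE_I2) simp
    have B: "AE t in lebesgue_on {a..b}. ?D \<gamma> t" using u by (simp add: is_control_def)
    have D: "AE t in lebesgue_on {a..b}. ?D \<eta> t"
      by (rule eventually_mono[OF eventually_conj[OF A B]]) (rule impl, simp_all)
    obtain L where "L-lipschitz_on {a..b} \<gamma>" using u by (auto simp: is_control_def)
    then have "L-lipschitz_on {a..b} \<eta>" using eq by (simp add: lipschitz_on_def)
    moreover have "\<eta> ` {a..b} \<subseteq> carnot_group" using u eq by (force simp: is_control_def)
    ultimately show ?thesis using u D unfolding is_control_def by blast
  qed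
  show ?thesis using *[of \<gamma> \<eta>, OF eq] *[of \<eta> \<gamma>, OF eq[symmetric]] by blast
qed

lemma curve_length_cong:
  assumes "\<And>t. t \<in> {a..b} \<Longrightarrow> \<gamma> t = \<eta> t"
  shows "curve_length a b \<gamma> = curve_length a b \<eta>"
proof -
  have "is_control a b \<gamma> = is_control a b \<eta>" by (rule ext) (rule is_control_cong[OF assms])
  then show ?thesis by (simp only: curve_length_def)
qed

lemma minimizing_cong:
  assumes eq: "\<And>t. t \<in> {a..b} \<Longrightarrow> \<gamma> t = \<eta> t" and ab: "a \<le> b"
  shows "minimizing a b \<gamma> \<longleftrightarrow> minimizing a b \<eta>"
proof -
  have "is_control a b \<gamma> = is_control a b \<eta>" by (rule ext) (rule is_control_cong[OF eq])
  moreover have "\<gamma> a = \<eta> a" "\<gamma> b = \<eta> b" using eq ab by auto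
  ultimately show ?thesis by (simp only: minimizing_def horizontal_def curve_length_cong[OF eq])
qed

lemma geodesic_Icc_subset:
  assumes "geodesic J \<gamma>" "t \<in> J"
  shows "{0..t} \<subseteq> J"
proof
  fix s assume "s \<in> {0..t}"
  moreover have "is_interval J" "0 \<in> J" using assms(1) unfolding geodesic_def by blast+
  ultimately show "s \<in> J" using assms(2) mem_is_interval_1_I[of J 0 t s] by auto
qed

lemma geodesic_cong:
  assumes g: "geodesic J \<gamma>" and eq: "\<And>t. t \<in> J \<Longrightarrow> \<gamma> t = \<eta> t"
  shows "geodesic J \<eta>"
proof -
  obtain c where c: "\<And>T. T \<in> J \<Longrightarrow> 0 < T \<Longrightarrow>
      \<exists>u. is_control 0 T \<gamma> u \<and> (AE t in lebesgue_on {0..T}. norm (u t) = c)"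
    using g unfolding geodesic_def by blast
  have c': "\<exists>u. is_control 0 T \<eta> u \<and> (AE t in lebesgue_on {0..T}. norm (u t) = c)"
    if T: "T \<in> J" "0 < T" for T
  proof -
    have "is_control 0 T \<gamma> u \<longleftrightarrow> is_control 0 T \<eta> u" for u
      by (rule is_control_cong) (use eq geodesic_Icc_subset[OF g T(1)] in blast)
    then show ?thesis using c[OF T] by simp
  qed
  have l: "\<exists>\<epsilon>>0. \<forall>a b. a < b \<and> {a..b} \<subseteq> J \<inter> {t - \<epsilon>..t + \<epsilon>} \<longrightarrow> minimizing a b \<eta>" if t: "t \<in> J" for t
  proof -
    obtain \<epsilon> where \<epsilon>: "\<epsilon> > 0" "\<And>a b. a < b \<Longrightarrow> {a..b} \<subseteq> J \<inter> {t - \<epsilon>..t + \<epsilon>} \<Longrightarrow> minimizing a b \<gamma>"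
      using g t unfolding geodesic_def by blast
    have "minimizing a b \<eta>" if ab: "a < b" "{a..b} \<subseteq> J \<inter> {t - \<epsilon>..t + \<epsilon>}" for a b
    proof -
      have "minimizing a b \<gamma> \<longleftrightarrow> minimizing a b \<eta>"
        by (rule minimizing_cong) (use ab eq in auto)
      then show ?thesis using \<epsilon>(2)[OF ab] by simp
    qed
    then show ?thesis using \<epsilon>(1) by blast
  qed
  have "\<not> \<eta> constant_on J"
  proof
    assume "\<eta> constant_on J"
    then obtain y where "\<And>t. t \<in> J \<Longrightarrow> \<eta> t = y" unfolding constant_on_def by blast
    then have "\<gamma> constant_on J" unfolding constant_on_def using eq by (intro exI[of _ y]) simp
    then show False using g by (simp add: geodesic_def)
  qed
  then show ?thesis using g c' l unfolding geodesic_def by blast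
qed

lemma geodesic_Union_chain:
  assumes ne: "\<K> \<noteq> {}" and g: "\<And>K. K \<in> \<K> \<Longrightarrow> geodesic K \<gamma>"
    and ch: "\<And>K K'. K \<in> \<K> \<Longrightarrow> K' \<in> \<K> \<Longrightarrow> K \<subseteq> K' \<or> K' \<subseteq> K"
    and T0: "0 < T0" "\<And>K. K \<in> \<K> \<Longrightarrow> T0 \<in> K"
  shows "geodesic (\<Union>\<K>) \<gamma>"
proof -
  obtain K0 where K0: "K0 \<in> \<K>" using ne by blast
  have int: "is_interval K" "0 \<in> K" "K \<subseteq> {0..}" if "K \<in> \<K>" for K
    using g[OF that] by (auto simp: geodesic_def)
  have "is_interval (\<Union>\<K>)"
    unfolding is_interval_1
  proof (intro ballI allI impI)
    fix a b x assume "a \<in> \<Union>\<K>" "b \<in> \<Union>\<K>" and x: "a \<le> x \<and> x \<le> b"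
    then obtain K K' where K: "K \<in> \<K>" "a \<in> K" "K' \<in> \<K>" "b \<in> K'" by blast
    have "0 \<le> a" using int(3)[OF K(1)] K(2) by auto
    then have "x \<in> {0..b}" using x by simp
    then have "x \<in> K'" using geodesic_Icc_subset[OF g[OF K(3)] K(4)] by blast
    then show "x \<in> \<Union>\<K>" using K(3) by blast
  qed
  moreover have "0 \<in> \<Union>\<K>" "\<Union>\<K> \<subseteq> {0..}" using int K0 by blast+
  moreover have "\<not> \<gamma> constant_on \<Union>\<K>"
    using g[OF K0] K0 constant_on_subset[of \<gamma> "\<Union>\<K>" K0] by (auto simp: geodesic_def)
  \<comment> \<open>Each member comes with its own speed; the common time \<open>T0\<close> shows
    that all of them equal \<open>curve_length 0 T0 \<gamma> / T0\<close>.\<close>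
  moreover have "\<exists>u. is_control 0 T \<gamma> u \<and> (AE t in lebesgue_on {0..T}. norm (u t) = curve_length 0 T0 \<gamma> / T0)"
    if T: "T \<in> \<Union>\<K>" "0 < T" for T
  proof -
    obtain K where K: "K \<in> \<K>" "T \<in> K" using T by blast
    obtain c where c: "\<And>T. T \<in> K \<Longrightarrow> 0 < T \<Longrightarrow>
      \<exists>u. is_control 0 T \<gamma> u \<and> (AE t in lebesgue_on {0..T}. norm (u t) = c)"
      using g[OF K(1)] unfolding geodesic_def by blast
    obtain u where u: "is_control 0 T0 \<gamma> u" "AE t in lebesgue_on {0..T0}. norm (u t) = c"
      using c[OF T0(2)[OF K(1)] T0(1)] by blast
    have "curve_length 0 T0 \<gamma> = c * (T0 - 0)"
      by (rule unit_speed_control_gauge_lipschitz(2)[OF u]) (use T0(1) in simp)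
    then have "c = curve_length 0 T0 \<gamma> / T0" using T0(1) by simp
    then show ?thesis using c[OF K(2) T(2)] by simp
  qed
  moreover have "\<exists>\<epsilon>>0. \<forall>a b. a < b \<and> {a..b} \<subseteq> \<Union>\<K> \<inter> {t - \<epsilon>..t + \<epsilon>} \<longrightarrow> minimizing a b \<gamma>"
    if t: "t \<in> \<Union>\<K>" for t
  proof -
    obtain K where K: "K \<in> \<K>" "t \<in> K" using t by blast
    show ?thesis
    \<comment> \<open>Intervals around \<open>t\<close> must fit into one member. If the union
      reaches some \<open>s > t\<close>, a member containing \<open>s\<close> works once
      \<open>\<epsilon>\<close> is at most \<open>s - t\<close>; otherwise the union equals the
      member that contains \<open>t\<close>.\<close>
    proof (cases "\<exists>s\<in>\<Union>\<K>. t < s")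
      case True
      then obtain s K' where s: "K' \<in> \<K>" "s \<in> K'" "t < s" by blast
      have tK': "{0..s} \<subseteq> K'" by (rule geodesic_Icc_subset[OF g[OF s(1)] s(2)])
      have "0 \<le> t" using int(3)[OF K(1)] K(2) by auto
      then have "t \<in> K'" using tK' s(3) by auto
      then obtain \<epsilon> where \<epsilon>: "\<epsilon> > 0" "\<And>a b. a < b \<Longrightarrow> {a..b} \<subseteq> K' \<inter> {t - \<epsilon>..t + \<epsilon>} \<Longrightarrow> minimizing a b \<gamma>"
        using g[OF s(1)] unfolding geodesic_def by blast
      show ?thesis
      proof (intro exI[of _ "min \<epsilon> (s - t)"] conjI allI impI)
        show "0 < min \<epsilon> (s - t)" using \<epsilon>(1) s(3) by simp
        fix a b assume ab: "a < b \<and> {a..b} \<subseteq> \<Union>\<K> \<inter> {t - min \<epsilon> (s - t)..t + min \<epsilon> (s - t)}"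
        have "{a..b} \<subseteq> K' \<inter> {t - \<epsilon>..t + \<epsilon>}"
        proof
          fix r assume "r \<in> {a..b}"
          then have r: "r \<in> \<Union>\<K>" "r \<in> {t - min \<epsilon> (s - t)..t + min \<epsilon> (s - t)}" using ab by blast+
          then have "0 \<le> r" using \<open>\<Union>\<K> \<subseteq> {0..}\<close> by auto
          then show "r \<in> K' \<inter> {t - \<epsilon>..t + \<epsilon>}" using r(2) tK' by auto
        qed
        then show "minimizing a b \<gamma>" using \<epsilon>(2) ab by blast
      qed
    next
      case False
      have "\<Union>\<K> \<subseteq> K"
      proof
        fix r assume r: "r \<in> \<Union>\<K>"
        then have "r \<in> {0..t}" using False \<open>\<Union>\<K> \<subseteq> {0..}\<close> by force
        then show "r \<in> K" using geodesic_Icc_subset[OF g[OF K(1)] K(2)] by blast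
      qed
      then have eqK: "\<Union>\<K> = K" using K(1) by blast
      show ?thesis unfolding eqK using g[OF K(1)] K(2) by (simp add: geodesic_def)
    qed
  qed
  ultimately show ?thesis unfolding geodesic_def by blast
qed

text \<open>Zorn's lemma is applied to graphs: curves are total functions, and the graph over the
  domain forgets the irrelevant values, so that inclusion means extension.\<close>

lemma maximal_geodesic_extension:
  assumes g0: "geodesic J0 \<gamma>0" and T0: "0 < T0" "T0 \<in> J0"
  obtains J \<gamma> where "maximal_geodesic J \<gamma>" "J0 \<subseteq> J" "\<And>t. t \<in> J0 \<Longrightarrow> \<gamma> t = \<gamma>0 t"
proof -
  define graph where "graph J \<gamma> = (\<lambda>t. (t, \<gamma> t)) ` J" for J :: "real set" and \<gamma> :: "real \<Rightarrow> 'a point"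
  define \<G> where "\<G> = {graph J \<gamma> | J \<gamma>. geodesic J \<gamma> \<and> J0 \<subseteq> J \<and> (\<forall>t\<in>J0. \<gamma> t = \<gamma>0 t)}"
  have "\<exists>M\<in>\<G>. \<forall>X\<in>\<G>. M \<subseteq> X \<longrightarrow> X = M"
  proof (rule subset_Zorn_nonempty)
    show "\<G> \<noteq> {}" using g0 unfolding \<G>_def by blast
    fix \<C> assume \<C>: "\<C> \<noteq> {}" "subset.chain \<G> \<C>"
    have ch: "G \<subseteq> G' \<or> G' \<subseteq> G" if "G \<in> \<C>" "G' \<in> \<C>" for G G'
      using \<C>(2) that unfolding subset.chain_def by blast
    define \<gamma> where "\<gamma> t = (SOME y. (t, y) \<in> \<Union>\<C>)" for t
    have fn: "y = y'" if ty: "(t, y) \<in> \<Union>\<C>" "(t, y') \<in> \<Union>\<C>" for t y y'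
    proof -
      obtain G1 G2 where G12: "G1 \<in> \<C>" "(t, y) \<in> G1" "G2 \<in> \<C>" "(t, y') \<in> G2" using ty by blast
      have "\<exists>G. G \<in> \<C> \<and> (t, y) \<in> G \<and> (t, y') \<in> G"
        using ch[OF G12(1,3)]
      proof
        assume "G1 \<subseteq> G2" then show ?thesis using G12 by blast
      next
        assume "G2 \<subseteq> G1" then show ?thesis using G12 by blast
      qed
      then obtain G where "G \<in> \<C>" "(t, y) \<in> G" "(t, y') \<in> G" by blast
      moreover have "G \<in> \<G>" using \<C>(2) \<open>G \<in> \<C>\<close> unfolding subset.chain_def by blast
      ultimately show ?thesis unfolding \<G>_def graph_def by auto
    qed
    have \<gamma>: "\<gamma> t = y" if "(t, y) \<in> \<Union>\<C>" for t y
      using fn[OF _ that] someI[of "\<lambda>y. (t, y) \<in> \<Union>\<C>", OF that] by (simp add: \<gamma>_def)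
    define \<K> where "\<K> = (\<lambda>G. fst ` G) ` \<C>"
    have G: "geodesic (fst ` G) \<gamma> \<and> J0 \<subseteq> fst ` G \<and> (\<forall>t\<in>J0. \<gamma> t = \<gamma>0 t)" if "G \<in> \<C>" for G
    proof -
      have "G \<in> \<G>" using \<C>(2) that unfolding subset.chain_def by blast
      then obtain J \<eta> where J: "G = graph J \<eta>" "geodesic J \<eta>" "J0 \<subseteq> J" "\<forall>t\<in>J0. \<eta> t = \<gamma>0 t"
        unfolding \<G>_def by blast
      have f: "fst ` G = J" by (auto simp: J(1) graph_def image_image)
      have e: "\<gamma> t = \<eta> t" if "t \<in> J" for t
      proof (rule \<gamma>)
        have "(t, \<eta> t) \<in> G" unfolding J(1) graph_def using that by (rule image_eqI[rotated]) simp
        then show "(t, \<eta> t) \<in> \<Union>\<C>" using \<open>G \<in> \<C>\<close> by (rule UnionI[rotated])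
      qed
      have "geodesic J \<gamma>" by (rule geodesic_cong[OF J(2)]) (simp add: e)
      moreover have "\<gamma> t = \<gamma>0 t" if "t \<in> J0" for t
      proof -
        have "t \<in> J" using that J(3) by (rule subsetD[rotated])
        then show ?thesis using e[of t] J(4)[rule_format, OF that] by simp
      qed
      ultimately show ?thesis unfolding f using J(3) by (intro conjI ballI)
    qed
    have KE: "\<exists>G. G \<in> \<C> \<and> K = fst ` G" if "K \<in> \<K>" for K
      using that by (simp add: \<K>_def image_iff) (erule bexE, intro exI conjI)
    have "geodesic (\<Union>\<K>) \<gamma>"
    proof (rule geodesic_Union_chain[OF _ _ _ T0(1)])
      show "\<K> \<noteq> {}" using \<C>(1) by (simp add: \<K>_def)
      show "K \<subseteq> K' \<or> K' \<subseteq> K" if KK: "K \<in> \<K>" "K' \<in> \<K>" for K K'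
      proof -
        obtain G1 where G1: "G1 \<in> \<C> \<and> K = fst ` G1" using KE[OF KK(1)] ..
        obtain G2 where G2: "G2 \<in> \<C> \<and> K' = fst ` G2" using KE[OF KK(2)] ..
        have eqs: "K = fst ` G1" "K' = fst ` G2" using G1 G2 by simp_all
        have "G1 \<subseteq> G2 \<or> G2 \<subseteq> G1" using ch G1 G2 by simp
        then show ?thesis unfolding eqs by (elim disjE) (simp_all only: image_mono simp_thms)
      qed
      fix K assume "K \<in> \<K>"
      from KE[OF this] obtain G1 where "G1 \<in> \<C> \<and> K = fst ` G1" ..
      then have G1: "G1 \<in> \<C>" "K = fst ` G1" by simp_all
      show "geodesic K \<gamma>" unfolding G1(2) using G[OF G1(1)] by (rule conjunct1)
      have "J0 \<subseteq> fst ` G1" using G[OF G1(1), THEN conjunct2] by (rule conjunct1)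
      then show "T0 \<in> K" unfolding G1(2) using T0(2) by (rule subsetD)
    qed
    moreover have "J0 \<subseteq> \<Union>\<K> \<and> (\<forall>t\<in>J0. \<gamma> t = \<gamma>0 t)"
    proof -
      obtain G1 where G1: "G1 \<in> \<C>" using \<C>(1) by blast
      then have "fst ` G1 \<subseteq> \<Union>\<K>" unfolding \<K>_def by (intro Union_upper imageI)
      with G[OF G1, THEN conjunct2, THEN conjunct1] have "J0 \<subseteq> \<Union>\<K>" by (rule subset_trans)
      moreover have "\<forall>t\<in>J0. \<gamma> t = \<gamma>0 t" using G[OF G1, THEN conjunct2] by (rule conjunct2)
      ultimately show ?thesis ..
    qed
    moreover have "\<Union>\<C> = graph (\<Union>\<K>) \<gamma>"
    proof
      show "\<Union>\<C> \<subseteq> graph (\<Union>\<K>) \<gamma>"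
      proof
        fix p assume p: "p \<in> \<Union>\<C>"
        obtain t y where ty: "p = (t, y)" by (cases p)
        have "(t, y) \<in> \<Union>\<C>" using p unfolding ty .
        then have yt: "\<gamma> t = y" by (rule \<gamma>)
        from p obtain G1 where G1: "p \<in> G1" "G1 \<in> \<C>" by (rule UnionE)
        have "fst p \<in> fst ` G1" using G1(1) by (rule imageI)
        then have "t \<in> fst ` G1" unfolding ty fst_conv .
        moreover have "fst ` G1 \<in> \<K>" unfolding \<K>_def using G1(2) by (rule imageI)
        ultimately have "t \<in> \<Union>\<K>" by (rule UnionI[rotated])
        then have "(t, \<gamma> t) \<in> graph (\<Union>\<K>) \<gamma>" unfolding graph_def by (rule imageI)
        then show "p \<in> graph (\<Union>\<K>) \<gamma>" unfolding ty yt .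
      qed
      show "graph (\<Union>\<K>) \<gamma> \<subseteq> \<Union>\<C>"
      proof
        fix p assume "p \<in> graph (\<Union>\<K>) \<gamma>"
        then obtain t where t: "p = (t, \<gamma> t)" "t \<in> \<Union>\<K>" unfolding graph_def by (rule imageE)
        from t(2) obtain K where K: "K \<in> \<K>" "t \<in> K" ..
        from KE[OF K(1)] obtain G1 where G1: "G1 \<in> \<C> \<and> K = fst ` G1" ..
        then have "t \<in> fst ` G1" using K(2) by simp
        then obtain r where r: "r \<in> G1" "t = fst r" by (rule imageE)
        have "(t, snd r) \<in> G1" unfolding r(2) prod.collapse by (rule r(1))
        with G1[THEN conjunct1] have y: "(t, snd r) \<in> \<Union>\<C>" by (rule UnionI)
        show "p \<in> \<Union>\<C>" unfolding t(1) \<gamma>[OF y] by (rule y)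
      qed
    qed
    ultimately show "\<Union>\<C> \<in> \<G>" unfolding \<G>_def by blast
  qed
  then obtain M where M: "M \<in> \<G>" "\<forall>X\<in>\<G>. M \<subseteq> X \<longrightarrow> X = M" ..
  from M(1) have "\<exists>J \<gamma>. M = graph J \<gamma> \<and> geodesic J \<gamma> \<and> J0 \<subseteq> J \<and> (\<forall>t\<in>J0. \<gamma> t = \<gamma>0 t)"
    unfolding \<G>_def by (rule CollectD)
  then obtain J \<gamma> where MJ: "M = graph J \<gamma>" and J: "geodesic J \<gamma>" "J0 \<subseteq> J" "\<forall>t\<in>J0. \<gamma> t = \<gamma>0 t"
    by (elim exE conjE) (rule that)
  have "maximal_geodesic J \<gamma>"
    unfolding maximal_geodesic_def
  proof (intro conjI J(1) notI)
    assume "\<exists>J' \<gamma>'. J \<subset> J' \<and> geodesic J' \<gamma>' \<and> (\<forall>t\<in>J. \<gamma>' t = \<gamma> t)"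
    then obtain J' \<gamma>' where J': "J \<subset> J'" "geodesic J' \<gamma>'" "\<forall>t\<in>J. \<gamma>' t = \<gamma> t" by blast
    have "J0 \<subseteq> J'" using J(2) J'(1) by blast
    moreover have "\<forall>t\<in>J0. \<gamma>' t = \<gamma>0 t" using J(2,3) J'(3) by (simp add: subset_iff)
    ultimately have "graph J' \<gamma>' \<in> \<G>"
      unfolding \<G>_def by (intro CollectI exI[of _ J'] exI[of _ \<gamma>'] conjI refl J'(2))
    moreover have "M \<subseteq> graph J' \<gamma>'"
    proof
      fix p assume "p \<in> M"
      then obtain t where t: "p = (t, \<gamma> t)" "t \<in> J" unfolding MJ graph_def by (rule imageE)
      have "(t, \<gamma>' t) \<in> graph J' \<gamma>'" unfolding graph_def using t(2) J'(1) by (intro imageI) blast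
      then show "p \<in> graph J' \<gamma>'" unfolding t(1) J'(3)[rule_format, OF t(2)] .
    qed
    ultimately have "graph J' \<gamma>' = graph J \<gamma>" using M(2) unfolding MJ by blast
    then have "fst ` graph J' \<gamma>' = fst ` graph J \<gamma>" by simp
    then show False using J'(1) by (simp add: graph_def image_image)
  qed
  then show thesis by (rule that[OF _ J(2) J(3)[rule_format]])
qed

lemma minimizer_geodesic:
  assumes \<gamma>: "gauge_lipschitz c {0..T} \<gamma>" and T: "0 < T" and c: "0 < c"
    and min: "cc_dist (\<gamma> 0) (\<gamma> T) = c * T"
  shows "geodesic {0..T} \<gamma>"
proof -
  have sub: "\<exists>u. is_control a b \<gamma> u \<and> (AE t in lebesgue_on {a..b}. norm (u t) = c) \<and> minimizing a b \<gamma>"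
    if ab: "a < b" "{a..b} \<subseteq> {0..T}" for a b
  proof -
    have "0 \<le> a" "b \<le> T" using ab by auto
    then have "cc_dist (\<gamma> a) (\<gamma> b) = c * (b - a)"
      using minimal_subcurve[OF \<gamma>, of a b] min ab(1) by simp
    then obtain u where "is_control a b \<gamma> u" "AE t in lebesgue_on {a..b}. norm (u t) = c" "minimizing a b \<gamma>"
      by (rule minimal_control[OF gauge_lipschitz_subset[OF \<gamma> ab(2)] _ ab(1)]) blast
    then show ?thesis by blast
  qed
  have "\<not> \<gamma> constant_on {0..T}"
  proof
    assume "\<gamma> constant_on {0..T}"
    then have "\<gamma> 0 = \<gamma> T" using T unfolding constant_on_def by auto
    moreover have "joins 0 (\<gamma> 0) (\<gamma> 0)" using gauge_lipschitz_mem[OF \<gamma>, of 0] T by (intro joins_refl) auto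
    ultimately have "c * T \<le> 0" using cc_dist_le min by metis
    then show False using T c by (simp add: mult_le_0_iff)
  qed
  moreover have "\<exists>c. \<forall>t\<in>{0..T}. 0 < t \<longrightarrow>
      (\<exists>u. is_control 0 t \<gamma> u \<and> (AE s in lebesgue_on {0..t}. norm (u s) = c))"
  proof (intro exI[of _ c] ballI impI)
    fix t assume "t \<in> {0..T}" "0 < t"
    then show "\<exists>u. is_control 0 t \<gamma> u \<and> (AE s in lebesgue_on {0..t}. norm (u s) = c)"
      using sub[of 0 t] by auto
  qed
  moreover have "\<exists>\<epsilon>>0. \<forall>a b. a < b \<and> {a..b} \<subseteq> {0..T} \<inter> {t - \<epsilon>..t + \<epsilon>} \<longrightarrow> minimizing a b \<gamma>" for t
    using sub by (intro exI[of _ 1]) auto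
  ultimately show ?thesis
    unfolding geodesic_def using T by (intro conjI ballI) (simp_all add: is_interval_cc)
qed

text \<open>If two positions of \<open>x\<close> are orthogonal to \<open>z\<close>, their wedge
  kills \<open>z\<close>. The gauge bound then makes the increments of \<open>Y *v z\<close>
  quadratic in time, so its derivative is 0.\<close>

lemma gauge_lipschitz_snd_orthogonal:
  assumes \<gamma>: "gauge_lipschitz c {0..T} \<gamma>" and \<gamma>0: "\<gamma> 0 = 0" and T: "0 \<le> T"
    and z: "\<And>t. t \<in> {0..T} \<Longrightarrow> fst (\<gamma> t) \<bullet> z = 0"
  shows "snd (\<gamma> T) *v z = 0"
proof -
  define f where "f t = snd (\<gamma> t) *v z" for t
  have "linear (\<lambda>A :: real ^ 'a ^ 'a. A *v z)"
    by (rule linearI) (simp_all add: matrix_vector_mult_add_rdistrib scaleR_matrix_vector_assoc)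
  then obtain K where K: "0 < K" "\<And>A :: real ^ 'a ^ 'a. norm (A *v z) \<le> K * norm A"
    using linear_bounded_pos by blast
  have le: "norm (f t - f s) \<le> K * c\<^sup>2 * \<bar>t - s\<bar> * \<bar>t - s\<bar>" if "s \<in> {0..T}" "t \<in> {0..T}" for s t
  proof -
    have "f t - f s = (snd (\<gamma> t) - snd (\<gamma> s) - (1/2) *\<^sub>R wedge (fst (\<gamma> s)) (fst (\<gamma> t))) *v z"
      using z[OF that(1)] z[OF that(2)]
      by (simp add: f_def matrix_vector_mult_diff_rdistrib wedge_vector_mult scaleR_matrix_vector_assoc[symmetric])
    then have "norm (f t - f s) \<le> K * norm (snd (\<gamma> t) - snd (\<gamma> s) - (1/2) *\<^sub>R wedge (fst (\<gamma> s)) (fst (\<gamma> t)))"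
      using K(2) by simp
    also have "\<dots> \<le> K * (c * \<bar>t - s\<bar>)\<^sup>2"
      using \<gamma> that K(1) unfolding gauge_lipschitz_def gauge_le_def by (intro mult_left_mono) auto
    finally show ?thesis by (simp add: power2_eq_square mult_ac)
  qed
  have "(f has_vector_derivative 0) (at t within {0..T})" if t: "t \<in> {0..T}" for t
    unfolding has_vector_derivative_def has_derivative_within_alt
  proof (intro conjI allI impI)
    fix e :: real assume e: "0 < e"
    have pos: "0 < K * c\<^sup>2 + 1" using K(1) by (intro add_nonneg_pos mult_nonneg_nonneg) auto
    have "norm (f s - f t - (s - t) *\<^sub>R 0) \<le> e * norm (s - t)"
      if "s \<in> {0..T}" "norm (s - t) < e / (K * c\<^sup>2 + 1)" for s
    proof -
      have "norm (f s - f t - (s - t) *\<^sub>R 0) \<le> K * c\<^sup>2 * \<bar>s - t\<bar> * \<bar>s - t\<bar>" using le[OF t that(1)] by simp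
      also have "\<dots> \<le> e * \<bar>s - t\<bar>"
      proof (rule mult_right_mono)
        have "K * c\<^sup>2 * \<bar>s - t\<bar> \<le> (K * c\<^sup>2 + 1) * \<bar>s - t\<bar>" by (intro mult_right_mono) auto
        also have "\<dots> \<le> e" using that(2) pos by (simp add: pos_less_divide_eq mult.commute)
        finally show "K * c\<^sup>2 * \<bar>s - t\<bar> \<le> e" .
      qed simp
      finally show ?thesis by simp
    qed
    then show "\<exists>d>0. \<forall>y\<in>{0..T}. norm (y - t) < d \<longrightarrow> norm (f y - f t - (y - t) *\<^sub>R 0) \<le> e * norm (y - t)"
      using e pos by (intro exI[of _ "e / (K * c\<^sup>2 + 1)"]) auto
  qed simp
  then obtain d where "\<And>t. t \<in> {0..T} \<Longrightarrow> f t = d"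
    using has_vector_derivative_zero_constant[of "{0..T}" f] by auto
  then have "f T = f 0" using T by simp
  then show ?thesis by (simp add: f_def \<gamma>0)
qed

lemma C_set_subset_cut_locus: "(C_set :: ('k::finite) point set) \<subseteq> cut_locus"
proof
  fix q :: "'k point" assume "q \<in> C_set"
  then obtain x Y M where q: "q = (x, Y)" "q \<in> carnot_group" "Y \<noteq> 0"
    and M: "orthogonal_matrix M" "M \<noteq> mat 1" "M *v x = x" "M ** Y ** transpose M = Y"
      "\<And>v. Y *v v = 0 \<Longrightarrow> M *v v = v"
    unfolding C_set_def by blast
  define d where "d = cc_dist 0 q"
  obtain r where "joins r 0 q" using joins_exists[OF q(2)] by blast
  then have jd: "joins d 0 q" unfolding d_def by (rule joins_cc_dist)
  then obtain \<gamma>0 where \<gamma>0: "gauge_lipschitz 1 {0..d} \<gamma>0" "\<gamma>0 0 = 0" "\<gamma>0 d = q" and "0 \<le> d"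
    unfolding joins_def by blast
  have d: "0 < d"
  proof (rule ccontr)
    assume "\<not> 0 < d"
    then have "d = 0" using \<open>0 \<le> d\<close> by simp
    then have "q = 0" using \<gamma>0 by simp
    then show False using q(1,3) by (simp add: zero_prod_def)
  qed
  have min0: "cc_dist (\<gamma>0 0) (\<gamma>0 d) = 1 * d" using \<gamma>0 by (simp add: d_def)
  have g0: "geodesic {0..d} \<gamma>0" by (rule minimizer_geodesic[OF \<gamma>0(1) d _ min0]) simp
  obtain J \<gamma> where J: "maximal_geodesic J \<gamma>" "{0..d} \<subseteq> J" "\<And>t. t \<in> {0..d} \<Longrightarrow> \<gamma> t = \<gamma>0 t"
    by (rule maximal_geodesic_extension[OF g0 d]) (use d in auto)
  have \<gamma>_0: "\<gamma> 0 = 0" and \<gamma>_d: "\<gamma> d = q" using J(3) d \<gamma>0 by simp_all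
  have "t \<le> d" if t: "0 < t" "t \<in> J" "geodesic {0..t} \<gamma>" "minimizing 0 t \<gamma>" for t
  proof (rule ccontr)
    assume "\<not> t \<le> d"
    then have dt: "d < t" by simp
    obtain c where "\<forall>T\<in>{0..t}. 0 < T \<longrightarrow>
        (\<exists>u. is_control 0 T \<gamma> u \<and> (AE s in lebesgue_on {0..T}. norm (u s) = c))"
      using t(3) unfolding geodesic_def by blast
    then obtain u where u: "is_control 0 t \<gamma> u" "AE s in lebesgue_on {0..t}. norm (u s) = c"
      using t(1) by force
    note gl = unit_speed_control_gauge_lipschitz[OF u]
    have "curve_length 0 t \<gamma> = c * t" using gl(2) t(1) by simp
    then have min: "cc_dist (\<gamma> 0) (\<gamma> t) = c * (t - 0)" using t(4) by (simp add: minimizing_def)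
    have "cc_dist (\<gamma> 0) (\<gamma> d) = c * (d - 0)"
      by (rule minimal_subcurve[OF gl(1) min]) (use d dt in auto)
    then have "cc_dist 0 q = c * d" by (simp add: \<gamma>_0 \<gamma>_d)
    then have "d = c * d" unfolding d_def[symmetric] .
    then have c: "c = 1" using d by simp
    \<comment> \<open>The image under \<open>M\<close> up to time \<open>d\<close>, the original
      curve afterwards. It is again a minimizer to \<open>\<gamma> t\<close>, because
      \<open>M\<close> preserves the gauge and fixes both \<open>0\<close> and
      \<open>q\<close>.\<close>
    define \<eta> where "\<eta> s = (if s \<le> d then point_conj M (\<gamma> s) else \<gamma> s)" for s
    have Mq: "point_conj M q = q" by (simp add: point_conj_def q(1) M(3,4))
    have "gauge_lipschitz c {0..d} (\<lambda>s. point_conj M (\<gamma> s))"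
      using gauge_lipschitz_subset[OF gl(1), of "{0..d}"] dt
      by (auto simp: gauge_lipschitz_def intro!: point_conj_carnot_group gauge_le_point_conj[OF M(1)])
    then have "gauge_lipschitz c {0..d} \<eta>"
      by (subst gauge_lipschitz_cong[of _ _ "\<lambda>s. point_conj M (\<gamma> s)"]) (auto simp: \<eta>_def)
    moreover have "gauge_lipschitz c {d..t} \<gamma>" using gauge_lipschitz_subset[OF gl(1), of "{d..t}"] d by simp
    then have "gauge_lipschitz c {d..t} \<eta>"
      by (subst gauge_lipschitz_cong[of _ _ \<gamma>]) (auto simp: \<eta>_def \<gamma>_d Mq)
    ultimately have \<eta>: "gauge_lipschitz c {0..t} \<eta>" by (rule gauge_lipschitz_join)
    have \<eta>0: "\<eta> 0 = 0" using d by (simp add: \<eta>_def point_conj_def \<gamma>_0 zero_prod_def matrix_vector_mult_0_right)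
    have fixM: "fst (\<gamma> s) = M *v fst (\<gamma> s)" if s: "s \<in> {0..d}" for s
    proof -
      have "fst (\<gamma> s) = fst (\<eta> s)"
      proof (rule minimizers_do_not_branch[OF gl(1) \<gamma>_0 _ \<eta> \<eta>0 _ _ less_imp_le[OF d] dt])
        show "cc_dist 0 (\<gamma> t) = c * t" using min by (simp add: \<gamma>_0)
        then show "cc_dist 0 (\<eta> t) = c * t" using dt by (simp add: \<eta>_def)
        show "0 < c" by (simp add: c)
        show "\<gamma> r = \<eta> r" if "r \<in> {d..t}" for r
          using that by (cases "r = d") (simp_all add: \<eta>_def \<gamma>_d Mq)
        show "s \<in> {0..t}" using s dt by simp
      qed
      then show ?thesis using s by (simp add: \<eta>_def point_conj_def)
    qed
    define F where "F = {v. M *v v = v}"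
    have "subspace F"
      unfolding F_def subspace_def by (simp add: matrix_vector_right_distrib matrix_vector_mult_scaleR)
    \<comment> \<open>A vector orthogonal to the fixed space of \<open>M\<close> is orthogonal to
      the curve, hence lies in \<open>ker Y\<close>, which \<open>M\<close> fixes pointwise; so it
      is orthogonal to itself.\<close>
    have orth: "z = 0" if z: "\<And>w. w \<in> F \<Longrightarrow> orthogonal z w" for z
    proof -
      have "snd (\<gamma> d) *v z = 0"
      proof (rule gauge_lipschitz_snd_orthogonal[OF gauge_lipschitz_subset[OF gl(1)] \<gamma>_0])
        show "fst (\<gamma> s) \<bullet> z = 0" if "s \<in> {0..d}" for s
          using z[of "fst (\<gamma> s)"] fixM[OF that] by (simp add: F_def orthogonal_def inner_commute)
      qed (use d dt in auto)
      then have "M *v z = z" using M(5) by (simp add: \<gamma>_d q(1))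
      then show "z = 0" using z[of z] by (simp add: F_def orthogonal_def)
    qed
    have "M *v v = v" for v
    proof -
      obtain y z where yz: "y \<in> span F" "\<And>w. w \<in> span F \<Longrightarrow> orthogonal z w" "v = y + z"
        using orthogonal_subspace_decomp_exists[of F v] by blast
      have "z = 0" by (rule orth) (use yz(2) in \<open>auto intro: span_base\<close>)
      then have "v \<in> F" using yz(1,3) \<open>subspace F\<close> by (simp add: span_eq_iff[THEN iffD2])
      then show ?thesis by (simp add: F_def)
    qed
    then have "M = mat 1" by (simp add: matrix_eq)
    then show False using M(2) by simp
  qed
  moreover have "geodesic {0..d} \<gamma>" by (rule geodesic_cong[OF g0]) (simp add: J(3))
  moreover have "minimizing 0 d \<gamma>"
  proof -
    obtain u where "minimizing 0 d \<gamma>0" by (rule minimal_control[OF \<gamma>0(1)]) (use min0 d in auto)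
    then show ?thesis using minimizing_cong[of 0 d \<gamma> \<gamma>0] J(3) d by simp
  qed
  \<comment> \<open>Minimality on \<open>{0..d}\<close> puts \<open>d\<close> into the set of the
    supremum, and no larger time belongs to it.\<close>
  ultimately have "cut_time J \<gamma> = ereal d"
    unfolding cut_time_def using d J(2)
    by (intro antisym Sup_least Sup_upper) (auto intro!: imageI)
  moreover have "d \<in> J" using J(2) d by auto
  ultimately show "q \<in> cut_locus"
    unfolding cut_locus_def using J(1) \<gamma>_0 \<gamma>_d by blast
qed

section \<open>Rational parametrizations\<close>

text \<open>One quotient for all of \<open>U\<close>, with a denominator free of zeros there, turns
  conditions on \<open>f\<close> into polynomial ones: \<open>f = 0\<close> reads
  \<open>p = 0\<close> and \<open>f > 0\<close> reads \<open>p * q > 0\<close>.\<close>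

definition rational_on :: "'a::real_normed_vector set \<Rightarrow> ('a \<Rightarrow> real) \<Rightarrow> bool" where
  "rational_on U f \<longleftrightarrow> (\<exists>p q. real_polynomial_function p \<and> real_polynomial_function q \<and>
     (\<forall>z\<in>U. q z \<noteq> 0 \<and> f z = p z / q z))"

lemma rational_on_polynomial: "real_polynomial_function f \<Longrightarrow> rational_on U f"
  unfolding rational_on_def by (rule exI[of _ f], rule exI[of _ "\<lambda>_. 1"]) auto

lemma rational_on_const: "rational_on U (\<lambda>_. c)"
  by (rule rational_on_polynomial) auto

lemma rational_on_linear: "bounded_linear f \<Longrightarrow> rational_on U f"
  by (rule rational_on_polynomial) auto

lemma rational_on_add:
  assumes "rational_on U f" "rational_on U g"
  shows "rational_on U (\<lambda>z. f z + g z)"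
proof -
  obtain p q p' q' where pq: "real_polynomial_function p" "real_polynomial_function q"
    "\<forall>z\<in>U. q z \<noteq> 0 \<and> f z = p z / q z" "real_polynomial_function p'" "real_polynomial_function q'"
    "\<forall>z\<in>U. q' z \<noteq> 0 \<and> g z = p' z / q' z"
    using assms unfolding rational_on_def by blast
  show ?thesis
    unfolding rational_on_def
  proof (rule exI[of _ "\<lambda>z. p z * q' z + p' z * q z"], rule exI[of _ "\<lambda>z. q z * q' z"], intro conjI ballI)
    show "real_polynomial_function (\<lambda>z. p z * q' z + p' z * q z)" "real_polynomial_function (\<lambda>z. q z * q' z)"
      using pq by auto
    fix z assume "z \<in> U"
    then show "q z * q' z \<noteq> 0" "f z + g z = (p z * q' z + p' z * q z) / (q z * q' z)"
      using pq by (simp_all add: add_frac_eq)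
  qed
qed

lemma rational_on_mult:
  assumes "rational_on U f" "rational_on U g"
  shows "rational_on U (\<lambda>z. f z * g z)"
proof -
  obtain p q p' q' where pq: "real_polynomial_function p" "real_polynomial_function q"
    "\<forall>z\<in>U. q z \<noteq> 0 \<and> f z = p z / q z" "real_polynomial_function p'" "real_polynomial_function q'"
    "\<forall>z\<in>U. q' z \<noteq> 0 \<and> g z = p' z / q' z"
    using assms unfolding rational_on_def by blast
  show ?thesis
    unfolding rational_on_def
  proof (rule exI[of _ "\<lambda>z. p z * p' z"], rule exI[of _ "\<lambda>z. q z * q' z"], intro conjI ballI)
    show "real_polynomial_function (\<lambda>z. p z * p' z)" "real_polynomial_function (\<lambda>z. q z * q' z)"
      using pq by auto
    fix z assume "z \<in> U"
    then show "q z * q' z \<noteq> 0" "f z * g z = (p z * p' z) / (q z * q' z)"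
      using pq by simp_all
  qed
qed

lemma rational_on_divide:
  assumes "rational_on U f" "rational_on U g" "\<And>z. z \<in> U \<Longrightarrow> g z \<noteq> 0"
  shows "rational_on U (\<lambda>z. f z / g z)"
proof -
  obtain p q where pq: "real_polynomial_function p" "real_polynomial_function q"
    "\<forall>z\<in>U. q z \<noteq> 0 \<and> g z = p z / q z"
    using assms unfolding rational_on_def by blast
  have "\<forall>z\<in>U. p z \<noteq> 0 \<and> 1 / g z = q z / p z" using pq(3) assms(3) by auto
  then have "rational_on U (\<lambda>z. 1 / g z)" unfolding rational_on_def using pq(1,2) by blast
  from rational_on_mult[OF assms(1) this] show ?thesis by simp
qed

lemma rational_on_minus: "rational_on U f \<Longrightarrow> rational_on U (\<lambda>z. - f z)"
  using rational_on_mult[OF rational_on_const[of U "-1"], of f] by simp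

lemma rational_on_diff: "rational_on U f \<Longrightarrow> rational_on U g \<Longrightarrow> rational_on U (\<lambda>z. f z - g z)"
  using rational_on_add[OF _ rational_on_minus, of U f g] by simp

lemma rational_on_sum:
  assumes "\<And>i. i \<in> I \<Longrightarrow> rational_on U (f i)"
  shows "rational_on U (\<lambda>z. \<Sum>i\<in>I. f i z)"
  using assms
proof (induction I rule: infinite_finite_induct)
  case (insert i I)
  then show ?case by (simp add: rational_on_add)
qed (simp_all add: rational_on_const)

lemma rational_on_prod:
  assumes "\<And>i. i \<in> I \<Longrightarrow> rational_on U (f i)"
  shows "rational_on U (\<lambda>z. \<Prod>i\<in>I. f i z)"
  using assms
proof (induction I rule: infinite_finite_induct)
  case (insert i I)
  then show ?case by (simp add: rational_on_mult)
qed (simp_all add: rational_on_const)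

lemma rational_on_continuous:
  assumes "rational_on U f"
  shows "continuous_on U f"
proof -
  obtain p q where pq: "real_polynomial_function p" "real_polynomial_function q"
    "\<forall>z\<in>U. q z \<noteq> 0 \<and> f z = p z / q z"
    using assms unfolding rational_on_def by blast
  have "continuous_on U p" "continuous_on U q"
    using pq(1,2) by (simp_all add: continuous_on_polymonial_function real_polynomial_function_eq)
  then have "continuous_on U (\<lambda>z. p z / q z)" using pq(3) by (intro continuous_intros) auto
  then show ?thesis using pq(3) by (simp cong: continuous_on_cong)
qed

definition rational_map_on :: "'a::real_normed_vector set \<Rightarrow> ('a \<Rightarrow> 'b::euclidean_space) \<Rightarrow> bool" where
  "rational_map_on U h \<longleftrightarrow> (\<forall>b\<in>Basis. rational_on U (\<lambda>z. h z \<bullet> b))"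

lemma rational_on_compose_polynomial:
  fixes g :: "'a::real_normed_vector \<Rightarrow> 'b::euclidean_space"
  assumes "real_polynomial_function h" and g: "rational_map_on U g"
  shows "rational_on U (\<lambda>z. h (g z))"
  using assms(1)
proof induction
  case (linear h)
  interpret bounded_linear h by (rule linear)
  have "h (g z) = (\<Sum>b\<in>Basis. (g z \<bullet> b) * h b)" for z
  proof -
    have "h (g z) = h (\<Sum>b\<in>Basis. (g z \<bullet> b) *\<^sub>R b)" by (simp add: euclidean_representation)
    then show ?thesis by (simp only: sum scaleR real_scaleR_def)
  qed
  then show ?case
    using g by (auto simp: rational_map_on_def intro!: rational_on_sum rational_on_mult rational_on_const)
qed (auto intro: rational_on_const rational_on_add rational_on_mult)

lemma rational_on_compose:
  fixes g :: "'a::real_normed_vector \<Rightarrow> 'b::euclidean_space"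
  assumes h: "rational_on UNIV h" and g: "rational_map_on U g"
  shows "rational_on U (\<lambda>z. h (g z))"
proof -
  obtain p q where pq: "real_polynomial_function p" "real_polynomial_function q"
    "\<forall>z. q z \<noteq> 0 \<and> h z = p z / q z"
    using h unfolding rational_on_def by blast
  have "rational_on U (\<lambda>z. p (g z) / q (g z))"
    by (intro rational_on_divide rational_on_compose_polynomial[OF _ g] pq(1,2)) (use pq(3) in blast)
  then show ?thesis using pq(3) by simp
qed

lemma rational_map_on_linear: "bounded_linear h \<Longrightarrow> rational_map_on U h"
  unfolding rational_map_on_def
  by (intro ballI rational_on_linear bounded_linear_inner_left_comp)

lemma rational_map_on_continuous: "rational_map_on U h \<Longrightarrow> continuous_on U h"
  unfolding rational_map_on_def by (subst continuous_on_componentwise) (auto intro: rational_on_continuous)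

lemma semialgebraic_rational_eq_zero:
  assumes "semialgebraic U" "rational_on U f"
  shows "semialgebraic {z \<in> U. f z = 0}"
proof -
  obtain p q where pq: "real_polynomial_function p" "\<forall>z\<in>U. q z \<noteq> 0 \<and> f z = p z / q z"
    using assms(2) unfolding rational_on_def by blast
  have "{z \<in> U. f z = 0} = U \<inter> {z. p z = 0}" using pq(2) by auto
  then show ?thesis using semialgebraic.inter[OF assms(1) semialgebraic.eq_zero[OF pq(1)]] by simp
qed

lemma semialgebraic_rational_pos:
  assumes "semialgebraic U" "rational_on U f"
  shows "semialgebraic {z \<in> U. 0 < f z}"
proof -
  obtain p q where pq: "real_polynomial_function p" "real_polynomial_function q"
    "\<forall>z\<in>U. q z \<noteq> 0 \<and> f z = p z / q z"
    using assms(2) unfolding rational_on_def by blast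
  have "{z \<in> U. 0 < f z} = U \<inter> {z. p z * q z > 0}"
    using pq(3) by (auto simp: zero_less_divide_iff zero_less_mult_iff)
  moreover have "real_polynomial_function (\<lambda>z. p z * q z)" using pq by auto
  ultimately show ?thesis using semialgebraic.inter[OF assms(1) semialgebraic.pos] by simp
qed

lemma semialgebraic_Ball:
  assumes "finite I" "semialgebraic U" "\<And>i. i \<in> I \<Longrightarrow> semialgebraic {z \<in> U. P i z}"
  shows "semialgebraic {z \<in> U. \<forall>i\<in>I. P i z}"
  using assms(1,3)
proof (induction I)
  case empty
  then show ?case using assms(2) by simp
next
  case (insert i I)
  have "{z \<in> U. \<forall>j\<in>insert i I. P j z} = {z \<in> U. P i z} \<inter> {z \<in> U. \<forall>j\<in>I. P j z}" by auto
  then show ?case using insert by (simp add: semialgebraic.inter)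
qed

lemma semialgebraic_UNIV: "semialgebraic (UNIV :: 'a::euclidean_space set)"
  using semialgebraic.eq_zero[of "\<lambda>_ :: 'a. 0"] by auto

lemma semialgebraic_open_cube_vimage:
  fixes g :: "'a::euclidean_space \<Rightarrow> 'b::euclidean_space"
  assumes U: "semialgebraic U" and g: "rational_map_on U g" and B: "B \<subseteq> Basis"
  shows "semialgebraic {z \<in> U. g z \<in> open_cube B}"
proof -
  have gb: "rational_on U (\<lambda>z. g z \<bullet> b)" if "b \<in> Basis" for b using g that by (simp add: rational_map_on_def)
  have fin: "finite B" "finite (Basis - B)" using finite_subset[OF B finite_Basis] by simp_all
  have "semialgebraic {z \<in> U. \<forall>b\<in>B. 0 < g z \<bullet> b}"
    by (rule semialgebraic_Ball[OF fin(1) U], rule semialgebraic_rational_pos[OF U], rule gb, erule subsetD[OF B])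
  moreover have "semialgebraic {z \<in> U. \<forall>b\<in>B. 0 < 1 - g z \<bullet> b}"
    by (rule semialgebraic_Ball[OF fin(1) U], rule semialgebraic_rational_pos[OF U],
        rule rational_on_diff[OF rational_on_const], rule gb, erule subsetD[OF B])
  moreover have "semialgebraic {z \<in> U. \<forall>b\<in>Basis - B. g z \<bullet> b = 0}"
    by (rule semialgebraic_Ball[OF fin(2) U], rule semialgebraic_rational_eq_zero[OF U], rule gb, simp)
  ultimately have "semialgebraic ({z \<in> U. \<forall>b\<in>B. 0 < g z \<bullet> b} \<inter> ({z \<in> U. \<forall>b\<in>B. 0 < 1 - g z \<bullet> b}
      \<inter> {z \<in> U. \<forall>b\<in>Basis - B. g z \<bullet> b = 0}))"
    by (intro semialgebraic.inter)
  moreover have "{z \<in> U. \<forall>b\<in>B. 0 < g z \<bullet> b} \<inter> ({z \<in> U. \<forall>b\<in>B. 0 < 1 - g z \<bullet> b}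
      \<inter> {z \<in> U. \<forall>b\<in>Basis - B. g z \<bullet> b = 0}) = {z \<in> U. g z \<in> open_cube B}"
    by (auto simp: open_cube_def)
  ultimately show ?thesis by simp
qed

lemma semialgebraic_rational_eq:
  fixes g h :: "'a::euclidean_space \<Rightarrow> 'b::euclidean_space"
  assumes U: "semialgebraic U" and g: "rational_map_on U g" and h: "rational_map_on U h"
  shows "semialgebraic {z \<in> U. g z = h z}"
proof -
  have "semialgebraic {z \<in> U. \<forall>b\<in>Basis. g z \<bullet> b - h z \<bullet> b = 0}"
  proof (rule semialgebraic_Ball[OF finite_Basis U])
    fix b :: 'b assume "b \<in> Basis"
    then have "rational_on U (\<lambda>z. g z \<bullet> b - h z \<bullet> b)"
      using g h by (intro rational_on_diff) (auto simp: rational_map_on_def)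
    then show "semialgebraic {z \<in> U. g z \<bullet> b - h z \<bullet> b = 0}" by (rule semialgebraic_rational_eq_zero[OF U])
  qed
  moreover have "{z \<in> U. \<forall>b\<in>Basis. g z \<bullet> b - h z \<bullet> b = 0} = {z \<in> U. g z = h z}"
    by (auto simp: euclidean_eq_iff[where 'a = 'b])
  ultimately show ?thesis by simp
qed

text \<open>
  With a rational left inverse \<open>g\<close> at hand the image of \<open>f\<close> is described without quantifiers,
  as \<open>{z. g z \<in> open_cube B \<and> f (g z) = z}\<close>; no quantifier elimination is needed.
\<close>

lemma semialgebraic_cell_rational:
  fixes f g :: "'a::euclidean_space \<Rightarrow> 'a"
  assumes U: "semialgebraic U" and g: "rational_map_on U g" and f: "rational_map_on UNIV f"
    and B: "B \<subseteq> Basis"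
    and fU: "\<And>t. t \<in> open_cube B \<Longrightarrow> f t \<in> U" and gf: "\<And>t. t \<in> open_cube B \<Longrightarrow> g (f t) = t"
  shows "semialgebraic_cell (card B) (f ` open_cube B)"
proof -
  let ?S = "f ` open_cube B"
  have S: "?S = {z \<in> U. g z \<in> open_cube B} \<inter> {z \<in> U. f (g z) = z}"
  proof
    show "?S \<subseteq> {z \<in> U. g z \<in> open_cube B} \<inter> {z \<in> U. f (g z) = z}" using fU gf by auto
    show "{z \<in> U. g z \<in> open_cube B} \<inter> {z \<in> U. f (g z) = z} \<subseteq> ?S"
    proof
      fix z assume "z \<in> {z \<in> U. g z \<in> open_cube B} \<inter> {z \<in> U. f (g z) = z}"
      then have "g z \<in> open_cube B" "z = f (g z)" by simp_all
      then show "z \<in> ?S" by (rule image_eqI[rotated])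
    qed
  qed
  have "rational_map_on U (\<lambda>z. f (g z))"
    unfolding rational_map_on_def[of _ "\<lambda>z. f (g z)"]
  proof
    fix b :: 'a assume "b \<in> Basis"
    then have "rational_on UNIV (\<lambda>t. f t \<bullet> b)" using f by (simp add: rational_map_on_def)
    then show "rational_on U (\<lambda>z. f (g z) \<bullet> b)" by (rule rational_on_compose[OF _ g])
  qed
  then have "semialgebraic {z \<in> U. f (g z) = z}"
    by (rule semialgebraic_rational_eq[OF U _ rational_map_on_linear[OF bounded_linear_ident]])
  then have sS: "semialgebraic ?S"
    unfolding S by (intro semialgebraic.inter semialgebraic_open_cube_vimage[OF U g B])
  have hom: "homeomorphism (open_cube B) ?S f g"
    unfolding homeomorphism_def
  proof (intro conjI ballI)
    show "continuous_on (open_cube B) f"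
      by (rule continuous_on_subset[OF rational_map_on_continuous[OF f] subset_UNIV])
    show "continuous_on ?S g"
      by (rule continuous_on_subset[OF rational_map_on_continuous[OF g]]) (use fU in auto)
    have "g ` ?S = (\<lambda>t. t) ` open_cube B" unfolding image_image by (rule image_cong[OF refl gf])
    then show "g ` ?S = open_cube B" by simp
  qed (use gf in auto)
  have ffst: "rational_map_on UNIV (\<lambda>w :: 'a \<times> 'a. f (fst w))"
    unfolding rational_map_on_def[of _ "\<lambda>w. f (fst w)"]
  proof
    fix b :: 'a assume "b \<in> Basis"
    then have "rational_on UNIV (\<lambda>t. f t \<bullet> b)" using f by (simp add: rational_map_on_def)
    then show "rational_on UNIV (\<lambda>w :: 'a \<times> 'a. f (fst w) \<bullet> b)"
      by (rule rational_on_compose[OF _ rational_map_on_linear[OF bounded_linear_fst]])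
  qed
  have "semialgebraic ({w :: 'a \<times> 'a. w \<in> UNIV \<and> fst w \<in> open_cube B} \<inter> {w. w \<in> UNIV \<and> f (fst w) = snd w})"
    by (rule semialgebraic.inter
        [OF semialgebraic_open_cube_vimage[OF semialgebraic_UNIV rational_map_on_linear[OF bounded_linear_fst] B]
          semialgebraic_rational_eq[OF semialgebraic_UNIV ffst rational_map_on_linear[OF bounded_linear_snd]]])
  moreover have "{w :: 'a \<times> 'a. w \<in> UNIV \<and> fst w \<in> open_cube B} \<inter> {w. w \<in> UNIV \<and> f (fst w) = snd w}
      = (\<lambda>t. (t, f t)) ` open_cube B"
    by (auto simp: image_iff)
  ultimately have "semialgebraic ((\<lambda>t. (t, f t)) ` open_cube B)" by simp
  then show ?thesis
    unfolding semialgebraic_cell_def using sS hom B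
    by (intro conjI exI[of _ B] exI[of _ f] exI[of _ g] refl)
qed

section \<open>Determinants, Cramer inverses and coordinates of points\<close>

lemma rational_on_det:
  fixes M :: "'a::real_normed_vector \<Rightarrow> real ^ 'n::finite ^ 'n"
  assumes "\<And>i j. rational_on U (\<lambda>z. M z $ i $ j)"
  shows "rational_on U (\<lambda>z. det (M z))"
  unfolding det_def by (intro rational_on_sum rational_on_mult rational_on_const rational_on_prod assms)

text \<open>An explicit formula instead of \<open>matrix_inv\<close>, which is given by choice:
  rationality in the entries has to be visible.\<close>

definition cramer_inv :: "real ^ 'n::finite ^ 'n \<Rightarrow> real ^ 'n ^ 'n" where
  "cramer_inv A = (\<chi> i j. det (\<chi> a b. if b = i then (if a = j then 1 else 0) else A $ a $ b) / det A)"

lemma cramer_inv_right: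
  assumes "det A \<noteq> 0"
  shows "A ** cramer_inv A = mat 1"
proof -
  have "A *v (\<chi> i. cramer_inv A $ i $ j) = axis j 1" for j
    using cramer[OF assms, of "\<chi> i. cramer_inv A $ i $ j" "axis j 1"]
    by (simp add: cramer_inv_def axis_def eq_commute[of j] cong: if_cong)
  then have "(A ** cramer_inv A) $ i $ j = mat 1 $ i $ j" for i j
    by (simp add: vec_eq_iff matrix_matrix_mult_def matrix_vector_mult_def axis_def mat_def)
  then show ?thesis by (simp add: vec_eq_iff)
qed

lemma cramer_inv_left: "det A \<noteq> 0 \<Longrightarrow> cramer_inv A ** A = mat 1"
  using cramer_inv_right matrix_left_right_inverse by blast

lemma rational_on_cramer_inv:
  fixes M :: "'a::real_normed_vector \<Rightarrow> real ^ 'n::finite ^ 'n"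
  assumes M: "\<And>i j. rational_on U (\<lambda>z. M z $ i $ j)" and d: "\<And>z. z \<in> U \<Longrightarrow> det (M z) \<noteq> 0"
  shows "rational_on U (\<lambda>z. cramer_inv (M z) $ i $ j)"
proof -
  have "rational_on U (\<lambda>z. det (\<chi> a b. if b = i then (if a = j then 1 else 0) else M z $ a $ b) / det (M z))"
  proof (intro rational_on_divide rational_on_det M d)
    fix a b
    show "rational_on U (\<lambda>z. (\<chi> a b. if b = i then (if a = j then 1 else 0) else M z $ a $ b) $ a $ b)"
      using M[of a b] rational_on_const[of U 0] rational_on_const[of U 1] by (cases "b = i"; cases "a = j") simp_all
  qed
  then show ?thesis by (simp add: cramer_inv_def)
qed

text \<open>A kernel vector satisfies \<open>v = - X *v v\<close>, and skewness makes
  \<open>v \<bullet> (X *v v)\<close> vanish, so \<open>v\<close> has length 0.\<close>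

lemma det_one_plus_skew:
  fixes X :: "real ^ 'n::finite ^ 'n"
  assumes "transpose X = - X"
  shows "det (mat 1 + X) \<noteq> 0"
proof
  assume "det (mat 1 + X) = 0"
  then obtain v where v: "v \<noteq> 0" "(mat 1 + X) *v v = 0"
    using matrix_left_invertible_ker[of "mat 1 + X"] invertible_det_nz[of "mat 1 + X"]
      invertible_left_inverse[of "mat 1 + X"] by blast
  have "v \<bullet> (X *v v) = 0"
  proof -
    have "v \<bullet> (X *v v) = (transpose X *v v) \<bullet> v"
      by (metis dot_lmul_matrix transpose_matrix_vector)
    also have "transpose X *v v = - (X *v v)"
      unfolding assms by (simp add: vec_eq_iff matrix_vector_mult_def sum_negf)
    finally show ?thesis by (simp add: inner_commute)
  qed
  moreover have "v + X *v v = 0" using v(2) by (simp add: matrix_vector_mult_add_rdistrib)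
  then have "v \<bullet> v + v \<bullet> (X *v v) = 0" by (metis inner_add_right inner_zero_right)
  ultimately show False using v(1) by simp
qed

lemma rational_map_on_point:
  fixes h :: "'a::real_normed_vector \<Rightarrow> ('k::finite) point"
  assumes "\<And>i. rational_on U (\<lambda>z. fst (h z) $ i)" "\<And>i j. rational_on U (\<lambda>z. snd (h z) $ i $ j)"
  shows "rational_map_on U h"
  unfolding rational_map_on_def
proof
  fix b :: "'k point" assume "b \<in> Basis"
  then consider i where "b = (axis i 1, 0)" | i j where "b = (0, axis i (axis j 1))"
    by (auto simp: Basis_prod_def Basis_vec_def)
  then show "rational_on U (\<lambda>z. h z \<bullet> b)"
    by cases (use assms in \<open>simp_all add: inner_prod_def inner_axis\<close>)
qed

lemma rational_on_point_nth:
  fixes h :: "'a::real_normed_vector \<Rightarrow> ('k::finite) point"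
  assumes "rational_map_on U h"
  shows "rational_on U (\<lambda>z. fst (h z) $ i)" "rational_on U (\<lambda>z. snd (h z) $ i $ j)"
proof -
  have "axis i (1 :: real) \<in> Basis" "axis i (axis j (1 :: real)) \<in> Basis"
    by (auto simp: Basis_vec_def)
  then have "(axis i 1, 0) \<in> (Basis :: 'k point set)" "(0, axis i (axis j 1)) \<in> (Basis :: 'k point set)"
    by (simp_all add: Basis_prod_def)
  then show "rational_on U (\<lambda>z. fst (h z) $ i)" "rational_on U (\<lambda>z. snd (h z) $ i $ j)"
    using assms by (force simp: rational_map_on_def inner_prod_def inner_axis)+
qed

lemma rational_on_matrix_mult:
  fixes M N :: "'a::real_normed_vector \<Rightarrow> real ^ 'n::finite ^ 'n"
  assumes "\<And>i j. rational_on U (\<lambda>z. M z $ i $ j)" "\<And>i j. rational_on U (\<lambda>z. N z $ i $ j)"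
  shows "rational_on U (\<lambda>z. (M z ** N z) $ i $ j)"
  by (simp add: matrix_matrix_mult_def rational_on_sum rational_on_mult assms)

lemma rational_on_matrix_vector_mult:
  fixes M :: "'a::real_normed_vector \<Rightarrow> real ^ 'n::finite ^ 'n"
  assumes "\<And>i j. rational_on U (\<lambda>z. M z $ i $ j)" "\<And>i. rational_on U (\<lambda>z. x z $ i)"
  shows "rational_on U (\<lambda>z. (M z *v x z) $ i)"
  by (simp add: matrix_vector_mult_def rational_on_sum rational_on_mult assms)

lemma matrix_vector_mult_axis: "(A *v axis j 1) $ i = A $ i $ (j :: 'n::finite)" for A :: "real ^ 'n ^ 'm"
  by (simp add: matrix_vector_mult_basis column_def)

lemma matrix_vector_mult_nth: "(A *v v) $ i = A $ i \<bullet> v" for A :: "real ^ 'n::finite ^ 'm"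
  by (simp add: matrix_vector_mult_def inner_vec_def)

lemma inner_axis_right: "x \<bullet> axis i (1 :: real) = x $ i"
  by (simp add: inner_axis)

section \<open>A cell of codimension two\<close>

text \<open>\<open>r\<close> numbers the coordinates. Numbers below \<open>n\<close> form the first
  block, which carries the vector \<open>\<tau>\<close> or \<open>fst t\<close>; \<open>n\<close>
  and \<open>n + 1\<close> form the plane on which \<open>refl_mat\<close> is -1.\<close>

locale coordinate_splitting =
  fixes r :: "'k::finite \<Rightarrow> nat" and n :: nat
  assumes bij: "bij_betw r UNIV {0..<n + 2}"
begin

lemma r_inj: "r i = r j \<longleftrightarrow> i = j"
  using bij by (auto simp: bij_betw_def inj_on_def)

lemma r_less: "r i < n + 2"
  using bij by (auto simp: bij_betw_def)

lemma r_surj: "m < n + 2 \<Longrightarrow> \<exists>i. r i = m"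
  using bij by (auto simp: bij_betw_def image_iff set_eq_iff) metis

definition same :: "'k \<Rightarrow> 'k \<Rightarrow> bool" where "same i j \<longleftrightarrow> (r i < n \<longleftrightarrow> r j < n)"

definition block_diag :: "real ^ 'k ^ 'k \<Rightarrow> bool" where
  "block_diag M \<longleftrightarrow> (\<forall>i j. \<not> same i j \<longrightarrow> M $ i $ j = 0)"

definition block_off :: "real ^ 'k ^ 'k \<Rightarrow> bool" where
  "block_off M \<longleftrightarrow> (\<forall>i j. same i j \<longrightarrow> M $ i $ j = 0)"

definition flat :: "real ^ 'k \<Rightarrow> bool" where "flat y \<longleftrightarrow> (\<forall>j. n \<le> r j \<longrightarrow> y $ j = 0)"

definition diag_part :: "real ^ 'k ^ 'k \<Rightarrow> real ^ 'k ^ 'k" where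
  "diag_part T = (\<chi> i j. if same i j then T $ i $ j else 0)"

definition off_part :: "real ^ 'k ^ 'k \<Rightarrow> real ^ 'k ^ 'k" where
  "off_part T = (\<chi> i j. if same i j then 0 else T $ i $ j)"

definition refl_mat :: "real ^ 'k ^ 'k" where
  "refl_mat = (\<chi> i j. if i = j then (if r i < n then 1 else - 1) else 0)"

lemma same_sym: "same i j \<longleftrightarrow> same j i"
  by (auto simp: same_def)

lemma same_refl [simp]: "same i i"
  by (simp add: same_def)

lemma block_diag_diag_part: "block_diag (diag_part T)"
  by (simp add: block_diag_def diag_part_def)

lemma block_off_off_part: "block_off (off_part T)"
  by (simp add: block_off_def off_part_def)

lemma transpose_parts:
  assumes "transpose T = - T"
  shows "transpose (diag_part T) = - diag_part T" "transpose (off_part T) = - off_part T"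
proof -
  have sk: "transpose T $ i $ j = - T $ i $ j" for i j by (simp add: assms)
  have "transpose (diag_part T) $ i $ j = - diag_part T $ i $ j" "transpose (off_part T) $ i $ j = - off_part T $ i $ j" for i j
    using sk[of i j] same_sym[of i j] by (simp_all add: transpose_def diag_part_def off_part_def)
  then show "transpose (diag_part T) = - diag_part T" "transpose (off_part T) = - off_part T"
    by (simp_all add: vec_eq_iff)
qed

lemma block_off_square:
  assumes "block_off X"
  shows "block_diag (X ** X)"
  unfolding block_diag_def
proof (intro allI impI)
  fix i j assume ij: "\<not> same i j"
  have "X $ i $ m * X $ m $ j = 0" for m
  proof (cases "same i m")
    case True
    then have "X $ i $ m = 0" using assms unfolding block_off_def by blast
    then show ?thesis by simp
  next
    case False
    then have "same m j" using ij unfolding same_def by blast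
    then have "X $ m $ j = 0" using assms unfolding block_off_def by blast
    then show ?thesis by simp
  qed
  then show "(X ** X) $ i $ j = 0"
    by (simp only: matrix_matrix_mult_def vec_lambda_beta sum.neutral_const)
qed

text \<open>For skew \<open>X\<close> this is the Gram matrix of the columns of
  \<open>1 + X\<close>, so columns from different blocks are orthogonal.\<close>

lemma block_diag_gram:
  assumes "block_off X"
  shows "block_diag ((mat 1 - X) ** (mat 1 + X))"
proof -
  have "(mat 1 - X) ** (mat 1 + X) = mat 1 - X ** X"
    by (simp add: matrix_mult_linear)
  then show ?thesis
    using block_off_square[OF assms] by (auto simp: block_diag_def mat_def)
qed

lemma flat_block_diag:
  assumes "block_diag M" "flat y"
  shows "flat (M *v y)"
  unfolding flat_def
proof (intro allI impI)
  fix j assume j: "n \<le> r j"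
  have "M $ j $ m * y $ m = 0" for m
  proof (cases "n \<le> r m")
    case True
    then have "y $ m = 0" using assms(2) unfolding flat_def by blast
    then show ?thesis by simp
  next
    case False
    then have "\<not> same j m" using j by (simp add: same_def)
    then have "M $ j $ m = 0" using assms(1) unfolding block_diag_def by blast
    then show ?thesis by simp
  qed
  then show "(M *v y) $ j = 0"
    by (simp only: matrix_vector_mult_def vec_lambda_beta sum.neutral_const)
qed

lemma refl_mat_flat: "flat y \<Longrightarrow> refl_mat *v y = y"
  by (auto simp: vec_eq_iff refl_mat_def matrix_vector_mult_def flat_def if_distrib[of "\<lambda>c. c * _"] not_less cong: if_cong)

lemma refl_mat_nth_mult: "(refl_mat ** M) $ i $ j = (if r i < n then 1 else - 1) * M $ i $ j"
  "(M ** refl_mat) $ i $ j = M $ i $ j * (if r j < n then 1 else - 1)"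
  by (simp_all add: refl_mat_def matrix_matrix_mult_def if_distrib[of "\<lambda>c. c * _"] if_distrib[of "\<lambda>c. _ * c"] cong: if_cong)

lemma refl_mat_block_off: "block_off X \<Longrightarrow> X ** refl_mat = - (refl_mat ** X)"
  by (auto simp: vec_eq_iff refl_mat_nth_mult block_off_def same_def)

lemma refl_mat_block_diag: "block_diag Z \<Longrightarrow> Z ** refl_mat = refl_mat ** Z"
  by (auto simp: vec_eq_iff refl_mat_nth_mult block_diag_def same_def)

lemma refl_mat_square: "refl_mat ** refl_mat = mat 1"
  by (auto simp: vec_eq_iff refl_mat_nth_mult) (auto simp: refl_mat_def mat_def)

lemma transpose_refl_mat: "transpose refl_mat = refl_mat"
  by (auto simp: vec_eq_iff transpose_def refl_mat_def)

text \<open>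
  The columns of \<open>1 + X\<close> span two orthogonal subspaces, the images of the two coordinate blocks;
  the witness \<open>M\<close> is the reflection that is \<open>-1\<close> on the image of the two-dimensional block.
\<close>

lemma conjugate_mem_C_set:
  assumes X: "transpose X = - X" "block_off X" and Z: "transpose Z = - Z" "block_diag Z"
    and \<tau>: "flat \<tau>" and ps: "r p = n" "r s = n + 1" and nz: "Z $ p $ s \<noteq> 0"
  shows "((mat 1 + X) *v \<tau>, (mat 1 + X) ** Z ** (mat 1 - X)) \<in> C_set"
proof -
  define A where "A = mat 1 + X"
  define N where "N = mat 1 - X"
  define J where "J = refl_mat"
  have tA: "transpose A = N" by (simp add: A_def N_def transpose_linear transpose_mat X(1))
  have tN: "transpose N = A" by (simp add: A_def N_def transpose_linear transpose_mat X(1))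
  have dA: "det A \<noteq> 0" unfolding A_def by (rule det_one_plus_skew[OF X(1)])
  define R where "R = cramer_inv A"
  have AR: "A ** R = mat 1" and RA: "R ** A = mat 1"
    unfolding R_def using cramer_inv_right[OF dA] cramer_inv_left[OF dA] by auto
  have RtN: "transpose R ** N = mat 1"
    using arg_cong[OF AR, of transpose] by (simp add: matrix_transpose_mul tA transpose_mat)
  have NRt: "N ** transpose R = mat 1"
    using arg_cong[OF RA, of transpose] by (simp add: matrix_transpose_mul tA transpose_mat)
  have AN: "A ** N = N ** A" by (simp add: A_def N_def matrix_mult_linear)
  have JX: "X ** J = - (J ** X)" unfolding J_def by (rule refl_mat_block_off[OF X(2)])
  have AJ: "A ** J = J ** N" by (simp add: A_def N_def matrix_mult_linear JX)
  have NJ: "N ** J = J ** A" by (simp add: A_def N_def matrix_mult_linear JX)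
  have JJ: "J ** J = mat 1" and tJ: "transpose J = J"
    by (simp_all add: J_def refl_mat_square transpose_refl_mat)
  have ZJ: "Z ** J = J ** Z" unfolding J_def by (rule refl_mat_block_diag[OF Z(2)])
  define M where "M = A ** J ** R"
  define Y where "Y = A ** Z ** N"
  have tM: "transpose M = transpose R ** J ** N"
    by (simp add: M_def matrix_transpose_mul tA tJ matrix_mul_assoc)
  have MA: "M ** A = A ** J"
    by (simp add: M_def matrix_mul_assoc[symmetric] RA)
  \<comment> \<open>Moving \<open>J\<close> across exchanges \<open>A\<close> with
    \<open>N = transpose A\<close>; as these commute, the two copies of \<open>J\<close> meet and
    cancel.\<close>
  have "transpose M ** M = mat 1"
  proof -
    have "(J ** N) ** (A ** J) = J ** (A ** N) ** J" by (simp add: AN matrix_mul_assoc)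
    also have "\<dots> = (J ** A) ** (N ** J)" by (simp add: matrix_mul_assoc)
    also have "\<dots> = (N ** J) ** (J ** A)" by (simp only: NJ)
    also have "\<dots> = N ** (J ** J) ** A" by (simp only: matrix_mul_assoc)
    also have "\<dots> = N ** A" by (simp add: JJ)
    finally have E: "(J ** N) ** (A ** J) = N ** A" .
    have "transpose M ** M = transpose R ** ((J ** N) ** (A ** J)) ** R"
      unfolding tM unfolding M_def by (simp only: matrix_mul_assoc)
    also have "\<dots> = (transpose R ** N) ** (A ** R)" unfolding E by (simp only: matrix_mul_assoc)
    finally show ?thesis by (simp add: RtN AR)
  qed
  then have oM: "orthogonal_matrix M" by (simp add: orthogonal_matrix)
  have M1: "M \<noteq> mat 1"
  proof
    assume "M = mat 1"
    then have "A = A ** J" using MA by simp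
    then have "R ** A = R ** A ** J" by (metis matrix_mul_assoc)
    then have "J = mat 1" by (simp add: RA)
    then have "J $ p $ p = 1" by (simp add: mat_def)
    then show False by (simp add: J_def refl_mat_def ps)
  qed
  have Mx: "M *v (A *v \<tau>) = A *v \<tau>"
  proof -
    have "M *v (A *v \<tau>) = (A ** J) *v \<tau>" by (simp add: matrix_vector_mul_assoc MA)
    also have "\<dots> = A *v (J *v \<tau>)" by (simp add: matrix_vector_mul_assoc)
    finally show ?thesis by (simp add: J_def refl_mat_flat[OF \<tau>])
  qed
  have MY: "M ** Y ** transpose M = Y"
  proof -
    have "M ** Y ** transpose M = (M ** A) ** Z ** (N ** transpose R) ** J ** N"
      by (simp add: Y_def tM matrix_mul_assoc)
    also have "\<dots> = A ** (J ** Z) ** J ** N" by (simp add: MA NRt matrix_mul_assoc)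
    also have "\<dots> = A ** (Z ** (J ** J)) ** N" unfolding ZJ[symmetric] by (simp add: matrix_mul_assoc)
    finally show ?thesis by (simp add: JJ Y_def)
  qed
  \<comment> \<open>In terms of \<open>y = N *v v\<close> the equation is \<open>Z *v y = 0\<close>.
    The plane block of \<open>Z\<close> is a nonzero skew matrix of size 2, hence invertible, so
    \<open>y\<close> is flat; and \<open>M\<close> fixes \<open>transpose R *v y\<close> for flat
    \<open>y\<close>.\<close>
  have ker: "M *v v = v" if v: "Y *v v = 0" for v
  proof -
    define y where "y = N *v v"
    have vy: "v = transpose R *v y" by (simp add: y_def matrix_vector_mul_assoc RtN)
    have "R *v (Y *v v) = (R ** A) *v (Z *v y)"
      by (simp add: Y_def y_def matrix_vector_mul_assoc matrix_mul_assoc)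
    then have Zy: "Z *v y = 0" using v by (simp add: RA matrix_vector_mult_0_right)
    have sk: "Z $ j $ i = - Z $ i $ j" for i j
      using arg_cong[OF Z(1), of "\<lambda>X. X $ i $ j"] by (simp add: transpose_def)
    have big: "r j = n \<or> r j = n + 1" if "n \<le> r j" for j using r_less[of j] that by linarith
    have row: "(Z *v y) $ i = Z $ i $ p * y $ p + Z $ i $ s * y $ s" if "n \<le> r i" for i
    proof -
      have "(Z *v y) $ i = (\<Sum>j\<in>{p, s}. Z $ i $ j * y $ j)"
        unfolding matrix_vector_mult_def vec_lambda_beta
      proof (rule sum.mono_neutral_right)
        show "\<forall>j\<in>UNIV - {p, s}. Z $ i $ j * y $ j = 0"
        proof
          fix j assume "j \<in> UNIV - {p, s}"
          then have "r j \<noteq> n" "r j \<noteq> n + 1" using r_inj ps by (metis DiffD2 insert_iff)+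
          then have "\<not> n \<le> r j" using big by blast
          then have "\<not> same i j" using that by (simp add: same_def)
          then show "Z $ i $ j * y $ j = 0" using Z(2) by (simp add: block_diag_def)
        qed
      qed simp_all
      then show ?thesis using ps r_inj[of p s] by (cases "p = s") auto
    qed
    have "Z $ p $ p = 0" "Z $ s $ s = 0" using sk[of p p] sk[of s s] by simp_all
    then have "Z $ p $ s * y $ s = 0" "Z $ s $ p * y $ p = 0"
      using row[of p] row[of s] Zy ps by simp_all
    then have "y $ s = 0" "y $ p = 0" using nz sk[of s p] by simp_all
    then have "flat y"
      unfolding flat_def using big r_inj ps by metis
    then have Jy: "J *v y = y" by (simp add: J_def refl_mat_flat)
    have NR: "N ** R = R ** N"
    proof -
      have "R ** (A ** N) ** R = R ** (N ** A) ** R" by (simp add: AN)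
      then have "(R ** A) ** N ** R = R ** N ** (A ** R)" by (simp add: matrix_mul_assoc)
      then show ?thesis by (simp add: RA AR)
    qed
    have JR: "J ** R = transpose R ** J"
    proof -
      have "transpose R ** (N ** J) ** R = transpose R ** (J ** A) ** R" by (simp add: NJ)
      then have "(transpose R ** N) ** J ** R = transpose R ** J ** (A ** R)" by (simp add: matrix_mul_assoc)
      then show ?thesis by (simp add: RtN AR)
    qed
    have "M *v v = (J ** (N ** R)) *v v" by (simp add: M_def AJ matrix_mul_assoc)
    also have "\<dots> = (J ** R) *v y" by (simp add: NR y_def matrix_vector_mul_assoc matrix_mul_assoc)
    also have "\<dots> = transpose R *v (J *v y)" by (simp add: JR matrix_vector_mul_assoc)
    finally show ?thesis by (simp add: Jy vy)
  qed
  have "transpose Y = - Y"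
    by (simp add: Y_def matrix_transpose_mul tA tN Z(1) matrix_mult_linear matrix_mul_assoc)
  moreover have "Y \<noteq> 0"
  proof
    assume "Y = 0"
    have "R ** Y ** transpose R = (R ** A) ** Z ** (N ** transpose R)" by (simp add: Y_def matrix_mul_assoc)
    then have "Z = R ** Y ** transpose R" by (simp add: RA NRt)
    also have "\<dots> = 0" unfolding \<open>Y = 0\<close> by (simp add: vec_eq_iff matrix_matrix_mult_def)
    finally show False using nz by simp
  qed
  ultimately have "(A *v \<tau>, Y) \<in> C_set"
    unfolding C_set_def carnot_group_def using oM M1 Mx MY ker by blast
  then show ?thesis by (simp add: A_def Y_def N_def)
qed

text \<open>One skew matrix \<open>T\<close> carries all free entries: its off-diagonal block is the
  tilt \<open>X\<close>, its diagonal blocks form \<open>Z\<close>. Antisymmetrizing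
  \<open>snd t\<close> lets the strict upper triangle be prescribed freely.\<close>

definition param :: "'k point \<Rightarrow> 'k point" where
  "param t = (let T = snd t - transpose (snd t); A = mat 1 + off_part T in
     (A *v fst t, A ** diag_part T ** (mat 1 - off_part T)))"

text \<open>The last two rows are coordinate vectors; they normalize the vectors orthogonal to the
  Krylov space.\<close>

definition krylov :: "'k point \<Rightarrow> real ^ 'k ^ 'k" where
  "krylov z = (\<chi> j. if r j < n then ((\<lambda>v. snd z *v v) ^^ r j) (fst z) else axis j 1)"

text \<open>For parametrized points the two plane columns of the inverse Krylov matrix are those of
  \<open>1 + X\<close>. The mirrored block is filled by skewness instead of being read off, so that
  \<open>1 + tilt z\<close> is invertible at every \<open>z\<close>.\<close>

definition tilt :: "'k point \<Rightarrow> real ^ 'k ^ 'k" where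
  "tilt z = (\<chi> i j. if same i j then 0
     else if n \<le> r j then cramer_inv (krylov z) $ i $ j else - cramer_inv (krylov z) $ j $ i)"

definition unparam :: "'k point \<Rightarrow> 'k point" where
  "unparam z = (let R = cramer_inv (mat 1 + tilt z) in
     (R *v fst z, \<chi> i j. if r i < r j then (tilt z + R ** snd z ** transpose R) $ i $ j else 0))"

text \<open>One step turns \<open>(1 + X) y\<close> into \<open>(1 + X) Z (1 - X) (1 + X) y\<close>;
  the Gram matrix and \<open>Z\<close> are block diagonal, so \<open>y\<close> is replaced by
  another flat vector.\<close>

lemma krylov_iterate:
  assumes X: "block_off X" and Z: "block_diag Z" and \<tau>: "flat \<tau>"
  shows "\<exists>y. flat y \<and> ((\<lambda>v. ((mat 1 + X) ** Z ** (mat 1 - X)) *v v) ^^ m) ((mat 1 + X) *v \<tau>) = (mat 1 + X) *v y"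
proof (induction m)
  case 0
  then show ?case using \<tau> by auto
next
  case (Suc m)
  then obtain y where y: "flat y"
    "((\<lambda>v. ((mat 1 + X) ** Z ** (mat 1 - X)) *v v) ^^ m) ((mat 1 + X) *v \<tau>) = (mat 1 + X) *v y" by blast
  have "((\<lambda>v. ((mat 1 + X) ** Z ** (mat 1 - X)) *v v) ^^ Suc m) ((mat 1 + X) *v \<tau>)
      = (mat 1 + X) *v (Z *v (((mat 1 - X) ** (mat 1 + X)) *v y))"
    by (simp add: y(2) matrix_vector_mul_assoc matrix_mul_assoc)
  moreover have "flat (Z *v (((mat 1 - X) ** (mat 1 + X)) *v y))"
    by (intro flat_block_diag Z block_diag_gram X y(1))
  ultimately show ?case by blast
qed

text \<open>The first \<open>n\<close> rows lie in the image of the flat vectors, which is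
  orthogonal to the image of a plane axis; the last two rows read plane coordinates, to which the
  off-diagonal \<open>X\<close> contributes nothing.\<close>

lemma krylov_column:
  assumes X: "transpose X = - X" "block_off X" and Z: "block_diag Z" and \<tau>: "flat \<tau>" and j: "n \<le> r j"
  shows "krylov ((mat 1 + X) *v \<tau>, (mat 1 + X) ** Z ** (mat 1 - X)) *v ((mat 1 + X) *v axis j 1) = axis j 1"
    (is "krylov ?z *v _ = _")
proof -
  have "(krylov ?z *v ((mat 1 + X) *v axis j 1)) $ a = axis j 1 $ a" for a
  proof (cases "r a < n")
    case True
    obtain y where y: "flat y" "((\<lambda>v. snd ?z *v v) ^^ r a) (fst ?z) = (mat 1 + X) *v y"
      using krylov_iterate[OF X(2) Z \<tau>, of "r a"] by auto
    have row: "krylov ?z $ a = (mat 1 + X) *v y" using y(2) True by (simp add: krylov_def)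
    have "(krylov ?z *v ((mat 1 + X) *v axis j 1)) $ a = ((mat 1 + X) *v y) \<bullet> ((mat 1 + X) *v axis j 1)"
      unfolding row[symmetric] by (rule matrix_vector_mult_nth)
    also have "\<dots> = (transpose (mat 1 + X) *v ((mat 1 + X) *v y)) \<bullet> axis j 1"
      by (metis dot_lmul_matrix transpose_matrix_vector)
    also have "\<dots> = (((mat 1 - X) ** (mat 1 + X)) *v y) $ j"
      by (simp add: transpose_linear transpose_mat X(1) inner_axis_right matrix_vector_mul_assoc)
    also have "\<dots> = 0"
      using flat_block_diag[OF block_diag_gram[OF X(2)] y(1)] j by (simp add: flat_def)
    finally show ?thesis using True j by (auto simp: axis_def)
  next
    case False
    have row: "krylov ?z $ a = axis a 1" using False by (simp add: krylov_def)
    have "(krylov ?z *v ((mat 1 + X) *v axis j 1)) $ a = axis a 1 \<bullet> ((mat 1 + X) *v axis j 1)"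
      unfolding row[symmetric] by (rule matrix_vector_mult_nth)
    also have "\<dots> = (mat 1 + X) $ a $ j"
      by (simp only: inner_commute[of "axis a 1"] inner_axis_right matrix_vector_mult_axis)
    also have "\<dots> = axis j 1 $ a"
      using X(2) False j by (auto simp: block_off_def same_def mat_def axis_def)
    finally show ?thesis .
  qed
  then show ?thesis by (simp add: vec_eq_iff)
qed

text \<open>The Krylov matrix yields \<open>X\<close>. With \<open>1 + X\<close> known,
  \<open>Z\<close> and the flat vector come from undoing the conjugation, and \<open>X + Z\<close>
  restores the upper triangle of \<open>snd t\<close>.\<close>

lemma unparam_param:
  assumes \<tau>: "flat (fst t)" and U: "\<And>i j. \<not> r i < r j \<Longrightarrow> snd t $ i $ j = 0"
    and d: "det (krylov (param t)) \<noteq> 0"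
  shows "unparam (param t) = t"
proof -
  define T where "T = snd t - transpose (snd t)"
  define X where "X = off_part T"
  define Z where "Z = diag_part T"
  define A where "A = mat 1 + X"
  have tT: "transpose T = - T" by (simp add: T_def transpose_linear)
  have X: "transpose X = - X" "block_off X" and Z: "transpose Z = - Z" "block_diag Z"
    using transpose_parts[OF tT] block_off_off_part block_diag_diag_part by (simp_all add: X_def Z_def)
  have p: "param t = (A *v fst t, A ** Z ** (mat 1 - X))"
    by (simp add: param_def Let_def T_def A_def X_def Z_def)
  have inv: "cramer_inv (krylov (param t)) $ i $ j = A $ i $ j" if j: "n \<le> r j" for i j
  proof -
    have "krylov (param t) *v (A *v axis j 1) = axis j 1"
      unfolding p A_def by (rule krylov_column[OF X Z(2) \<tau> j])
    then have "cramer_inv (krylov (param t)) *v (krylov (param t) *v (A *v axis j 1)) = cramer_inv (krylov (param t)) *v axis j 1"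
      by simp
    then have "A *v axis j 1 = cramer_inv (krylov (param t)) *v axis j 1"
      by (simp add: matrix_vector_mul_assoc matrix_mul_assoc cramer_inv_left[OF d])
    then show ?thesis using matrix_vector_mult_axis by metis
  qed
  have sk: "X $ j $ i = - X $ i $ j" for i j
    using arg_cong[OF X(1), of "\<lambda>X. X $ i $ j"] by (simp add: transpose_def)
  have tilt: "tilt (param t) = X"
  proof -
    have "tilt (param t) $ i $ j = X $ i $ j" for i j
    proof (cases "same i j")
      case True
      then show ?thesis using X(2) by (simp add: tilt_def block_off_def)
    next
      case False
      then have "i \<noteq> j" by auto
      show ?thesis
      proof (cases "n \<le> r j")
        case True
        then show ?thesis using False \<open>i \<noteq> j\<close> inv[of j i] by (simp add: tilt_def A_def mat_def)
      next
        case nj: False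
        then have "n \<le> r i" using False by (auto simp: same_def)
        then show ?thesis using False nj \<open>i \<noteq> j\<close> inv[of i j] sk[of i j] by (simp add: tilt_def A_def mat_def)
      qed
    qed
    then show ?thesis by (simp add: vec_eq_iff)
  qed
  define R where "R = cramer_inv A"
  have dA: "det A \<noteq> 0" unfolding A_def by (rule det_one_plus_skew[OF X(1)])
  have RA: "R ** A = mat 1" unfolding R_def by (rule cramer_inv_left[OF dA])
  have tA: "transpose A = mat 1 - X" by (simp add: A_def transpose_linear transpose_mat X(1))
  have NRt: "(mat 1 - X) ** transpose R = mat 1"
    using arg_cong[OF RA, of transpose] by (simp add: matrix_transpose_mul tA transpose_mat)
  have "R ** snd (param t) ** transpose R = (R ** A) ** Z ** ((mat 1 - X) ** transpose R)"
    by (simp add: p matrix_mul_assoc)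
  then have RY: "R ** snd (param t) ** transpose R = Z" by (simp add: RA NRt)
  have XZ: "X + Z = T" by (simp add: vec_eq_iff X_def Z_def off_part_def diag_part_def)
  have "(if r i < r j then (X + Z) $ i $ j else 0) = snd t $ i $ j" for i j
    using U[of i j] U[of j i] by (auto simp: XZ T_def transpose_def)
  then have "(\<chi> i j. if r i < r j then (X + Z) $ i $ j else 0) = snd t"
    unfolding vec_eq_iff vec_lambda_beta by blast
  moreover have "R *v fst (param t) = fst t"
    by (simp add: p matrix_vector_mul_assoc RA)
  ultimately show ?thesis
    unfolding unparam_def Let_def tilt A_def[symmetric] R_def[symmetric] RY by (simp only: prod.collapse)
qed

lemma param_mem_C_set:
  assumes "flat (fst t)" "r p = n" "r s = n + 1" "snd t $ p $ s \<noteq> 0" "snd t $ s $ p = 0"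
  shows "param t \<in> C_set"
proof -
  define T where "T = snd t - transpose (snd t)"
  have tT: "transpose T = - T" by (simp add: T_def transpose_linear)
  have "diag_part T $ p $ s \<noteq> 0"
    using assms by (simp add: diag_part_def same_def T_def transpose_def)
  then show ?thesis
    unfolding param_def Let_def T_def[symmetric]
    by (intro conjugate_mem_C_set[OF transpose_parts(2)[OF tT] block_off_off_part transpose_parts(1)[OF tT]
          block_diag_diag_part assms(1-3)]) 
qed

section \<open>Rationality of the parametrization and of its inverse\<close>

lemma rational_fst_snd:
  "rational_on U (\<lambda>z :: 'k point. fst z $ i)" "rational_on U (\<lambda>z :: 'k point. snd z $ i $ j)"
  using rational_on_point_nth[OF rational_map_on_linear[OF bounded_linear_ident], of U] by auto

lemma rational_param: "rational_map_on UNIV param"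
proof (rule rational_map_on_point)
  have T: "rational_on UNIV (\<lambda>t :: 'k point. (snd t - transpose (snd t)) $ i $ j)" for i j
    by (simp add: transpose_def rational_on_diff rational_fst_snd)
  have off: "rational_on UNIV (\<lambda>t :: 'k point. off_part (snd t - transpose (snd t)) $ i $ j)" for i j
    using T[of i j] rational_on_const[of UNIV 0] unfolding off_part_def by (cases "same i j") simp_all
  have diag: "rational_on UNIV (\<lambda>t :: 'k point. diag_part (snd t - transpose (snd t)) $ i $ j)" for i j
    using T[of i j] rational_on_const[of UNIV 0] unfolding diag_part_def by (cases "same i j") simp_all
  have A: "rational_on UNIV (\<lambda>t :: 'k point. (mat 1 + off_part (snd t - transpose (snd t))) $ i $ j)"
    "rational_on UNIV (\<lambda>t :: 'k point. (mat 1 - off_part (snd t - transpose (snd t))) $ i $ j)" for i j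
    unfolding vector_add_component vector_minus_component
    by (intro rational_on_add rational_on_diff rational_on_const off)+
  show "rational_on UNIV (\<lambda>z. fst (param z) $ i)" for i
    unfolding param_def Let_def fst_conv
    by (rule rational_on_matrix_vector_mult[OF A(1) rational_fst_snd(1)])
  show "rational_on UNIV (\<lambda>z. snd (param z) $ i $ j)" for i j
    unfolding param_def Let_def snd_conv
    by (rule rational_on_matrix_mult[OF rational_on_matrix_mult[OF A(1) diag] A(2)])
qed

lemma rational_krylov: "rational_on U (\<lambda>z. krylov z $ i $ j)"
proof -
  have "rational_on U (\<lambda>z :: 'k point. ((\<lambda>v. snd z *v v) ^^ m) (fst z) $ j)" for m j
  proof (induction m arbitrary: j)
    case 0
    then show ?case by (simp add: rational_fst_snd)
  next
    case (Suc m)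
    have "rational_on U (\<lambda>z :: 'k point. (snd z *v ((\<lambda>v. snd z *v v) ^^ m) (fst z)) $ j)"
      by (rule rational_on_matrix_vector_mult[OF rational_fst_snd(2) Suc.IH])
    then show ?case by simp
  qed
  then show ?thesis unfolding krylov_def by (cases "r i < n") (simp_all add: rational_on_const)
qed

lemma transpose_tilt: "transpose (tilt z) = - tilt z"
  by (auto simp: vec_eq_iff transpose_def tilt_def same_def)

lemma rational_unparam: "rational_map_on {z. det (krylov z) \<noteq> 0} unparam"
proof -
  let ?U = "{z. det (krylov z) \<noteq> 0}"
  have inv: "rational_on ?U (\<lambda>z. cramer_inv (krylov z) $ i $ j)" for i j
    by (rule rational_on_cramer_inv[OF rational_krylov]) simp
  have tilt: "rational_on ?U (\<lambda>z. tilt z $ i $ j)" for i j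
    using inv[of i j] rational_on_minus[OF inv[of j i]] rational_on_const[of ?U 0]
    unfolding tilt_def by (cases "same i j"; cases "n \<le> r j") simp_all
  have A: "rational_on ?U (\<lambda>z. (mat 1 + tilt z) $ i $ j)" for i j
    unfolding vector_add_component by (intro rational_on_add rational_on_const tilt)
  have R: "rational_on ?U (\<lambda>z. cramer_inv (mat 1 + tilt z) $ i $ j)" for i j
    by (rule rational_on_cramer_inv[OF A]) (rule det_one_plus_skew[OF transpose_tilt])
  have Rt: "rational_on ?U (\<lambda>z. transpose (cramer_inv (mat 1 + tilt z)) $ i $ j)" for i j
    using R[of j i] by (simp add: transpose_def)
  show ?thesis
  proof (rule rational_map_on_point)
    show "rational_on ?U (\<lambda>z. fst (unparam z) $ i)" for i
      unfolding unparam_def Let_def fst_conv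
      by (rule rational_on_matrix_vector_mult[OF R rational_fst_snd(1)])
    show "rational_on ?U (\<lambda>z. snd (unparam z) $ i $ j)" for i j
    proof -
      have "rational_on ?U (\<lambda>z. (tilt z + cramer_inv (mat 1 + tilt z) ** snd z ** transpose (cramer_inv (mat 1 + tilt z))) $ i $ j)"
        unfolding vector_add_component
        by (intro rational_on_add tilt rational_on_matrix_mult R Rt rational_fst_snd)
      then show ?thesis
        using rational_on_const[of ?U 0] unfolding unparam_def Let_def snd_conv by (cases "r i < r j") simp_all
    qed
  qed
qed

text \<open>After antisymmetrization the superdiagonal of -1 gives a tridiagonal matrix with +1
  below the diagonal, which carries the first axis step by step through the first block. The
  condition \<open>0 < n\<close> keeps the vector flat when that block is empty.\<close>

definition base :: "'k point" where
  "base = (\<chi> i. if r i = 0 \<and> 0 < n then 1 else 0, \<chi> i j. if r j = r i + 1 \<and> r j < n then - 1 else 0)"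

text \<open>Each application of the tridiagonal matrix raises the highest nonzero index by exactly
  one, with coefficient 1.\<close>

lemma krylov_base:
  assumes "m < n"
  shows "\<forall>i. (m < r i \<longrightarrow> ((\<lambda>v. (snd base - transpose (snd base)) *v v) ^^ m) (fst base) $ i = 0) \<and>
    (r i = m \<longrightarrow> ((\<lambda>v. (snd base - transpose (snd base)) *v v) ^^ m) (fst base) $ i = 1)"
  using assms
proof (induction m)
  case 0
  then show ?case by (simp add: base_def)
next
  case (Suc m)
  define T where "T = snd base - transpose (snd base)"
  define y where "y = ((\<lambda>v. T *v v) ^^ m) (fst base)"
  have y: "y $ i = 0" if "m < r i" for i using Suc that by (simp add: y_def T_def)
  have y1: "y $ i = 1" if "r i = m" for i using Suc that by (simp add: y_def T_def)
  have term_eq: "T $ i $ j * y $ j = (if r i = Suc m \<and> r j = m then 1 else 0)" if "Suc m \<le> r i" for i j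
  proof (cases "m < r j")
    case True
    then show ?thesis using y[OF True] by simp
  next
    case False
    then have "T $ i $ j = (if r i = r j + 1 \<and> r i < n then 1 else 0)"
      using that by (simp add: T_def base_def transpose_def)
    then show ?thesis using False that y1[of j] Suc.prems by auto
  qed
  have step: "((\<lambda>v. T *v v) ^^ Suc m) (fst base) $ i = (\<Sum>j\<in>UNIV. T $ i $ j * y $ j)" for i
    by (simp add: y_def matrix_vector_mult_def)
  obtain a where a: "r a = m" using r_surj[of m] Suc.prems by auto
  have ra: "r j = m \<longleftrightarrow> j = a" for j using a r_inj by metis
  have "((\<lambda>v. T *v v) ^^ Suc m) (fst base) $ i = (if r i = Suc m then 1 else 0)" if "Suc m \<le> r i" for i
    unfolding step term_eq[OF that] by (simp add: ra)
  then show ?case unfolding T_def[symmetric] by (metis le_refl less_imp_le less_irrefl)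
qed

lemma param_base: "param base = (fst base, snd base - transpose (snd base))"
proof -
  define T where "T = snd base - transpose (snd base)"
  have "T $ i $ j = 0" if "\<not> same i j" for i j
    using that by (auto simp: T_def base_def transpose_def same_def)
  then have "off_part T = 0" "diag_part T = T"
    by (auto simp: vec_eq_iff off_part_def diag_part_def)
  then show ?thesis by (simp add: param_def T_def[symmetric])
qed

text \<open>By \<open>krylov_base\<close>, and because the last two rows are axes, the matrix is
  lower unitriangular in the order \<open>r\<close>; a kernel vector is eliminated entry by
  entry.\<close>

lemma det_krylov_base: "det (krylov (param base)) \<noteq> 0"
proof -
  let ?K = "krylov (param base)"
  have ker: "v = 0" if v: "?K *v v = 0" for v
  proof -
    have row: "?K $ i \<bullet> v = 0" for i using arg_cong[OF v, of "\<lambda>x. x $ i"] by (simp add: matrix_vector_mult_nth)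
    have big: "v $ i = 0" if "n \<le> r i" for i
      using row[of i] that by (simp add: krylov_def inner_commute[of "axis i 1"] inner_axis_right)
    have "\<forall>i. r i = m \<longrightarrow> v $ i = 0" for m
    proof (induction m rule: less_induct)
      case (less m)
      show ?case
      proof (intro allI impI)
        fix i assume i: "r i = m"
        show "v $ i = 0"
        proof (cases "m < n")
          case False
          then show ?thesis using big i by simp
        next
          case True
          define y where "y = ((\<lambda>v. (snd base - transpose (snd base)) *v v) ^^ m) (fst base)"
          have y: "y $ j = 0" if "m < r j" for j using krylov_base[OF True] that by (simp add: y_def)
          have y1: "y $ i = 1" using krylov_base[OF True] i by (simp add: y_def)
          have "?K $ i = y" using True i by (simp add: krylov_def param_base y_def)
          then have "(\<Sum>j\<in>UNIV. y $ j * v $ j) = 0" using row[of i] by (simp add: inner_vec_def)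
          moreover have "y $ j * v $ j = (if j = i then v $ i else 0)" for j
          proof (cases "r j" m rule: linorder_cases)
            case less
            then have "v $ j = 0" using less.IH by blast
            then show ?thesis using i less by auto
          next
            case equal
            then have "j = i" using i r_inj by metis
            then show ?thesis using y1 by simp
          next
            case greater
            then show ?thesis using y[OF greater] i by auto
          qed
          ultimately show ?thesis by simp
        qed
      qed
    qed
    then show "v = 0" by (simp add: vec_eq_iff)
  qed
  then have "\<exists>B. B ** ?K = mat 1" using matrix_left_invertible_ker[of ?K] by blast
  then show ?thesis using invertible_det_nz[of ?K] invertible_left_inverse[of ?K] by blast
qed

lemma card_indices: "card {i. r i < n} = n" "2 * card {(i, j). r i < r j} + (n + 2) = (n + 2) * (n + 2)"
proof -
  have "inj r" by (simp add: inj_def r_inj)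
  have "card {i. r i < n} = card (r ` {i. r i < n})"
    by (rule card_image[symmetric]) (use \<open>inj r\<close> in \<open>auto simp: inj_on_def\<close>)
  also have "r ` {i. r i < n} = {0..<n}"
  proof
    show "{0..<n} \<subseteq> r ` {i. r i < n}"
    proof
      fix m assume "m \<in> {0..<n}"
      then have "m < n" by simp
      moreover obtain i where "r i = m" using r_surj[of m] \<open>m < n\<close> by auto
      ultimately show "m \<in> r ` {i. r i < n}" by blast
    qed
  qed auto
  finally show "card {i. r i < n} = n" by simp
  let ?I = "{(i, j). r i < r j}" and ?J = "{(i, j). r j < r i}" and ?D = "(\<lambda>i :: 'k. (i, i)) ` UNIV"
  have k: "CARD('k) = n + 2" using bij_betw_same_card[OF bij] by simp
  have "card ?J = card ?I"
    by (rule bij_betw_same_card[of prod.swap]) (auto simp: bij_betw_def inj_on_def image_iff)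
  moreover have "card ?D = n + 2" by (subst card_image) (auto simp: inj_on_def k)
  moreover have "(UNIV :: ('k \<times> 'k) set) = ?I \<union> (?J \<union> ?D)"
  proof (intro set_eqI iffI UNIV_I)
    fix ij :: "'k \<times> 'k"
    obtain i j where ij: "ij = (i, j)" by (cases ij)
    show "ij \<in> ?I \<union> (?J \<union> ?D)"
      using r_inj[of i j] by (cases "r i" "r j" rule: linorder_cases) (auto simp: ij)
  qed
  then have "CARD('k \<times> 'k) = card (?I \<union> (?J \<union> ?D))" by simp
  moreover have "card (?I \<union> (?J \<union> ?D)) = card ?I + card (?J \<union> ?D)"
    by (rule card_Un_disjoint) auto
  moreover have "card (?J \<union> ?D) = card ?J + card ?D"
    by (rule card_Un_disjoint) auto
  ultimately show "2 * card ?I + (n + 2) = (n + 2) * (n + 2)" by (simp add: k)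
qed

text \<open>Invertibility of the Krylov matrix is an open condition that holds at
  \<open>base\<close>, so it survives on a small cube with corner \<open>base\<close>, where
  \<open>unparam\<close> is a rational inverse of \<open>param\<close>.\<close>

lemma C_set_contains_cell: "\<exists>S\<subseteq>(C_set :: 'k point set). semialgebraic_cell (n + card {(i, j). r i < r j}) S"
proof -
  define W where "W = {t :: 'k point. det (krylov (param t)) \<noteq> 0}"
  have dk: "rational_on UNIV (\<lambda>z. det (krylov z))" by (rule rational_on_det[OF rational_krylov])
  then have "rational_on UNIV (\<lambda>t. det (krylov (param t)))" by (rule rational_on_compose[OF _ rational_param])
  then have "continuous_on UNIV (\<lambda>t. det (krylov (param t)))" by (rule rational_on_continuous)
  then have "open W" unfolding W_def by (intro open_Collect_neq continuous_on_const)
  moreover have "base \<in> W" by (simp add: W_def det_krylov_base)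
  ultimately obtain \<epsilon> where \<epsilon>: "0 < \<epsilon>" "ball base \<epsilon> \<subseteq> W" unfolding open_contains_ball by blast
  \<comment> \<open>Cube points have norm below \<open>D\<close>, by comparison with the sum of the
    absolute coordinates; scaled by \<open>\<epsilon> / D\<close> the cube fits into the
    ball.\<close>
  define D where "D = real DIM('k point) + 1"
  have D: "0 < D" unfolding D_def using of_nat_0_le_iff[of "DIM('k point)", where 'a = real] by linarith
  define \<delta> where "\<delta> = \<epsilon> / D"
  have \<delta>: "0 < \<delta>" using \<epsilon>(1) D by (simp add: \<delta>_def)
  define F where "F t = param (base + \<delta> *\<^sub>R t)" for t
  define G where "G z = (1 / \<delta>) *\<^sub>R (unparam z - base)" for z
  define U where "U = {z :: 'k point. det (krylov z) \<noteq> 0}"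
  \<comment> \<open>The free coordinates: the first block of the vector and the strict upper
    triangle of the matrix.\<close>
  define B :: "'k point set" where "B = (\<lambda>i. (axis i 1, 0)) ` {i. r i < n} \<union> (\<lambda>(i, j). (0, axis i (axis j 1))) ` {(i, j). r i < r j}"
  have B: "B \<subseteq> (Basis :: 'k point set)"
    by (auto simp: B_def Basis_prod_def)
  have cB: "card B = n + card {(i, j). r i < r j}"
  proof -
    have "card B = card ((\<lambda>i. (axis i 1, 0) :: 'k point) ` {i. r i < n})
        + card ((\<lambda>(i, j). (0, axis i (axis j 1)) :: 'k point) ` {(i, j). r i < r j})"
      unfolding B_def by (rule card_Un_disjoint) (auto simp: axis_eq_0_iff)
    moreover have "card ((\<lambda>i. (axis i 1, 0) :: 'k point) ` {i. r i < n}) = n"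
      by (subst card_image) (auto simp: inj_on_def axis_eq_axis card_indices(1))
    moreover have "card ((\<lambda>(i, j). (0, axis i (axis j 1)) :: 'k point) ` {(i, j). r i < r j}) = card {(i, j). r i < r j}"
      by (rule card_image) (auto simp: inj_on_def axis_eq_axis axis_eq_0_iff)
    ultimately show ?thesis by simp
  qed
  have nth: "t \<bullet> (axis i 1, 0) = fst t $ i" "t \<bullet> (0, axis i (axis j 1)) = snd t $ i $ j" for t :: "'k point" and i j
    by (simp_all add: inner_prod_def inner_axis)
  have bas: "(axis i 1, 0) \<in> (Basis :: 'k point set)" "(0, axis i (axis j 1)) \<in> (Basis :: 'k point set)" for i j
    by (simp_all add: Basis_prod_def)
  have cube: "flat (fst t)" "\<And>i j. \<not> r i < r j \<Longrightarrow> snd t $ i $ j = 0" "\<And>i j. r i < r j \<Longrightarrow> 0 < snd t $ i $ j"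
    if t: "t \<in> open_cube B" for t
  proof -
    have out: "t \<bullet> b = 0" if "b \<in> Basis" "b \<notin> B" for b using t that by (simp add: open_cube_def)
    have "fst t $ j = 0" if "n \<le> r j" for j
    proof -
      have "(axis j 1, 0) \<notin> B" using that by (auto simp: B_def axis_eq_axis axis_eq_0_iff)
      then show ?thesis using out[OF bas(1)[of j]] by (simp add: nth)
    qed
    then show "flat (fst t)" by (simp add: flat_def)
    show "snd t $ i $ j = 0" if "\<not> r i < r j" for i j
    proof -
      have "(0, axis i (axis j 1)) \<notin> B" using that by (auto simp: B_def axis_eq_axis axis_eq_0_iff)
      then show ?thesis using out[OF bas(2)[of i j]] by (simp add: nth)
    qed
    show "0 < snd t $ i $ j" if "r i < r j" for i j
    proof -
      have "(0, axis i (axis j 1)) \<in> B" using that by (auto simp: B_def)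
      then have "0 < t \<bullet> (0, axis i (axis j 1))" using t by (simp add: open_cube_def)
      then show ?thesis by (simp add: nth)
    qed
  qed
  have nrm: "base + \<delta> *\<^sub>R t \<in> W" if t: "t \<in> open_cube B" for t
  proof -
    have "norm t \<le> (\<Sum>b\<in>Basis. \<bar>t \<bullet> b\<bar>)" by (rule norm_le_l1)
    also have "\<dots> \<le> (\<Sum>b\<in>(Basis :: 'k point set). 1)"
    proof (rule sum_mono)
      fix b :: "'k point" assume "b \<in> Basis"
      then show "\<bar>t \<bullet> b\<bar> \<le> 1" using t by (cases "b \<in> B") (auto simp: open_cube_def less_imp_le)
    qed
    also have "\<dots> = real DIM('k point)" unfolding sum_constant by (rule mult_1_right)
    finally have "norm t < D" unfolding D_def by linarith
    then have "\<delta> * norm t < \<delta> * D" using \<delta> by (rule mult_strict_left_mono)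
    also have "\<dots> = \<epsilon>" using D by (simp add: \<delta>_def)
    finally have "norm (\<delta> *\<^sub>R t) < \<epsilon>" using \<delta> by simp
    then have "base + \<delta> *\<^sub>R t \<in> ball base \<epsilon>" by (simp add: dist_norm)
    then show ?thesis using \<epsilon>(2) by blast
  qed
  obtain p s where ps: "r p = n" "r s = n + 1" using r_surj[of n] r_surj[of "n + 1"] by auto
  have fl: "flat (fst (base + \<delta> *\<^sub>R t))" if "flat (fst t)" for t
    using that by (auto simp: flat_def base_def)
  have up: "snd (base + \<delta> *\<^sub>R t) $ i $ j = 0" if "snd t $ i $ j = 0" "\<not> r i < r j" for t i j
    using that by (auto simp: base_def)
  have sU: "semialgebraic U"
  proof -
    have "rational_on UNIV (\<lambda>z :: 'k point. det (krylov z) * det (krylov z))"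
      by (rule rational_on_mult[OF dk dk])
    from semialgebraic_rational_pos[OF semialgebraic_UNIV this]
    have "semialgebraic {z :: 'k point. 0 < det (krylov z) * det (krylov z)}"
      by (simp only: UNIV_I simp_thms)
    moreover have "(det (krylov z) \<noteq> 0) = (0 < det (krylov z) * det (krylov z))" for z :: "'k point"
      using not_real_square_gt_zero[of "det (krylov z)"] by blast
    then have "U = {z :: 'k point. 0 < det (krylov z) * det (krylov z)}"
      unfolding U_def by (rule Collect_cong)
    ultimately show ?thesis by (simp only:)
  qed
  have rG: "rational_map_on U G"
    unfolding rational_map_on_def
  proof
    fix b :: "'k point" assume "b \<in> Basis"
    then have "rational_on U (\<lambda>z. unparam z \<bullet> b)" using rational_unparam by (simp add: rational_map_on_def U_def)
    then have "rational_on U (\<lambda>z. (1 / \<delta>) * (unparam z \<bullet> b - base \<bullet> b))"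
      by (intro rational_on_mult rational_on_diff rational_on_const)
    then show "rational_on U (\<lambda>z. G z \<bullet> b)" by (simp add: G_def inner_diff_left)
  qed
  have aff: "rational_map_on UNIV (\<lambda>t :: 'k point. base + \<delta> *\<^sub>R t)"
    unfolding rational_map_on_def inner_add_left inner_scaleR_left
    by (rule ballI, rule rational_on_add[OF rational_on_const], rule rational_on_mult[OF rational_on_const],
        rule rational_on_linear[OF bounded_linear_inner_left])
  have rF: "rational_map_on UNIV F"
    unfolding rational_map_on_def[of _ F] F_def
  proof
    fix b :: "'k point" assume "b \<in> Basis"
    then have "rational_on UNIV (\<lambda>t. param t \<bullet> b)" using rational_param by (simp add: rational_map_on_def)
    then show "rational_on UNIV (\<lambda>t. param (base + \<delta> *\<^sub>R t) \<bullet> b)" by (rule rational_on_compose[OF _ aff])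
  qed
  have cell: "semialgebraic_cell (card B) (F ` open_cube B)"
  proof (rule semialgebraic_cell_rational[OF sU rG rF B])
    fix t assume t: "t \<in> open_cube B"
    show "F t \<in> U" using nrm[OF t] by (simp add: F_def U_def W_def)
    have "unparam (F t) = base + \<delta> *\<^sub>R t"
      unfolding F_def
    proof (rule unparam_param)
      show "det (krylov (param (base + \<delta> *\<^sub>R t))) \<noteq> 0" using nrm[OF t] by (simp add: W_def)
      show "snd (base + \<delta> *\<^sub>R t) $ i $ j = 0" if "\<not> r i < r j" for i j
        by (rule up[OF cube(2)[OF t that] that])
    qed (rule fl[OF cube(1)[OF t]])
    then show "G (F t) = t" using \<delta> by (simp add: G_def)
  qed
  have sub: "F ` open_cube B \<subseteq> C_set"
  proof (rule image_subsetI)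
    fix t assume t: "t \<in> open_cube B"
    show "F t \<in> C_set"
      unfolding F_def
    proof (rule param_mem_C_set[OF fl[OF cube(1)[OF t]] ps])
      \<comment> \<open>\<open>base\<close> vanishes at the plane entry, so the positive cube
        coordinate there keeps the plane block of \<open>Z\<close> nonzero.\<close>
      have "0 < snd t $ p $ s" using cube(3)[OF t, of p s] ps by simp
      moreover have "snd base $ p $ s = 0" using ps by (simp add: base_def)
      ultimately show "snd (base + \<delta> *\<^sub>R t) $ p $ s \<noteq> 0" using \<delta> by simp
      have "\<not> r s < r p" using ps by simp
      then show "snd (base + \<delta> *\<^sub>R t) $ s $ p = 0" by (intro up cube(2)[OF t])
    qed
  qed
  have "F ` open_cube B \<subseteq> C_set \<and> semialgebraic_cell (n + card {(i, j). r i < r j}) (F ` open_cube B)"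
    using sub cell cB by simp
  then show ?thesis by (rule exI)
qed

end

lemma coordinate_splitting_exists:
  "2 \<le> CARD('k::finite) \<Longrightarrow> \<exists>r :: 'k \<Rightarrow> nat. coordinate_splitting r (CARD('k) - 2)"
proof -
  assume "2 \<le> CARD('k)"
  then have k: "CARD('k) - 2 + 2 = CARD('k)" by simp
  have "\<exists>r. bij_betw r (UNIV :: 'k set) {0..<CARD('k)}"
    by (rule ex_bij_betw_finite_nat) simp
  then show "\<exists>r :: 'k \<Rightarrow> nat. coordinate_splitting r (CARD('k) - 2)"
    unfolding coordinate_splitting_def k .
qed

lemma codim_le_2:
  assumes k: "2 \<le> CARD('k::finite)" and A: "(C_set :: 'k point set) \<subseteq> A"
  shows "codim A \<le> 2"
proof -
  obtain r :: "'k \<Rightarrow> nat" where "coordinate_splitting r (CARD('k) - 2)"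
    using coordinate_splitting_exists[OF k] ..
  then interpret coordinate_splitting r "CARD('k) - 2" .
  define n where "n = CARD('k) - 2"
  define d where "d = n + card {(i, j). r i < r j}"
  have n: "CARD('k) = n + 2" using k by (simp add: n_def)
  have c: "2 * card {(i, j). r i < r j} + (n + 2) = (n + 2) * (n + 2)"
    using card_indices(2) by (simp add: n_def)
  obtain S :: "'k point set" where S: "S \<subseteq> C_set" "semialgebraic_cell d S"
    using C_set_contains_cell unfolding d_def[symmetric] n_def[symmetric] by (elim exE conjE) (rule that)
  have "ereal (real d) \<le> semialgebraic_dim A"
    unfolding semialgebraic_dim_def
  proof (rule Sup_upper)
    have "S \<subseteq> A" using S(1) A by (rule subset_trans)
    then have "\<exists>S\<subseteq>A. semialgebraic_cell d S" using S(2) by (intro exI[of _ S] conjI)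
    then show "ereal (real d) \<in> {ereal (real d) | d. \<exists>S\<subseteq>A. semialgebraic_cell d S}"
      by (intro CollectI exI[of _ d] conjI refl)
  qed
  then have "codim A \<le> ereal (real (dim (carnot_group :: 'k point set))) - ereal (real d)"
    unfolding codim_def by (intro ereal_minus_mono order.refl)
  moreover have "dim (carnot_group :: 'k point set) = d + 2"
  proof -
    \<comment> \<open>The parameters number \<open>n\<close> plus
      \<open>(n + 2) (n + 1) / 2\<close>; the group has two more dimensions, the plane coordinates
      of the flat vector.\<close>
    have "(n + 2) * (n + 2 + 1) = (n + 2) * (n + 2) + (n + 2)" by (simp only: distrib_left mult_1_right)
    also have "\<dots> = 2 * (d + 2)" unfolding c[symmetric] d_def by simp
    finally have "(n + 2) * (n + 2 + 1) div 2 = d + 2" by simp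
    then show ?thesis unfolding dim_carnot_group n .
  qed
  ultimately show ?thesis by simp
qed

section \<open>The chain of inclusions\<close>

lemma P_set_subset_Sigma_set: "P_set \<subseteq> Sigma_set"
  by (auto simp: P_set_def Sigma_set_def carnot_group_def transpose_wedge)

text \<open>The witness is the reflection \<open>2 P - 1\<close>, with \<open>P\<close> the
  orthogonal projection to \<open>ker Y\<close>. It is -1 on the range of \<open>Y\<close>, so it
  reverses the sign of \<open>Y\<close> from the left and from the right, and the two signs
  cancel.\<close>

lemma Sigma_set_subset_C_set: "(Sigma_set :: ('k::finite) point set) \<subseteq> C_set"
proof
  fix q :: "'k point" assume "q \<in> Sigma_set"
  then obtain x Y where q: "q = (x, Y)" "(x, Y) \<in> carnot_group" "Y \<noteq> 0" "Y *v x = 0"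
    unfolding Sigma_set_def by blast
  have tY: "transpose Y = - Y" using q(2) by (simp add: carnot_group_def)
  have sk: "a \<bullet> (Y *v b) = - ((Y *v a) \<bullet> b)" for a b
  proof -
    have "a \<bullet> (Y *v b) = (transpose Y *v a) \<bullet> b" by (metis dot_lmul_matrix transpose_matrix_vector)
    then show ?thesis unfolding tY by (simp add: matrix_vector_mult_def vec_eq_iff sum_negf inner_vec_def)
  qed
  define K where "K = {v. Y *v v = 0}"
  have "subspace K"
    unfolding K_def subspace_def by (simp add: matrix_vector_right_distrib matrix_vector_mult_scaleR)
  then obtain P where P: "linear P" "\<And>z. P z \<in> K" "\<And>z. z \<in> K \<Longrightarrow> P z = z" "\<And>a b. P a \<bullet> b = a \<bullet> P b"
    by (rule orthogonal_projection_exists) blast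
  define f where "f v = 2 *\<^sub>R P v - v" for v
  have lf: "linear f"
    unfolding f_def by (intro linear_compose_sub linear_compose_scale_right P(1) linear_ident)
  define M where "M = matrix f"
  have M: "M *v v = f v" for v unfolding M_def using fun_cong[OF matrix_vector_mul(2)[OF lf]] by simp
  have "f v \<bullet> f w = v \<bullet> w" for v w
  proof -
    have "P v \<bullet> P w = v \<bullet> P w" using P(4)[of v "P w"] P(3)[OF P(2)] by simp
    then show ?thesis using P(4)[of v w] by (simp add: f_def inner_diff_left inner_diff_right)
  qed
  then have "orthogonal_transformation f" using lf by (simp add: orthogonal_transformation_def)
  then have oM: "orthogonal_matrix M" unfolding M_def by (simp add: orthogonal_transformation_matrix)
  \<comment> \<open>The range of a skew matrix is orthogonal to its kernel.\<close>
  have PY: "P (Y *v v) = 0" for v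
  proof -
    have "P (Y *v v) \<bullet> P (Y *v v) = (Y *v v) \<bullet> P (Y *v v)" using P(4)[of "Y *v v"] P(3)[OF P(2)] by simp
    also have "\<dots> = - (v \<bullet> (Y *v P (Y *v v)))" by (simp add: sk)
    also have "\<dots> = 0" using P(2)[of "Y *v v"] by (simp add: K_def)
    finally show ?thesis by simp
  qed
  have MY: "M ** Y = - Y"
  proof -
    have "(M ** Y) *v v = (- Y) *v v" for v
      by (simp add: matrix_vector_mul_assoc[symmetric] M f_def PY)
         (simp add: matrix_vector_mult_def vec_eq_iff sum_negf)
    then show ?thesis by (simp only: matrix_eq) blast
  qed
  have "- (Y ** transpose M) = Y"
    using arg_cong[OF MY, of transpose] by (simp add: matrix_transpose_mul tY transpose_linear matrix_mult_linear)
  then have "- Y = Y ** transpose M" by (simp only: minus_equation_iff[of "Y ** transpose M" Y])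
  then have "Y ** transpose M = - Y" by (rule sym)
  then have "M ** Y ** transpose M = Y" by (simp add: MY matrix_mult_linear)
  moreover have "M \<noteq> mat 1"
  proof
    assume "M = mat 1"
    then have "Y = - Y" using MY by simp
    then have "Y = 0" by (simp add: vec_eq_iff)
    then show False using q(3) by simp
  qed
  moreover have "M *v v = v" if "Y *v v = 0" for v
    using P(3)[of v] that by (simp add: M f_def K_def scaleR_2)
  ultimately show "q \<in> C_set"
    unfolding C_set_def q(1) using q(2-4) oM by blast
qed

lemma strict_inclusions:
  assumes k: "4 \<le> CARD('k::finite)"
  shows "(P_set :: 'k point set) \<noteq> Sigma_set" "(Sigma_set :: 'k point set) \<noteq> C_set"
proof -
  have "2 \<le> CARD('k)" using k by simp
  then obtain r :: "'k \<Rightarrow> nat" where "coordinate_splitting r (CARD('k) - 2)"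
    using coordinate_splitting_exists by blast
  then interpret coordinate_splitting r "CARD('k) - 2" .
  obtain a b p s where abps: "r a = 0" "r b = 1" "r p = CARD('k) - 2" "r s = CARD('k) - 2 + 1"
    using r_surj[of 0] r_surj[of 1] r_surj[of "CARD('k) - 2"] r_surj[of "CARD('k) - 2 + 1"] k by auto
  have ne: "a \<noteq> b" "a \<noteq> p" "a \<noteq> s" "b \<noteq> p" "b \<noteq> s" "p \<noteq> s"
    using abps k by auto
  \<comment> \<open>A matrix of rank four, for which four distinct indices are required; it
    separates both pairs of sets.\<close>
  define Y :: "real ^ 'k ^ 'k" where "Y = wedge (axis a 1) (axis b 1) + wedge (axis p 1) (axis s 1)"
  have tY: "transpose Y = - Y" by (simp add: Y_def transpose_linear transpose_wedge)
  have Yv: "Y $ a $ b = 1" "Y $ b $ a = - 1" "Y $ p $ s = 1" "Y $ a $ p = 0" "Y $ b $ s = 0" "Y $ a $ s = 0" "Y $ b $ p = 0"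
    using ne by (simp_all add: Y_def axis_def)
  have Y0: "Y \<noteq> 0" using Yv(1) by auto
  have "(0, Y) \<in> Sigma_set"
    by (simp add: Sigma_set_def carnot_group_def tY Y0 matrix_vector_mult_0_right)
  moreover have "(0, Y) \<notin> P_set"
  proof
    assume "(0, Y) \<in> P_set"
    then obtain v w where vw: "Y = wedge v w" by (auto simp: P_set_def)
    define m where "m i j = v $ i * w $ j - w $ i * v $ j" for i j
    \<comment> \<open>The Pluecker relation for the 2 by 2 minors of \<open>v\<close> and
      \<open>w\<close>; for this \<open>Y\<close> its first product is 1 and the others are
      0.\<close>
    have "m a b * m p s - m a p * m b s + m a s * m b p = 0"
      unfolding m_def by (simp add: algebra_simps)
    moreover have "m i j = Y $ i $ j" for i j by (simp add: vw m_def)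
    ultimately show False using Yv by simp
  qed
  ultimately show "(P_set :: 'k point set) \<noteq> Sigma_set" by blast
  have "block_diag Y"
    unfolding block_diag_def
  proof (intro allI impI)
    fix i j assume ij: "\<not> same i j"
    have "r a < CARD('k) - 2" "r b < CARD('k) - 2" using abps k by simp_all
    then show "Y $ i $ j = 0"
      using ij abps by (auto simp: Y_def axis_def same_def)
  qed
  moreover have "flat (axis a 1)" using abps k by (auto simp: flat_def axis_def)
  \<comment> \<open>The untilted case \<open>X = 0\<close>: \<open>Y\<close> preserves the plane of
    \<open>p\<close> and \<open>s\<close>, and the axis of \<open>a\<close> is orthogonal to that
    plane without lying in \<open>ker Y\<close>.\<close>
  ultimately have "((mat 1 + 0) *v axis a 1, (mat 1 + 0) ** Y ** (mat 1 - 0)) \<in> C_set"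
    using tY abps Yv
    by (intro conjugate_mem_C_set[where p = p and s = s]) (simp_all add: transpose_linear block_off_def)
  then have "(axis a 1, Y) \<in> C_set" by simp
  moreover have "(axis a 1, Y) \<notin> Sigma_set"
  proof
    assume "(axis a 1, Y) \<in> Sigma_set"
    then have "(Y *v axis a 1) $ b = 0" by (simp add: Sigma_set_def)
    then show False using Yv(2) by (simp add: matrix_vector_mult_axis)
  qed
  ultimately show "(Sigma_set :: 'k point set) \<noteq> C_set" by blast
qed

theorem theorem11:
  assumes "CARD('k::finite) \<ge> 2"
  shows "(CARD('k) \<ge> 4 \<longrightarrow>
           (P_set :: 'k point set) \<subset> Sigma_set \<and>
           (Sigma_set :: 'k point set) \<subset> C_set \<and>
           (C_set :: 'k point set) \<subseteq> cut_locus) \<and>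
         (semialgebraic (cut_locus :: 'k point set) \<longrightarrow> codim (cut_locus :: 'k point set) \<le> 2)"
proof (intro conjI impI)
  assume k: "CARD('k) \<ge> 4"
  show "(P_set :: 'k point set) \<subset> Sigma_set"
    using P_set_subset_Sigma_set strict_inclusions(1)[OF k] by (rule psubsetI)
  show "(Sigma_set :: 'k point set) \<subset> C_set"
    using Sigma_set_subset_C_set strict_inclusions(2)[OF k] by (rule psubsetI)
  show "(C_set :: 'k point set) \<subseteq> cut_locus" by (rule C_set_subset_cut_locus)
next
  show "codim (cut_locus :: 'k point set) \<le> 2"
    by (rule codim_le_2[OF assms C_set_subset_cut_locus])
qed

end
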